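(* There exist universal constants $c,C>0$ such that, for all sufficiently large integers $n$, the following holds. Put $m=n^3$, let $\Gamma$ be an $n\times m$ random matrix with independent standard Gaussian entries, and let $G_m=\Gamma(B_1^m)$, i.e. $G_m$ is the absolutely convex hull of the columns of $\Gamma$. Then $$ \mathbb P\left\{d_{\mathrm{BM}}(G_m,B_1^n)\ge c\, n^{5/8}(\log n)^{-1/4}\right\}\ \ge\ 1-\frac{C}{n}. $$ Consequently, for all sufficiently large $n$, $$ R_1(n)\ \ge\ c\, n^{5/8}(\log n)^{-1/4}, $$ where $R_1(n)=\sup\{d_{\mathrm{BM}}(K,B_1^n): K\subset\mathbb R^n \text{ is an origin-symmetric convex body}\}$.
   Context: All logarithms are natural. $B_1^N=\operatorname{conv}\{\pm e_1,\ldots,\pm e_N\}\subset\mathbb R^N$ is the cross-polytope (closed unit ball of $\ell_1^N$). The absolutely convex hull of vectors $g_1,\ldots,g_m$ is $\{\sum_j a_j g_j:\sum_j|a_j|\le 1\}$. For origin-symmetric convex bodies $K,L\subset\mathbb R^n$ the Banach-Mazur distance is $$ d_{\mathrm{BM}}(K,L)=\inf\{\rho\ge 1:\ \exists\, T\in GL(n),\ T(K)\subset L\subset \rho\, T(K)\}. $$ *)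

theory Defs
  imports "HOL-Probability.Probability"
begin

text \<open>
  The dimension is quantified inside the theorem, so it cannot be a type.  Vectors of
  \<open>\<real>\<^sup>n\<close> are the points of the library space \<^const>\<open>Euclidean_space\<close> \<open>n\<close>: functions
  \<open>nat \<Rightarrow> real\<close> vanishing at all indices \<open>\<ge> n\<close>, with coordinates indexed by \<open>{..<n}\<close>.
  Matrices are functions \<open>nat \<times> nat \<Rightarrow> real\<close>; an \<open>n \<times> m\<close> matrix only has its entries in
  \<open>{..<n} \<times> {..<m}\<close> used.
\<close>

abbreviation Rn :: "nat \<Rightarrow> (nat \<Rightarrow> real) set" where
  "Rn n \<equiv> topspace (Euclidean_space n)"

text \<open>
  Componentwise form of \<^const>\<open>convex\<close>, which requires a type of class \<open>real_vector\<close>.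
\<close>

definition convex_fun :: "(nat \<Rightarrow> real) set \<Rightarrow> bool" where
  "convex_fun K \<longleftrightarrow> (\<forall>x\<in>K. \<forall>y\<in>K. \<forall>u\<ge>0. \<forall>v\<ge>0. u + v = 1 \<longrightarrow> (\<lambda>i. u * x i + v * y i) \<in> K)"

definition unit_vec :: "nat \<Rightarrow> nat \<Rightarrow> real" where
  "unit_vec i = (\<lambda>k. if k = i then 1 else 0)"

definition cross_polytope :: "nat \<Rightarrow> (nat \<Rightarrow> real) set" where
  "cross_polytope N = convex_fun hull (\<Union>i<N. {unit_vec i, \<lambda>k. - unit_vec i k})"

definition mat_apply :: "nat \<Rightarrow> nat \<Rightarrow> (nat \<times> nat \<Rightarrow> real) \<Rightarrow> (nat \<Rightarrow> real) \<Rightarrow> nat \<Rightarrow> real" where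
  "mat_apply n m A x = (\<lambda>i. if i < n then (\<Sum>j<m. A (i, j) * x j) else 0)"

definition GL :: "nat \<Rightarrow> (nat \<times> nat \<Rightarrow> real) set" where
  "GL n = {T. \<exists>S. \<forall>x\<in>Rn n. mat_apply n n S (mat_apply n n T x) = x \<and>
                           mat_apply n n T (mat_apply n n S x) = x}"

definition sym_convex_body :: "nat \<Rightarrow> (nat \<Rightarrow> real) set \<Rightarrow> bool" where
  "sym_convex_body n K \<longleftrightarrow>
     compactin (Euclidean_space n) K \<and> convex_fun K \<and>
     Euclidean_space n interior_of K \<noteq> {} \<and> (\<forall>x\<in>K. (\<lambda>i. - x i) \<in> K)"

text \<open>
  The infimum is taken in the extended reals, so an empty set of admissible \<open>\<rho>\<close> gives
  \<open>\<infinity>\<close>.  For two origin-symmetric convex bodies that set is never empty.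
\<close>

definition BM_dist :: "nat \<Rightarrow> (nat \<Rightarrow> real) set \<Rightarrow> (nat \<Rightarrow> real) set \<Rightarrow> ereal" where
  "BM_dist n K L =
     Inf {ereal \<rho> | \<rho>. \<rho> \<ge> 1 \<and>
       (\<exists>T\<in>GL n. mat_apply n n T ` K \<subseteq> L \<and> L \<subseteq> (\<lambda>x i. \<rho> * x i) ` (mat_apply n n T ` K))}"

definition R1 :: "nat \<Rightarrow> ereal" where
  "R1 n = (SUP K\<in>{K. sym_convex_body n K}. BM_dist n K (cross_polytope n))"

text \<open>
  The law of an \<open>n \<times> m\<close> matrix with independent standard Gaussian entries, so that the
  random matrix is the identity map on this probability space.
\<close>

definition gaussian_matrix :: "nat \<Rightarrow> nat \<Rightarrow> (nat \<times> nat \<Rightarrow> real) measure" where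
  "gaussian_matrix n m =
     (\<Pi>\<^sub>M p\<in>{..<n} \<times> {..<m}. density lborel (\<lambda>x. ennreal (std_normal_density x)))"

lemma prob_space_std_normal: "prob_space (density lborel (\<lambda>x. ennreal (std_normal_density x)))"
  by (rule prob_space_normal_density) simp

lemma prob_space_gaussian_matrix: "prob_space (gaussian_matrix n m)"
  unfolding gaussian_matrix_def by (intro prob_space_PiM prob_space_std_normal)

lemma gaussian_matrix_entry:
  assumes "i < n" "j < m"
  shows "distributed (gaussian_matrix n m) lborel (\<lambda>G. G (i, j)) std_normal_density"
proof -
  let ?N = "density lborel (\<lambda>x. ennreal (std_normal_density x))"
  have "distr (gaussian_matrix n m) ?N (\<lambda>G. G (i, j)) = ?N"
    unfolding gaussian_matrix_def using assms
    by (intro distr_PiM_component prob_space_std_normal) auto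
  moreover have "distr (gaussian_matrix n m) lborel (\<lambda>G. G (i, j)) =
      distr (gaussian_matrix n m) ?N (\<lambda>G. G (i, j))"
    by (intro distr_cong) auto
  moreover have "(\<lambda>G. G (i, j)) \<in> measurable (gaussian_matrix n m) ?N"
    unfolding gaussian_matrix_def using assms by (intro measurable_component_singleton) auto
  ultimately show ?thesis
    by (simp add: distributed_def)
qed

lemma gaussian_matrix_indep:
  "prob_space.indep_vars (gaussian_matrix n m) (\<lambda>_. borel) (\<lambda>p G. G p) ({..<n} \<times> {..<m})"
proof (cases "{..<n} \<times> {..<m} = {}")
  case True
  interpret prob_space "gaussian_matrix n m" by (rule prob_space_gaussian_matrix)
  show ?thesis unfolding True indep_vars_def indep_sets_def by simp
next
  case False
  let ?N = "density lborel (\<lambda>x. ennreal (std_normal_density x))"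
  interpret prob_space "gaussian_matrix n m" by (rule prob_space_gaussian_matrix)
  have "random_variable borel (\<lambda>G. G p)" if "p \<in> {..<n} \<times> {..<m}" for p
  proof -
    have "(\<lambda>G. G p) \<in> measurable (gaussian_matrix n m) ?N"
      unfolding gaussian_matrix_def using that by (intro measurable_component_singleton)
    then show ?thesis by simp
  qed
  note rv = this
  have "distr (gaussian_matrix n m) (\<Pi>\<^sub>M p\<in>{..<n} \<times> {..<m}. borel)
        (\<lambda>G. \<lambda>p\<in>{..<n} \<times> {..<m}. G p) =
      (\<Pi>\<^sub>M p\<in>{..<n} \<times> {..<m}. distr (gaussian_matrix n m) borel (\<lambda>G. G p))"
  proof -
    have "distr (gaussian_matrix n m) borel (\<lambda>G. G p) = ?N"
      if "p \<in> {..<n} \<times> {..<m}" for p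
    proof -
      have "distr (gaussian_matrix n m) borel (\<lambda>G. G p) =
          distr (gaussian_matrix n m) ?N (\<lambda>G. G p)"
        by (intro distr_cong) auto
      also have "\<dots> = ?N"
        unfolding gaussian_matrix_def using that
        by (intro distr_PiM_component prob_space_std_normal) auto
      finally show ?thesis .
    qed
    then have "(\<Pi>\<^sub>M p\<in>{..<n} \<times> {..<m}. distr (gaussian_matrix n m) borel (\<lambda>G. G p)) =
        gaussian_matrix n m"
      unfolding gaussian_matrix_def by (intro PiM_cong) auto
    moreover have "distr (gaussian_matrix n m) (\<Pi>\<^sub>M p\<in>{..<n} \<times> {..<m}. borel)
        (\<lambda>G. \<lambda>p\<in>{..<n} \<times> {..<m}. G p) =
        distr (gaussian_matrix n m) (gaussian_matrix n m) (\<lambda>G. G)"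
    proof (rule distr_cong)
      show "sets (\<Pi>\<^sub>M p\<in>{..<n} \<times> {..<m}. borel) = sets (gaussian_matrix n m)"
        unfolding gaussian_matrix_def by (intro sets_PiM_cong) auto
      show "(\<lambda>p\<in>{..<n} \<times> {..<m}. G p) = G" if "G \<in> space (gaussian_matrix n m)" for G
        using that unfolding gaussian_matrix_def space_PiM by (intro PiE_restrict) auto
    qed simp
    ultimately show ?thesis by (simp add: distr_id)
  qed
  then show ?thesis
    using indep_vars_iff_distr_eq_PiM'[where M' = "\<lambda>_. borel" and X = "\<lambda>p G. G p", OF False rv]
    by simp
qed

lemma cross_polytope_eq_l1_ball:
  assumes "N > 0"
  shows "cross_polytope N = {x \<in> Rn N. (\<Sum>i<N. \<bar>x i\<bar>) \<le> 1}"
  unfolding cross_polytope_def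
proof (rule hull_unique)
  let ?B = "\<lambda>N. {x \<in> Rn N. (\<Sum>i<N. \<bar>x i\<bar>) \<le> 1}"
  have "(\<Sum>k<N. \<bar>unit_vec i k\<bar>) = 1" if "i < N" for i
  proof -
    have "(\<Sum>k<N. \<bar>unit_vec i k\<bar>) = (\<Sum>k<N. if k = i then 1 else 0)"
      unfolding unit_vec_def by (intro sum.cong) auto
    then show ?thesis using that by simp
  qed
  then show "(\<Union>i<N. {unit_vec i, \<lambda>k. - unit_vec i k}) \<subseteq> ?B N"
    by (auto simp: topspace_Euclidean_space) (auto simp: unit_vec_def)
  show "convex_fun (?B N)"
    unfolding convex_fun_def
  proof (intro ballI allI impI)
    fix x y and u v :: real
    assume *: "x \<in> ?B N" "y \<in> ?B N" "0 \<le> u" "0 \<le> v" "u + v = 1"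
    have "(\<Sum>i<N. \<bar>u * x i + v * y i\<bar>) \<le> (\<Sum>i<N. u * \<bar>x i\<bar> + v * \<bar>y i\<bar>)"
      using * by (intro sum_mono) (metis abs_mult abs_of_nonneg abs_triangle_ineq)
    also have "\<dots> = u * (\<Sum>i<N. \<bar>x i\<bar>) + v * (\<Sum>i<N. \<bar>y i\<bar>)"
      by (simp add: sum.distrib sum_distrib_left)
    also have "\<dots> \<le> 1"
      using * by (intro convex_bound_le) auto
    finally show "(\<lambda>i. u * x i + v * y i) \<in> ?B N"
      using * by (auto simp: topspace_Euclidean_space)
  qed
  fix K
  assume sub: "(\<Union>i<N. {unit_vec i, \<lambda>k. - unit_vec i k}) \<subseteq> K" and conv: "convex_fun K"
  have cD: "(\<lambda>i. u * x i + v * y i) \<in> K"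
    if "x \<in> K" "y \<in> K" "0 \<le> u" "0 \<le> v" "u + v = 1" for x y u v
    using conv that unfolding convex_fun_def by blast
  have unit: "(\<lambda>k. s * unit_vec i k) \<in> K" if "\<bar>s\<bar> \<le> 1" "i < N" for s i
  proof -
    have "(\<lambda>k. (1 + s) / 2 * unit_vec i k + (1 - s) / 2 * (- unit_vec i k)) \<in> K"
      using sub that by (intro cD) (auto simp: field_simps)
    then show ?thesis by (simp add: field_simps)
  qed
  have "\<forall>x. (\<forall>i\<ge>M. x i = 0) \<longrightarrow> (\<Sum>i<M. \<bar>x i\<bar>) \<le> 1 \<longrightarrow> x \<in> K" if "M \<le> N" for M
    using that
  proof (induction M)
    case 0
    show ?case
    proof (intro allI impI)
      fix x :: "nat \<Rightarrow> real"
      assume "\<forall>i\<ge>0. x i = 0"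
      then have "x = (\<lambda>k. 0 * unit_vec 0 k)" by (intro ext) simp
      moreover have "(\<lambda>k. 0 * unit_vec 0 k) \<in> K" by (rule unit) (use assms in auto)
      ultimately show "x \<in> K" by (simp only:)
    qed
  next
    case (Suc M)
    show ?case
    proof (intro allI impI)
      fix x :: "nat \<Rightarrow> real"
      assume x: "\<forall>i\<ge>Suc M. x i = 0" and le: "(\<Sum>i<Suc M. \<bar>x i\<bar>) \<le> 1"
      define t where "t = (\<Sum>i<M. \<bar>x i\<bar>)"
      have t: "t \<ge> 0" "t + \<bar>x M\<bar> \<le> 1"
        using le by (auto simp: t_def sum_nonneg)
      show "x \<in> K"
      proof (cases "t = 0")
        case True
        then have "\<forall>i<M. x i = 0"
          unfolding t_def by (subst (asm) sum_nonneg_eq_0_iff) auto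
        have "x = (\<lambda>k. x M * unit_vec M k)"
        proof
          fix k
          show "x k = x M * unit_vec M k"
            using x \<open>\<forall>i<M. x i = 0\<close>
            by (cases k M rule: linorder_cases) (auto simp: unit_vec_def)
        qed
        then show ?thesis using unit[of "x M" M] t Suc.prems by auto
      next
        case False
        define y where "y = (\<lambda>i. if i < M then x i / t else 0)"
        have "(\<Sum>i<M. \<bar>y i\<bar>) = (\<Sum>i<M. \<bar>x i\<bar>) / t"
          using t False by (simp add: y_def sum_divide_distrib abs_divide)
        then have "(\<Sum>i<M. \<bar>y i\<bar>) \<le> 1" using False by (simp add: t_def)
        then have y: "y \<in> K" using Suc.IH Suc.prems by (auto simp: y_def)
        show ?thesis
        proof (cases "t = 1")
          case True
          then have "x M = 0" using t by simp
          then have "x = y" using x True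
            by (intro ext) (metis (full_types) div_by_1 le_antisym not_less not_less_eq_eq y_def)
          then show ?thesis using y by simp
        next
          case ne: False
          then have lt: "t < 1" using t by linarith
          have "(\<lambda>k. t * y k + (1 - t) * (x M / (1 - t) * unit_vec M k)) \<in> K"
            using t lt Suc.prems y by (intro cD unit) (auto simp: abs_divide divide_simps)
          moreover have "(\<lambda>k. t * y k + (1 - t) * (x M / (1 - t) * unit_vec M k)) = x"
          proof
            fix k
            show "t * y k + (1 - t) * (x M / (1 - t) * unit_vec M k) = x k"
              using x False lt by (cases k M rule: linorder_cases) (auto simp: y_def unit_vec_def)
          qed
          ultimately show ?thesis by simp
        qed
      qed
    qed
  qed
  then show "?B N \<subseteq> K" by (auto simp: topspace_Euclidean_space)
qed

lemma mat_image_cross_polytope: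
  assumes "m > 0"
  shows "mat_apply n m G ` cross_polytope m =
    {\<lambda>i. \<Sum>j<m. a j * (if i < n then G (i, j) else 0) | a. (\<Sum>j<m. \<bar>a j\<bar>) \<le> 1}"
    (is "?L = ?R")
proof
  show "?L \<subseteq> ?R"
  proof
    fix z
    assume "z \<in> ?L"
    then obtain x where x: "(\<Sum>j<m. \<bar>x j\<bar>) \<le> 1" "z = mat_apply n m G x"
      by (auto simp: cross_polytope_eq_l1_ball[OF assms])
    then have "z = (\<lambda>i. \<Sum>j<m. x j * (if i < n then G (i, j) else 0))"
      by (auto simp: mat_apply_def fun_eq_iff mult.commute)
    then show "z \<in> ?R" using x by blast
  qed
  show "?R \<subseteq> ?L"
  proof
    fix z
    assume "z \<in> ?R"
    then obtain a where a: "(\<Sum>j<m. \<bar>a j\<bar>) \<le> 1"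
      "z = (\<lambda>i. \<Sum>j<m. a j * (if i < n then G (i, j) else 0))" by blast
    define x where "x = (\<lambda>j. if j < m then a j else 0)"
    have "x \<in> cross_polytope m"
      using a by (simp add: cross_polytope_eq_l1_ball[OF assms] x_def topspace_Euclidean_space)
    moreover have "z = mat_apply n m G x"
      by (auto simp: a mat_apply_def x_def fun_eq_iff mult.commute intro!: sum.cong)
    ultimately show "z \<in> ?L" by blast
  qed
qed

end

theory Submission
  imports Defs "HOL-Real_Asymp.Real_Asymp"
begin

text \<open>
  If \<open>d(G\<^sub>m, B\<^sub>1\<^sup>n) < \<rho>\<close>, there are a matrix \<open>T\<close> with rows \<open>T\<^sub>i\<close> and vectors \<open>x\<^sub>i \<in> \<rho> G\<^sub>m\<close> with
  \<open>\<Sum>\<^sub>i x\<^sub>i T\<^sub>i\<^sup>T = Id\<close> and \<open>\<parallel>T \<gamma>\<parallel>\<^sub>1 \<le> 1\<close> for every column \<open>\<gamma>\<close> of \<open>\<Gamma>\<close>.  A net argument turns the latter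
  into \<open>\<Sum>\<^sub>i \<parallel>T\<^sub>i\<parallel>\<^sub>2 \<le> 64\<close>.  For an orthogonal projection \<open>W\<close> of rank \<open>D\<close> the trace identity gives
  \<open>D = \<Sum>\<^sub>i \<langle>T\<^sub>i, W x\<^sub>i\<rangle> \<le> \<Sum>\<^sub>i \<parallel>T\<^sub>i\<parallel> \<parallel>W x\<^sub>i\<parallel>\<close>, so it suffices to find \<open>W\<close> of rank at least \<open>2l\<close> with
  all \<open>W x\<^sub>i\<close> small, apart from the \<open>4l\<close> indices with the smallest \<open>\<parallel>T\<^sub>i\<parallel>\<close>.

  Write \<open>x\<^sub>i = \<Gamma> a\<^sub>i\<close> and let \<open>a\<^sub>i'\<close> be a \<open>k\<close>-term Maurey approximation of \<open>a\<^sub>i\<close>.  Start with the \<open>W\<close> that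
  kills the \<open>\<Gamma> a\<^sub>i'\<close> of the other indices, and let it kill greedily fewer than \<open>l\<close> columns so that all \<open>\<parallel>W \<gamma>\<parallel>\<^sup>2\<close> become
  \<open>O(l)\<close>.  A second Maurey approximation \<open>a\<^sub>i''\<close>, chosen after \<open>W\<close>, then satisfies
  \<open>\<parallel>W \<Gamma> (a\<^sub>i - a\<^sub>i'')\<parallel> = O(\<rho> \<surd>(l / k))\<close>, and a second greedy step makes the differences
  \<open>W \<Gamma> (a\<^sub>i'' - a\<^sub>i')\<close> equally small.  Each greedy step succeeds: by rotation invariance, \<open>l\<close> failures in
  a row for a fixed choice of directions have probability \<open>exp (- c l\<^sup>2)\<close>, while there are only
  \<open>exp (O(n k ln n))\<close> choices.  The parameters \<open>l \<approx> n\<^sup>3\<^sup>/\<^sup>4 \<surd>ln n\<close> and \<open>k \<approx> \<surd>n\<close> give the bound.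
\<close>

section \<open>Finite-dimensional inner products on functions\<close>

text \<open>\<open>W\<close> has to react to \<open>\<Gamma>\<close>, whereas a union bound needs
  candidates fixed beforehand. The way out is to record the killed directions as orthonormal lists
  in the coefficient space R^m: these lists range over a finite set in which \<open>\<Gamma>\<close>
  does not occur, and only their images are random. Images of orthonormal vectors are independent
  Gaussian columns, so the bounds for successive failures multiply. Two Maurey steps are needed
  because the first comes before \<open>W\<close>, which is built from it, and so controls only the
  coefficient error, which \<open>\<Gamma>\<close> may enlarge. The second is adapted to
  \<open>W\<close>; the differences of the two are again only \<open>n\<close> directions for the
  greedy step. The parameters: the union bound wants \<open>l^2\<close> to dominate
  \<open>n k ln n\<close>, and the trace inequality is contradictory while \<open>\<rho>\<close> is
  below small multiples of both \<open>n / sqrt l\<close> and \<open>sqrt (l k)\<close>. For the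
  chosen values the first is n^(5/8) (ln n)^(-1/4), and the second is larger by a factor
  \<open>sqrt (ln n)\<close>. Sums run over an arbitrary index set because vectors of R^n and R^m
  and whole matrices, indexed by pairs, are all treated alike.\<close>

definition ip :: "'a set \<Rightarrow> ('a \<Rightarrow> real) \<Rightarrow> ('a \<Rightarrow> real) \<Rightarrow> real" where
  "ip I x y = (\<Sum>b\<in>I. x b * y b)"

abbreviation sq_norm :: "'a set \<Rightarrow> ('a \<Rightarrow> real) \<Rightarrow> real" where
  "sq_norm I x \<equiv> ip I x x"

lemma ip_commute: "ip I x y = ip I y x"
  by (simp add: ip_def mult.commute)

lemma ip_cong: "(\<And>b. b \<in> I \<Longrightarrow> x b = x' b) \<Longrightarrow> (\<And>b. b \<in> I \<Longrightarrow> y b = y' b) \<Longrightarrow> ip I x y = ip I x' y'"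
  by (auto simp: ip_def intro!: sum.cong)

lemma ip_add_left: "ip I (\<lambda>b. x b + y b) z = ip I x z + ip I y z"
  and ip_add_right: "ip I z (\<lambda>b. x b + y b) = ip I z x + ip I z y"
  and ip_diff_left: "ip I (\<lambda>b. x b - y b) z = ip I x z - ip I y z"
  and ip_diff_right: "ip I z (\<lambda>b. x b - y b) = ip I z x - ip I z y"
  and ip_scale_left: "ip I (\<lambda>b. c * x b) z = c * ip I x z"
  and ip_scale_right: "ip I z (\<lambda>b. c * x b) = c * ip I z x"
  and ip_zero_left: "ip I (\<lambda>b. 0) z = 0"
  and ip_zero_right: "ip I z (\<lambda>b. 0) = 0"
  by (simp_all add: ip_def algebra_simps sum.distrib sum_subtractf sum_distrib_left)

lemma ip_sum_left: "ip I (\<lambda>b. \<Sum>s\<in>S. f s b) z = (\<Sum>s\<in>S. ip I (f s) z)"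
  unfolding ip_def sum_distrib_right by (rule sum.swap)

lemma ip_sum_right: "ip I z (\<lambda>b. \<Sum>s\<in>S. f s b) = (\<Sum>s\<in>S. ip I z (f s))"
  unfolding ip_def sum_distrib_left by (rule sum.swap)

lemma ip_self_nonneg [simp]: "0 \<le> sq_norm I x"
  by (simp add: ip_def sum_nonneg)

lemma ip_self_eq_0: "finite I \<Longrightarrow> sq_norm I x = 0 \<longleftrightarrow> (\<forall>b\<in>I. x b = 0)"
  unfolding ip_def by (subst sum_nonneg_eq_0_iff) auto

lemma ip_self_eq_0_imp: "finite I \<Longrightarrow> sq_norm I x = 0 \<Longrightarrow> ip I x y = 0"
  by (simp add: ip_self_eq_0) (simp add: ip_def)

lemma ip_triangle: "sqrt (sq_norm I (\<lambda>b. x b + y b)) \<le> sqrt (sq_norm I x) + sqrt (sq_norm I y)"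
  using L2_set_triangle_ineq[of x y I] by (simp add: L2_set_def ip_def power2_eq_square)

section \<open>Orthonormal lists, orthogonal residuals and Bessel's inequality\<close>

definition orthonormal :: "'a set \<Rightarrow> ('a \<Rightarrow> real) list \<Rightarrow> bool" where
  "orthonormal I us \<longleftrightarrow>
     (\<forall>i<length us. \<forall>j<length us. ip I (us ! i) (us ! j) = (if i = j then 1 else 0))"

lemma orthonormal_Nil [simp]: "orthonormal I []"
  by (simp add: orthonormal_def)

lemma orthonormal_snoc:
  "orthonormal I (us @ [u]) \<longleftrightarrow> orthonormal I us \<and> sq_norm I u = 1 \<and> (\<forall>v\<in>set us. ip I u v = 0)"
  (is "?L = ?R")
proof
  assume L: ?L
  have "orthonormal I us"
    unfolding orthonormal_def
  proof (intro allI impI)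
    fix i j assume "i < length us" "j < length us"
    then show "ip I (us ! i) (us ! j) = (if i = j then 1 else 0)"
      using L[unfolded orthonormal_def, rule_format, of i j] by (simp add: nth_append)
  qed
  moreover have "sq_norm I u = 1"
    using L[unfolded orthonormal_def, rule_format, of "length us" "length us"] by simp
  moreover have "ip I u (us ! i) = 0" if "i < length us" for i
    using L[unfolded orthonormal_def, rule_format, of "length us" i] that by (simp add: nth_append)
  ultimately show ?R by (auto simp: in_set_conv_nth)
next
  assume R: ?R
  then show ?L
    by (auto simp: orthonormal_def nth_append less_Suc_eq ip_commute)
qed

text \<open>A homogeneous linear system with fewer equations than unknowns: equation
  \<open>a\<close> is solved for a coordinate \<open>b\<close> with \<open>y a b \<noteq> 0\<close>,
  which is then eliminated from the other equations and removed from \<open>I\<close>.\<close>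

lemma exists_orth_nonzero:
  assumes "finite K" "finite I" "card K < card I"
  shows "\<exists>z. (\<exists>b\<in>I. z b \<noteq> 0) \<and> (\<forall>a\<in>K. ip I z (y a) = 0)"
  using assms
proof (induction K arbitrary: I y rule: finite_induct)
  case empty
  then obtain b where "b \<in> I" by fastforce
  then show ?case by (intro exI[of _ "\<lambda>_. 1"]) auto
next
  case (insert a K)
  show ?case
  proof (cases "\<forall>b\<in>I. y a b = 0")
    case True
    obtain z where "\<exists>b\<in>I. z b \<noteq> 0" "\<forall>c\<in>K. ip I z (y c) = 0"
      using insert.IH[of I y] insert.prems insert.hyps by auto
    moreover have "ip I z (y a) = 0" using True by (simp add: ip_def)
    ultimately show ?thesis by auto
  next
    case False
    then obtain b where b: "b \<in> I" "y a b \<noteq> 0" by blast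
    define J where "J = I - {b}"
    define y' where "y' c = (\<lambda>i. y c i - (y c b / y a b) * y a i)" for c
    have "finite J" "card K < card J"
      using insert.prems insert.hyps b by (auto simp: J_def)
    from insert.IH[OF this, of y'] obtain z where
      z: "\<exists>b\<in>J. z b \<noteq> 0" "\<forall>c\<in>K. ip J z (y' c) = 0" by auto
    define w where "w = z(b := - ip J z (y a) / y a b)"
    have I: "I = insert b J" "b \<notin> J" using b by (auto simp: J_def)
    have ipw: "ip I w x = ip J z x - ip J z (y a) / y a b * x b" for x
    proof -
      have "(\<Sum>i\<in>J. w i * x i) = (\<Sum>i\<in>J. z i * x i)"
        using I by (intro sum.cong) (auto simp: w_def)
      then show ?thesis
        using I \<open>finite J\<close> by (simp add: ip_def w_def)
    qed
    have "ip I w (y a) = 0" using b by (simp add: ipw)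
    moreover have "ip I w (y c) = 0" if "c \<in> K" for c
    proof -
      have "ip J z (y' c) = ip J z (y c) - (y c b / y a b) * ip J z (y a)"
        unfolding y'_def by (simp only: ip_diff_right ip_scale_right)
      then show ?thesis using z that by (simp add: ipw)
    qed
    moreover have "\<exists>b\<in>I. w b \<noteq> 0" using z(1) I by (auto simp: w_def)
    ultimately show ?thesis by auto
  qed
qed

lemma exists_orth_unit:
  assumes "finite I" "length vs < card I"
  shows "\<exists>z. sq_norm I z = 1 \<and> (\<forall>v\<in>set vs. ip I z v = 0)"
proof -
  have "card (set vs) < card I" using assms(2) card_length[of vs] by linarith
  from exists_orth_nonzero[OF _ assms(1) this, of "\<lambda>v. v"]
  obtain z where z: "\<exists>b\<in>I. z b \<noteq> 0" "\<forall>v\<in>set vs. ip I z v = 0" by auto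
  then have "sq_norm I z \<noteq> 0" using ip_self_eq_0[OF assms(1)] by blast
  then have pos: "sq_norm I z > 0" by (simp add: order_le_neq_trans)
  define w where "w = (\<lambda>b. (1 / sqrt (sq_norm I z)) * z b)"
  have "sq_norm I w = 1" unfolding w_def ip_scale_left ip_scale_right using pos by simp
  moreover have "\<forall>v\<in>set vs. ip I w v = 0" unfolding w_def ip_scale_left using z by simp
  ultimately show ?thesis by blast
qed

lemma exists_orthonormal_complement:
  assumes "finite I" "length vs + d \<le> card I"
  shows "\<exists>ws. length ws = d \<and> orthonormal I ws \<and> (\<forall>w\<in>set ws. \<forall>v\<in>set vs. ip I w v = 0)"
  using assms(2)
proof (induction d)
  case (Suc d)
  then obtain ws where ws: "length ws = d" "orthonormal I ws" "\<forall>w\<in>set ws. \<forall>v\<in>set vs. ip I w v = 0"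
    by auto
  obtain z where "sq_norm I z = 1" "\<forall>v\<in>set (vs @ ws). ip I z v = 0"
    using exists_orth_unit[OF assms(1), of "vs @ ws"] ws Suc.prems by auto
  then show ?case
    using ws by (intro exI[of _ "ws @ [z]"]) (auto simp: orthonormal_snoc)
qed auto

text \<open>The component orthogonal to the span when \<open>us\<close> is orthonormal; families
  that may be neither normalised nor independent are handled by \<open>gs_residual\<close>.\<close>

definition residual :: "'a set \<Rightarrow> ('a \<Rightarrow> real) list \<Rightarrow> ('a \<Rightarrow> real) \<Rightarrow> 'a \<Rightarrow> real" where
  "residual I us y = (\<lambda>b. y b - (\<Sum>i<length us. ip I y (us ! i) * (us ! i) b))"

lemma residual_orth:
  assumes "orthonormal I us" "v \<in> set us"
  shows "ip I (residual I us y) v = 0"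
proof -
  obtain j where j: "j < length us" "v = us ! j" using assms by (auto simp: in_set_conv_nth)
  have "ip I (residual I us y) v = ip I y v - (\<Sum>i<length us. ip I y (us ! i) * ip I (us ! i) v)"
    unfolding residual_def by (simp add: ip_diff_left ip_sum_left ip_scale_left)
  also have "(\<Sum>i<length us. ip I y (us ! i) * ip I (us ! i) v) = (\<Sum>i<length us. if i = j then ip I y v else 0)"
    using assms(1) j by (intro sum.cong) (auto simp: orthonormal_def)
  finally show ?thesis using j by simp
qed

lemma residual_norm:
  assumes "orthonormal I us"
  shows "sq_norm I (residual I us y) = sq_norm I y - (\<Sum>i<length us. (ip I y (us ! i))\<^sup>2)"
proof -
  let ?r = "residual I us y"
  have r: "?r = (\<lambda>b. y b - (\<Sum>i<length us. ip I y (us ! i) * (us ! i) b))"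
    by (rule residual_def)
  have "sq_norm I ?r = ip I ?r (\<lambda>b. y b - (\<Sum>i<length us. ip I y (us ! i) * (us ! i) b))"
    by (simp only: flip: r)
  also have "\<dots> = ip I ?r y - (\<Sum>i<length us. ip I y (us ! i) * ip I ?r (us ! i))"
    by (simp add: ip_diff_right ip_sum_right ip_scale_right)
  also have "(\<Sum>i<length us. ip I y (us ! i) * ip I ?r (us ! i)) = 0"
    using residual_orth[OF assms] by (intro sum.neutral) auto
  also have "ip I ?r y = sq_norm I y - (\<Sum>i<length us. (ip I y (us ! i))\<^sup>2)"
    by (subst r) (simp add: ip_diff_left ip_sum_left ip_scale_left ip_commute power2_eq_square)
  finally show ?thesis by simp
qed

lemma Bessel:
  assumes "orthonormal I us"
  shows "(\<Sum>i<length us. (ip I y (us ! i))\<^sup>2) \<le> sq_norm I y"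
  using residual_norm[OF assms, of y] ip_self_nonneg[of I "residual I us y"] by linarith

text \<open>Bessel for the coordinate vector at \<open>b\<close> bounds the sum of
  \<open>((us ! i) b)\<^sup>2\<close> over \<open>i\<close> by 1; summing over \<open>b\<close> in
  \<open>I\<close> counts the list.\<close>

lemma orthonormal_length_le_card:
  assumes "finite I" "orthonormal I us"
  shows "length us \<le> card I"
proof -
  have sq: "(\<Sum>i<length us. ((us ! i) b)\<^sup>2) \<le> 1" if "b \<in> I" for b
  proof -
    let ?e = "\<lambda>c. if c = b then 1 else 0 :: real"
    have e: "ip I ?e x = x b" for x
    proof -
      have "ip I ?e x = (\<Sum>c\<in>I. if c = b then x c else 0)" unfolding ip_def by (intro sum.cong) auto
      then show ?thesis using that assms(1) by simp
    qed
    show ?thesis using Bessel[OF assms(2), of ?e] by (simp add: e)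
  qed
  have "real (length us) = (\<Sum>i<length us. sq_norm I (us ! i))"
    using assms(2) by (simp add: orthonormal_def)
  also have "\<dots> = (\<Sum>b\<in>I. \<Sum>i<length us. ((us ! i) b)\<^sup>2)"
    unfolding ip_def power2_eq_square by (rule sum.swap)
  also have "\<dots> \<le> (\<Sum>b\<in>I. 1)" by (intro sum_mono sq)
  finally show ?thesis by simp
qed

text \<open>A nonzero residual could be normalised and appended, giving more orthonormal vectors
  than coordinates.\<close>

lemma orthonormal_full_residual:
  assumes "finite I" "orthonormal I us" "length us = card I" "b \<in> I"
  shows "residual I us y b = 0"
proof (rule ccontr)
  assume nz: "residual I us y b \<noteq> 0"
  let ?r = "residual I us y"
  have "sq_norm I ?r \<noteq> 0" using nz ip_self_eq_0[OF assms(1)] assms(4) by blast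
  then have pos: "sq_norm I ?r > 0" by (simp add: order_le_neq_trans)
  define w where "w = (\<lambda>b. (1 / sqrt (sq_norm I ?r)) * ?r b)"
  have "sq_norm I w = 1" unfolding w_def ip_scale_left ip_scale_right using pos by simp
  moreover have "\<forall>v\<in>set us. ip I w v = 0"
    unfolding w_def ip_scale_left using residual_orth[OF assms(2)] by simp
  ultimately have "orthonormal I (us @ [w])" using assms(2) by (simp add: orthonormal_snoc)
  from orthonormal_length_le_card[OF assms(1) this] assms(3) show False by simp
qed

text \<open>Gram-Schmidt that skips dependent vectors, followed by padding. The length must be
  exactly \<open>p\<close>, since the position at which the greedy directions begin has to be known
  in advance.\<close>

lemma exists_orthonormal_spanning:
  assumes "finite I" "length vs \<le> p" "p \<le> card I"
  shows "\<exists>us. length us = p \<and> orthonormal I us \<and> (\<forall>v\<in>set vs. \<forall>b\<in>I. residual I us v b = 0)"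
proof -
  have grow: "\<forall>b\<in>I. residual I (us @ [u]) v b = 0"
    if "\<forall>b\<in>I. residual I us v b = 0" "sq_norm I u = 1" "\<forall>w\<in>set us. ip I u w = 0" for us u v
  proof -
    have v: "v b = (\<Sum>i<length us. ip I v (us ! i) * (us ! i) b)" if "b \<in> I" for b
      using that \<open>\<forall>b\<in>I. residual I us v b = 0\<close> by (simp add: residual_def)
    have "ip I v u = ip I (\<lambda>b. \<Sum>i<length us. ip I v (us ! i) * (us ! i) b) u"
      using v by (intro ip_cong) auto
    also have "\<dots> = (\<Sum>i<length us. ip I v (us ! i) * ip I (us ! i) u)"
      by (simp add: ip_sum_left ip_scale_left)
    also have "\<dots> = 0" using that(3) by (intro sum.neutral) (auto simp: ip_commute)
    finally show ?thesis using that(1) by (simp add: residual_def nth_append)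
  qed
  have ex: "\<exists>us. length us \<le> length vs \<and> orthonormal I us \<and> (\<forall>v\<in>set vs. \<forall>b\<in>I. residual I us v b = 0)"
  proof (induction vs)
    case (Cons x vs)
    then obtain us where us: "length us \<le> length vs" "orthonormal I us"
      "\<forall>v\<in>set vs. \<forall>b\<in>I. residual I us v b = 0" by blast
    let ?r = "residual I us x"
    show ?case
    proof (cases "sq_norm I ?r = 0")
      case True
      then have "\<forall>b\<in>I. ?r b = 0" using ip_self_eq_0[OF assms(1)] by blast
      then show ?thesis using us by (intro exI[of _ us]) auto
    next
      case False
      then have pos: "sq_norm I ?r > 0" by (simp add: order_le_neq_trans)
      define w where "w = (\<lambda>b. (1 / sqrt (sq_norm I ?r)) * ?r b)"
      have w: "sq_norm I w = 1" "\<forall>v\<in>set us. ip I w v = 0"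
        unfolding w_def ip_scale_left ip_scale_right using pos residual_orth[OF us(2)] by simp_all
      have xw: "ip I x w = sqrt (sq_norm I ?r)"
      proof -
        have "ip I w x = ip I w ?r"
        proof -
          have "ip I w ?r = ip I w x - (\<Sum>i<length us. ip I x (us ! i) * ip I w (us ! i))"
            unfolding residual_def[of I us x] by (simp add: ip_diff_right ip_sum_right ip_scale_right)
          also have "(\<Sum>i<length us. ip I x (us ! i) * ip I w (us ! i)) = 0"
            using w(2) by (intro sum.neutral) auto
          finally show ?thesis by simp
        qed
        also have "\<dots> = sqrt (sq_norm I ?r)"
          unfolding w_def ip_scale_left using pos by (simp add: real_div_sqrt)
        finally show ?thesis by (simp add: ip_commute)
      qed
      have "\<forall>b\<in>I. residual I (us @ [w]) x b = 0"
      proof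
        fix b assume "b \<in> I"
        have "residual I (us @ [w]) x b = ?r b - ip I x w * w b"
          by (simp add: residual_def nth_append)
        also have "\<dots> = ?r b - sqrt (sq_norm I ?r) * w b" by (simp only: xw)
        also have "\<dots> = 0" using pos by (simp add: w_def)
        finally show "residual I (us @ [w]) x b = 0" .
      qed
      then show ?thesis using us w grow
        by (intro exI[of _ "us @ [w]"]) (auto simp: orthonormal_snoc)
    qed
  qed auto
  then obtain us where us: "length us \<le> p" "orthonormal I us"
    "\<forall>v\<in>set vs. \<forall>b\<in>I. residual I us v b = 0" using assms(2) by (meson le_trans)
  have "\<exists>us'. length us' = length us + d \<and> orthonormal I us' \<and> (\<forall>v\<in>set vs. \<forall>b\<in>I. residual I us' v b = 0)"
    if "length us + d \<le> p" for d
    using that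
  proof (induction d)
    case 0
    then show ?case using us by auto
  next
    case (Suc d)
    then obtain us' where us': "length us' = length us + d" "orthonormal I us'"
      "\<forall>v\<in>set vs. \<forall>b\<in>I. residual I us' v b = 0" by auto
    obtain z where "sq_norm I z = 1" "\<forall>v\<in>set us'. ip I z v = 0"
      using exists_orth_unit[OF assms(1), of us'] us' Suc.prems assms(3) by auto
    then show ?case using us' grow
      by (intro exI[of _ "us' @ [z]"]) (auto simp: orthonormal_snoc)
  qed
  from this[of "p - length us"] us(1) show ?thesis by auto
qed

section \<open>Rotation invariance of the Gaussian product measure\<close>

abbreviation std_gauss :: "real measure" where
  "std_gauss \<equiv> density lborel (\<lambda>x. ennreal (std_normal_density x))"

abbreviation gauss_PiM :: "'a set \<Rightarrow> ('a \<Rightarrow> real) measure" where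
  "gauss_PiM I \<equiv> Pi\<^sub>M I (\<lambda>_. std_gauss)"

interpretation gauss_product: product_prob_space "\<lambda>_. std_gauss" I for I
  by (rule product_prob_spaceI) (rule prob_space_std_normal)

lemma measurable_gauss_component [measurable (raw)]:
  "b \<in> I \<Longrightarrow> (\<lambda>x. x b) \<in> borel_measurable (gauss_PiM I)"
  using measurable_component_singleton[of b I "\<lambda>_. std_gauss"] by (simp cong: measurable_cong_sets)

lemma measurable_gauss_PiM_I:
  assumes "\<And>b. b \<in> I \<Longrightarrow> (\<lambda>x. f x b) \<in> borel_measurable M"
    and "\<And>x. x \<in> space M \<Longrightarrow> f x \<in> extensional I"
  shows "f \<in> measurable M (gauss_PiM I)"
  using assms by (intro measurable_PiM_single') (auto simp: space_PiM PiE_def cong: measurable_cong_sets)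

text \<open>For fixed \<open>x\<close> the shear is a translation in \<open>y\<close>.\<close>

lemma nn_integral_shear_snd:
  fixes f :: "real \<times> real \<Rightarrow> ennreal"
  assumes [measurable]: "f \<in> borel_measurable (borel \<Otimes>\<^sub>M borel)"
  shows "(\<integral>\<^sup>+x. \<integral>\<^sup>+y. f (x, y + a * x) \<partial>lborel \<partial>lborel) = (\<integral>\<^sup>+x. \<integral>\<^sup>+y. f (x, y) \<partial>lborel \<partial>lborel)"
proof (rule nn_integral_cong)
  fix x :: real
  show "(\<integral>\<^sup>+y. f (x, y + a * x) \<partial>lborel) = (\<integral>\<^sup>+y. f (x, y) \<partial>lborel)"
    using nn_integral_real_affine[of "\<lambda>y. f (x, y)" 1 "a * x"] by (simp add: add.commute)
qed

lemma nn_integral_shear_fst: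
  fixes f :: "real \<times> real \<Rightarrow> ennreal"
  assumes [measurable]: "f \<in> borel_measurable (borel \<Otimes>\<^sub>M borel)"
  shows "(\<integral>\<^sup>+x. \<integral>\<^sup>+y. f (x + a * y, y) \<partial>lborel \<partial>lborel) = (\<integral>\<^sup>+x. \<integral>\<^sup>+y. f (x, y) \<partial>lborel \<partial>lborel)"
proof -
  have "(\<integral>\<^sup>+x. \<integral>\<^sup>+y. f (x + a * y, y) \<partial>lborel \<partial>lborel) = (\<integral>\<^sup>+y. \<integral>\<^sup>+x. f (x + a * y, y) \<partial>lborel \<partial>lborel)"
    by (rule lborel_pair.Fubini') measurable
  also have "\<dots> = (\<integral>\<^sup>+y. \<integral>\<^sup>+x. f (x, y) \<partial>lborel \<partial>lborel)"
    using nn_integral_shear_snd[of "\<lambda>(y, x). f (x, y)" a] by simp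
  also have "\<dots> = (\<integral>\<^sup>+x. \<integral>\<^sup>+y. f (x, y) \<partial>lborel \<partial>lborel)"
    by (rule lborel_pair.Fubini'[symmetric]) measurable
  finally show ?thesis .
qed

text \<open>A plane rotation by an angle that is not a multiple of \<open>\<pi>\<close> is a product of three shears.\<close>

lemma nn_integral_rotate:
  fixes f :: "real \<times> real \<Rightarrow> ennreal"
  assumes [measurable]: "f \<in> borel_measurable (borel \<Otimes>\<^sub>M borel)"
    and cs: "c\<^sup>2 + s\<^sup>2 = 1" "s \<noteq> 0"
  shows "(\<integral>\<^sup>+x. \<integral>\<^sup>+y. f (c * x + s * y, c * y - s * x) \<partial>lborel \<partial>lborel) = (\<integral>\<^sup>+x. \<integral>\<^sup>+y. f (x, y) \<partial>lborel \<partial>lborel)"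
proof -
  \<comment> \<open>With \<open>c = cos t\<close> and \<open>s = sin t\<close> this is
    \<open>tan (t / 2)\<close>, the parameter of the two outer shears; the middle one has parameter
    \<open>- s\<close>.\<close>
  define a where "a = (1 - c) / s"
  have as: "a * s = 1 - c" "a * (1 + c) = s"
    using cs by (auto simp: a_def field_simps power2_eq_square)
  have "(\<integral>\<^sup>+x. \<integral>\<^sup>+y. f (x, y) \<partial>lborel \<partial>lborel) = (\<integral>\<^sup>+x. \<integral>\<^sup>+y. f (x + a * y, y) \<partial>lborel \<partial>lborel)"
    by (rule nn_integral_shear_fst[symmetric]) measurable
  also have "\<dots> = (\<integral>\<^sup>+x. \<integral>\<^sup>+y. f (x + a * (y + (- s) * x), y + (- s) * x) \<partial>lborel \<partial>lborel)"
    using nn_integral_shear_snd[of "\<lambda>(x, y). f (x + a * y, y)" "- s"] by simp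
  also have "\<dots> = (\<integral>\<^sup>+x. \<integral>\<^sup>+y. f ((x + a * y) + a * (y + (- s) * (x + a * y)), y + (- s) * (x + a * y)) \<partial>lborel \<partial>lborel)"
    using nn_integral_shear_fst[of "\<lambda>(x, y). f (x + a * (y + (- s) * x), y + (- s) * x)" a] by simp
  also have "\<dots> = (\<integral>\<^sup>+x. \<integral>\<^sup>+y. f (c * x + s * y, c * y - s * x) \<partial>lborel \<partial>lborel)"
  proof -
    have "(x + a * y) + a * (y + (- s) * (x + a * y)) = c * x + s * y" for x y
    proof -
      have "(x + a * y) + a * (y + (- s) * (x + a * y)) = x * (1 - a * s) + a * (1 + (1 - a * s)) * y"
        by (simp add: algebra_simps)
      also have "\<dots> = c * x + s * y" by (simp add: as)
      finally show ?thesis .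
    qed
    moreover have "y + (- s) * (x + a * y) = c * y - s * x" for x y
    proof -
      have "y + (- s) * (x + a * y) = (1 - a * s) * y - s * x" by (simp add: algebra_simps)
      then show ?thesis by (simp add: as)
    qed
    ultimately show ?thesis by simp
  qed
  finally show ?thesis by simp
qed

lemma nn_integral_std_gauss:
  "f \<in> borel_measurable borel \<Longrightarrow> (\<integral>\<^sup>+x. f x \<partial>std_gauss) = (\<integral>\<^sup>+x. ennreal (std_normal_density x) * f x \<partial>lborel)"
  by (subst nn_integral_density) auto

text \<open>Planar Lebesgue measure is rotation invariant, and the joint density depends on
  \<open>x\<^sup>2 + y\<^sup>2\<close> only.\<close>

lemma nn_integral_std_gauss_rotate:
  fixes f :: "real \<times> real \<Rightarrow> ennreal"
  assumes [measurable]: "f \<in> borel_measurable (borel \<Otimes>\<^sub>M borel)"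
    and cs: "c\<^sup>2 + s\<^sup>2 = 1" "s \<noteq> 0"
  shows "(\<integral>\<^sup>+x. \<integral>\<^sup>+y. f (c * x + s * y, c * y - s * x) \<partial>std_gauss \<partial>std_gauss)
       = (\<integral>\<^sup>+x. \<integral>\<^sup>+y. f (x, y) \<partial>std_gauss \<partial>std_gauss)"
proof -
  have conv: "(\<integral>\<^sup>+x. \<integral>\<^sup>+y. g (x, y) \<partial>std_gauss \<partial>std_gauss) =
    (\<integral>\<^sup>+x. \<integral>\<^sup>+y. ennreal (std_normal_density x * std_normal_density y) * g (x, y) \<partial>lborel \<partial>lborel)"
    if [measurable]: "g \<in> borel_measurable (borel \<Otimes>\<^sub>M borel)" for g :: "real \<times> real \<Rightarrow> ennreal"
    by (subst nn_integral_density; (simp add: nn_integral_std_gauss)?)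
       (auto simp: nn_integral_cmult[symmetric] ennreal_mult mult.assoc intro!: nn_integral_cong)
  define F where "F = (\<lambda>(x, y). ennreal (std_normal_density x * std_normal_density y) * f (x, y))"
  have [measurable]: "F \<in> borel_measurable (borel \<Otimes>\<^sub>M borel)"
    unfolding F_def by measurable
  have inv: "std_normal_density (c * x + s * y) * std_normal_density (c * y - s * x)
     = std_normal_density x * std_normal_density y" for x y
  proof -
    have "(c * x + s * y)\<^sup>2 + (c * y - s * x)\<^sup>2 = (c\<^sup>2 + s\<^sup>2) * (x\<^sup>2 + y\<^sup>2)"
      by (simp add: power2_eq_square algebra_simps)
    then have "(c * x + s * y)\<^sup>2 + (c * y - s * x)\<^sup>2 = x\<^sup>2 + y\<^sup>2" using cs by simp
    then have "- (c * x + s * y)\<^sup>2 / 2 + - (c * y - s * x)\<^sup>2 / 2 = - x\<^sup>2 / 2 + - y\<^sup>2 / 2" by (simp add: field_simps)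
    then show ?thesis
      by (simp add: std_normal_density_def flip: exp_add)
  qed
  have "(\<integral>\<^sup>+x. \<integral>\<^sup>+y. f (c * x + s * y, c * y - s * x) \<partial>std_gauss \<partial>std_gauss)
     = (\<integral>\<^sup>+x. \<integral>\<^sup>+y. F (c * x + s * y, c * y - s * x) \<partial>lborel \<partial>lborel)"
    using conv[of "\<lambda>(x, y). f (c * x + s * y, c * y - s * x)"] by (simp add: F_def inv)
  also have "\<dots> = (\<integral>\<^sup>+x. \<integral>\<^sup>+y. F (x, y) \<partial>lborel \<partial>lborel)"
    by (rule nn_integral_rotate) (use cs in measurable)
  also have "\<dots> = (\<integral>\<^sup>+x. \<integral>\<^sup>+y. f (x, y) \<partial>std_gauss \<partial>std_gauss)"
    using conv[of f] by (simp add: F_def)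
  finally show ?thesis .
qed

lemma nn_integral_std_gauss_reflect:
  fixes f :: "real \<Rightarrow> ennreal"
  assumes [measurable]: "f \<in> borel_measurable borel"
  shows "(\<integral>\<^sup>+x. f (- x) \<partial>std_gauss) = (\<integral>\<^sup>+x. f x \<partial>std_gauss)"
proof -
  have "(\<integral>\<^sup>+x. f x \<partial>std_gauss) = (\<integral>\<^sup>+x. ennreal (std_normal_density x) * f x \<partial>lborel)"
    by (rule nn_integral_std_gauss) simp
  also have "\<dots> = (\<integral>\<^sup>+x. ennreal (std_normal_density (- x)) * f (- x) \<partial>lborel)"
    by (subst nn_integral_real_affine[where c = "-1" and t = 0]) auto
  also have "\<dots> = (\<integral>\<^sup>+x. f (- x) \<partial>std_gauss)"
    by (subst nn_integral_std_gauss) (auto simp: std_normal_density_def)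
  finally show ?thesis by simp
qed

text \<open>Invariance of the measure and preservation of inner products are kept together so that
  rotation invariance in any dimension can be assembled by composing plane rotations and a
  reflection, without matrices or a change-of-variables theorem.\<close>

definition gauss_iso :: "'a set \<Rightarrow> (('a \<Rightarrow> real) \<Rightarrow> 'a \<Rightarrow> real) \<Rightarrow> bool" where
  "gauss_iso I R \<longleftrightarrow> R \<in> measurable (gauss_PiM I) (gauss_PiM I) \<and>
     distr (gauss_PiM I) (gauss_PiM I) R = gauss_PiM I \<and> (\<forall>x y. ip I (R x) (R y) = ip I x y)"

lemma gauss_iso_id: "gauss_iso I (\<lambda>x. x)"
  by (simp add: gauss_iso_def distr_id)

lemma gauss_iso_comp:
  assumes "gauss_iso I R" "gauss_iso I S"
  shows "gauss_iso I (\<lambda>x. R (S x))"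
proof -
  have "distr (gauss_PiM I) (gauss_PiM I) (R \<circ> S) = distr (distr (gauss_PiM I) (gauss_PiM I) S) (gauss_PiM I) R"
    using assms by (intro distr_distr[symmetric]) (auto simp: gauss_iso_def)
  also have "\<dots> = gauss_PiM I" using assms by (simp add: gauss_iso_def)
  finally show ?thesis using assms
    by (auto simp: gauss_iso_def comp_def intro: measurable_compose)
qed

lemma gauss_isoI:
  assumes R: "R \<in> measurable (gauss_PiM I) (gauss_PiM I)"
    and "\<And>f. f \<in> borel_measurable (gauss_PiM I) \<Longrightarrow>
      (\<integral>\<^sup>+x. f (R x) \<partial>gauss_PiM I) = (\<integral>\<^sup>+x. f x \<partial>gauss_PiM I)"
    and "\<And>x y. ip I (R x) (R y) = ip I x y"
  shows "gauss_iso I R"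
proof -
  have "distr (gauss_PiM I) (gauss_PiM I) R = gauss_PiM I"
  proof (rule measure_eqI)
    fix A assume "A \<in> sets (distr (gauss_PiM I) (gauss_PiM I) R)"
    then have A[measurable]: "A \<in> sets (gauss_PiM I)" by simp
    have "emeasure (distr (gauss_PiM I) (gauss_PiM I) R) A = (\<integral>\<^sup>+x. indicator A x \<partial>distr (gauss_PiM I) (gauss_PiM I) R)"
      using A by simp
    also have "\<dots> = (\<integral>\<^sup>+x. indicator A (R x) \<partial>gauss_PiM I)"
      by (rule nn_integral_distr[OF R]) (use A in simp)
    also have "\<dots> = (\<integral>\<^sup>+x. indicator A x \<partial>gauss_PiM I)"
      using assms(2)[of "indicator A"] A by simp
    finally show "emeasure (distr (gauss_PiM I) (gauss_PiM I) R) A = emeasure (gauss_PiM I) A"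
      using A by simp
  qed simp
  then show ?thesis using assms by (simp add: gauss_iso_def)
qed

text \<open>Supplies the sign: plane rotations bring a unit vector only to plus or minus a
  coordinate vector. The density is even.\<close>

lemma gauss_iso_reflect:
  assumes "finite I" "a \<in> I" "e = 1 \<or> e = (-1 :: real)"
  shows "gauss_iso I (\<lambda>x. x(a := e * x a))"
proof (cases "e = 1")
  case True
  then show ?thesis by (simp add: gauss_iso_id)
next
  case False
  then have e: "e = -1" using assms by simp
  define J where "J = I - {a}"
  have J: "I = insert a J" "a \<notin> J" "finite J" using assms by (auto simp: J_def)
  have meas: "(\<lambda>x. x(a := e * x a)) \<in> measurable (gauss_PiM I) (gauss_PiM I)"
  proof (rule measurable_gauss_PiM_I)
    fix b assume "b \<in> I"
    then show "(\<lambda>x. (x(a := e * x a)) b) \<in> borel_measurable (gauss_PiM I)"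
      using assms by (cases "b = a") auto
  qed (use assms in \<open>auto simp: space_PiM PiE_def extensional_def\<close>)
  show ?thesis
  proof (rule gauss_isoI[OF meas])
    fix f :: "('a \<Rightarrow> real) \<Rightarrow> ennreal" assume f[measurable]: "f \<in> borel_measurable (gauss_PiM I)"
    have f'[measurable]: "f \<in> borel_measurable (gauss_PiM (insert a J))" using f J by simp
    have fR: "(\<lambda>x. f (x(a := e * x a))) \<in> borel_measurable (gauss_PiM (insert a J))"
      using measurable_compose[OF meas f] J by simp
    have "(\<integral>\<^sup>+x. f (x(a := e * x a)) \<partial>gauss_PiM I)
       = (\<integral>\<^sup>+x. \<integral>\<^sup>+y. f ((x(a := y))(a := e * (x(a := y)) a)) \<partial>std_gauss \<partial>gauss_PiM J)"
      unfolding J(1) by (rule gauss_product.product_nn_integral_insert[OF J(3,2) fR])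
    also have "\<dots> = (\<integral>\<^sup>+x. \<integral>\<^sup>+y. f (x(a := - y)) \<partial>std_gauss \<partial>gauss_PiM J)"
      by (simp add: e)
    also have "\<dots> = (\<integral>\<^sup>+x. \<integral>\<^sup>+y. f (x(a := y)) \<partial>std_gauss \<partial>gauss_PiM J)"
    proof (rule nn_integral_cong)
      fix x :: "'a \<Rightarrow> real" assume x: "x \<in> space (gauss_PiM J)"
      have "(\<lambda>y. f (x(a := y))) \<in> borel_measurable std_gauss"
        using measurable_compose[OF measurable_component_update[OF x J(2)] f'] .
      then have "(\<lambda>y. f (x(a := y))) \<in> borel_measurable borel" by (simp cong: measurable_cong_sets)
      from nn_integral_std_gauss_reflect[OF this]
      show "(\<integral>\<^sup>+y. f (x(a := - y)) \<partial>std_gauss) = (\<integral>\<^sup>+y. f (x(a := y)) \<partial>std_gauss)" .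
    qed
    also have "\<dots> = (\<integral>\<^sup>+x. f x \<partial>gauss_PiM I)"
      unfolding J(1) by (rule gauss_product.product_nn_integral_insert[OF J(3,2) f', symmetric])
    finally show "(\<integral>\<^sup>+x. f (x(a := e * x a)) \<partial>gauss_PiM I) = (\<integral>\<^sup>+x. f x \<partial>gauss_PiM I)" .
  next
    fix x y :: "'a \<Rightarrow> real"
    show "ip I (x(a := e * x a)) (y(a := e * y a)) = ip I x y"
      unfolding ip_def using e by (intro sum.cong) auto
  qed
qed

lemma gauss_iso_rotate:
  assumes "finite I" "a \<in> I" "b \<in> I" "a \<noteq> b" and cs: "c\<^sup>2 + s\<^sup>2 = 1" "s \<noteq> 0"
  shows "gauss_iso I (\<lambda>x. x(a := c * x a + s * x b, b := c * x b - s * x a))"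
    (is "gauss_iso I ?R")
proof -
  define J where "J = I - {a, b}"
  have J: "I = insert b (insert a J)" "a \<notin> J" "b \<notin> J" "b \<notin> insert a J" "finite J" "finite (insert a J)"
    unfolding J_def using assms(1-4) by blast+
  have meas: "?R \<in> measurable (gauss_PiM I) (gauss_PiM I)"
  proof (rule measurable_gauss_PiM_I)
    fix d assume "d \<in> I"
    then show "(\<lambda>x. ?R x d) \<in> borel_measurable (gauss_PiM I)"
      using assms(1-4) by (cases "d = a"; cases "d = b") auto
  qed (use assms(1-4) in \<open>auto simp: space_PiM PiE_def extensional_def\<close>)
  show ?thesis
  proof (rule gauss_isoI[OF meas])
    fix f :: "('a \<Rightarrow> real) \<Rightarrow> ennreal" assume f: "f \<in> borel_measurable (gauss_PiM I)"
    \<comment> \<open>Fubini moves the two rotated coordinates innermost, where the planar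
      invariance applies.\<close>
    have iter: "(\<integral>\<^sup>+x. g x \<partial>gauss_PiM I) = (\<integral>\<^sup>+z. \<integral>\<^sup>+x. \<integral>\<^sup>+y. g (z(a := x, b := y)) \<partial>std_gauss \<partial>std_gauss \<partial>gauss_PiM J)"
      if g: "g \<in> borel_measurable (gauss_PiM I)" for g :: "('a \<Rightarrow> real) \<Rightarrow> ennreal"
    proof -
      have g'[measurable]: "g \<in> borel_measurable (gauss_PiM (insert b (insert a J)))" using g J by simp
      have upd: "(\<lambda>(x, y). x(b := y)) \<in> measurable (gauss_PiM (insert a J) \<Otimes>\<^sub>M std_gauss) (gauss_PiM (insert b (insert a J)))"
        by (rule measurable_add_dim)
      have h: "(\<lambda>x. \<integral>\<^sup>+y. g (x(b := y)) \<partial>std_gauss) \<in> borel_measurable (gauss_PiM (insert a J))"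
      proof (rule sigma_finite_measure.borel_measurable_nn_integral)
        show "sigma_finite_measure std_gauss" by (rule gauss_product.sigma_finite_measures)
        show "(\<lambda>(x, y). g (x(b := y))) \<in> borel_measurable (gauss_PiM (insert a J) \<Otimes>\<^sub>M std_gauss)"
          using measurable_compose[OF upd g'] by (simp add: case_prod_unfold)
      qed
      have "(\<integral>\<^sup>+x. g x \<partial>gauss_PiM I) = (\<integral>\<^sup>+x. \<integral>\<^sup>+y. g (x(b := y)) \<partial>std_gauss \<partial>gauss_PiM (insert a J))"
        unfolding J(1) by (rule gauss_product.product_nn_integral_insert[OF J(6,4) g'])
      also have "\<dots> = (\<integral>\<^sup>+z. \<integral>\<^sup>+x. \<integral>\<^sup>+y. g (z(a := x, b := y)) \<partial>std_gauss \<partial>std_gauss \<partial>gauss_PiM J)"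
        by (rule gauss_product.product_nn_integral_insert[OF J(5,2) h])
      finally show ?thesis .
    qed
    have "(\<integral>\<^sup>+x. f (?R x) \<partial>gauss_PiM I) =
       (\<integral>\<^sup>+z. \<integral>\<^sup>+x. \<integral>\<^sup>+y. f (?R (z(a := x, b := y))) \<partial>std_gauss \<partial>std_gauss \<partial>gauss_PiM J)"
      by (rule iter[OF measurable_compose[OF meas f]])
    also have "\<dots> = (\<integral>\<^sup>+z. \<integral>\<^sup>+x. \<integral>\<^sup>+y. f (z(a := c * x + s * y, b := c * y - s * x)) \<partial>std_gauss \<partial>std_gauss \<partial>gauss_PiM J)"
    proof -
      have "?R (z(a := x, b := y)) = z(a := c * x + s * y, b := c * y - s * x)" for z x y
        using assms(4) by (auto simp: fun_eq_iff)
      then show ?thesis by simp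
    qed
    also have "\<dots> = (\<integral>\<^sup>+z. \<integral>\<^sup>+x. \<integral>\<^sup>+y. f (z(a := x, b := y)) \<partial>std_gauss \<partial>std_gauss \<partial>gauss_PiM J)"
    proof (rule nn_integral_cong)
      fix z :: "'a \<Rightarrow> real" assume z: "z \<in> space (gauss_PiM J)"
      have m: "(\<lambda>(x, y). z(a := x, b := y)) \<in> measurable (borel \<Otimes>\<^sub>M borel) (gauss_PiM I)"
      proof (rule measurable_gauss_PiM_I)
        fix d assume "d \<in> I"
        then show "(\<lambda>xy. (case xy of (x, y) \<Rightarrow> z(a := x, b := y)) d) \<in> borel_measurable (borel \<Otimes>\<^sub>M borel)"
          by (cases "d = a"; cases "d = b") (auto simp: case_prod_unfold)
      qed (use z assms(1-4) in \<open>auto simp: J_def space_PiM PiE_def extensional_def\<close>)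
      have "(\<lambda>(x, y). f (z(a := x, b := y))) \<in> borel_measurable (borel \<Otimes>\<^sub>M borel)"
        using measurable_compose[OF m f] by (simp add: case_prod_unfold)
      from nn_integral_std_gauss_rotate[OF this cs]
      show "(\<integral>\<^sup>+x. \<integral>\<^sup>+y. f (z(a := c * x + s * y, b := c * y - s * x)) \<partial>std_gauss \<partial>std_gauss)
         = (\<integral>\<^sup>+x. \<integral>\<^sup>+y. f (z(a := x, b := y)) \<partial>std_gauss \<partial>std_gauss)" by simp
    qed
    also have "\<dots> = (\<integral>\<^sup>+x. f x \<partial>gauss_PiM I)" by (rule iter[OF f, symmetric])
    finally show "(\<integral>\<^sup>+x. f (?R x) \<partial>gauss_PiM I) = (\<integral>\<^sup>+x. f x \<partial>gauss_PiM I)" .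
  next
    fix x y :: "'a \<Rightarrow> real"
    have "(\<Sum>d\<in>J. ?R x d * ?R y d) = (\<Sum>d\<in>J. x d * y d)"
      using J(2-6) by (intro sum.cong) auto
    moreover have "(c * x a + s * x b) * (c * y a + s * y b) + (c * x b - s * x a) * (c * y b - s * y a)
       = x a * y a + x b * y b"
    proof -
      have "(c * x a + s * x b) * (c * y a + s * y b) + (c * x b - s * x a) * (c * y b - s * y a)
        = (c\<^sup>2 + s\<^sup>2) * (x a * y a + x b * y b)" by (simp add: power2_eq_square algebra_simps)
      then show ?thesis using cs by simp
    qed
    ultimately show "ip I (?R x) (?R y) = ip I x y"
      unfolding ip_def J(1) using J(2-6) assms(4) by simp
  qed
qed

text \<open>Givens rotations: each moves the component of \<open>v\<close> at some \<open>b\<close>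
  into coordinate \<open>a\<close>, which shrinks the support of \<open>v\<close>. Since
  \<open>v\<close> vanishes on \<open>K\<close>, no rotation touches a coordinate in
  \<open>K\<close>. A reflection settles the final sign.\<close>

lemma exists_gauss_iso_unit:
  assumes "finite I" "a \<in> I" "a \<notin> K" "K \<subseteq> I" "sq_norm I v = 1" "\<And>b. b \<in> K \<Longrightarrow> v b = 0"
  shows "\<exists>R. gauss_iso I R \<and> (\<forall>x. \<forall>b\<in>K. R x b = x b) \<and> (\<forall>x. R x a = ip I v x)"
  using assms(5,6)
proof (induction "card {b\<in>I. b \<noteq> a \<and> v b \<noteq> 0}" arbitrary: v rule: less_induct)
  case less
  show ?case
  proof (cases "{b\<in>I. b \<noteq> a \<and> v b \<noteq> 0} = {}")
    case True
    have ipv: "ip I v x = v a * x a" for x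
    proof -
      have "ip I v x = (\<Sum>b\<in>I. if b = a then v a * x a else 0)"
        unfolding ip_def using True by (intro sum.cong) auto
      then show ?thesis using assms by simp
    qed
    have "v a = 1 \<or> v a = -1" using less.prems(1) ipv[of v] by (simp add: square_eq_1_iff)
    then show ?thesis
      using gauss_iso_reflect[OF assms(1,2), of "v a"] assms(3) ipv
      by (intro exI[of _ "\<lambda>x. x(a := v a * x a)"]) auto
  next
    case False
    then obtain b where b: "b \<in> I" "b \<noteq> a" "v b \<noteq> 0" by blast
    have "b \<notin> K" using b less.prems by blast
    define r where "r = sqrt ((v a)\<^sup>2 + (v b)\<^sup>2)"
    have rpos: "r > 0" using b by (simp add: r_def add_nonneg_pos)
    have r2: "r\<^sup>2 = (v a)\<^sup>2 + (v b)\<^sup>2" by (simp add: r_def)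
    define c where "c = v a / r"
    define s where "s = v b / r"
    have cs: "c\<^sup>2 + s\<^sup>2 = 1" "s \<noteq> 0"
      using rpos b by (auto simp: c_def s_def power_divide r2 simp flip: add_divide_distrib)
    define R where "R = (\<lambda>x. x(a := c * x a + s * x b, b := c * x b - s * x a))"
    have isoR: "gauss_iso I R"
      unfolding R_def by (rule gauss_iso_rotate) (use assms(1,2) b cs in auto)
    define v' where "v' = R v"
    have va: "v' a = r"
    proof -
      have "v' a = (v a * v a + v b * v b) / r" using b by (simp add: v'_def R_def c_def s_def add_divide_distrib)
      also have "\<dots> = r" using r2 rpos by (simp add: power2_eq_square field_simps)
      finally show ?thesis .
    qed
    have vb: "v' b = 0" by (simp add: v'_def R_def c_def s_def)
    have vo: "v' d = v d" if "d \<noteq> a" "d \<noteq> b" for d using that by (simp add: v'_def R_def)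
    have sub: "{d\<in>I. d \<noteq> a \<and> v' d \<noteq> 0} \<subset> {d\<in>I. d \<noteq> a \<and> v d \<noteq> 0}"
      using b vb vo by auto (metis)
    have "card {d\<in>I. d \<noteq> a \<and> v' d \<noteq> 0} < card {d\<in>I. d \<noteq> a \<and> v d \<noteq> 0}"
      using assms(1) by (intro psubset_card_mono sub) auto
    moreover have "sq_norm I v' = 1" using isoR less.prems by (simp add: gauss_iso_def v'_def)
    moreover have "v' d = 0" if "d \<in> K" for d
      using that vo less.prems(2) assms(3) \<open>b \<notin> K\<close> by (metis)
    ultimately obtain R' where R': "gauss_iso I R'" "\<forall>x. \<forall>b\<in>K. R' x b = x b" "\<forall>x. R' x a = ip I v' x"
      using less.hyps[of v'] by blast
    have "ip I v' (R x) = ip I v x" for x using isoR by (simp add: gauss_iso_def v'_def)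
    then show ?thesis
      using R' gauss_iso_comp[OF R'(1) isoR] \<open>b \<notin> K\<close> assms(3)
      by (intro exI[of _ "\<lambda>x. R' (R x)"]) (auto simp: R_def)
  qed
qed

text \<open>One vector at a time: by orthogonality the isometry found so far sends
  \<open>u b\<close> to a vector vanishing on \<open>K\<close>, so the next isometry can leave the
  coordinates in \<open>K\<close> alone.\<close>

lemma exists_gauss_iso_orthonormal:
  assumes "finite I" "K \<subseteq> I" "\<And>a b. a \<in> K \<Longrightarrow> b \<in> K \<Longrightarrow> ip I (u a) (u b) = (if a = b then 1 else 0)"
  shows "\<exists>R. gauss_iso I R \<and> (\<forall>x. \<forall>a\<in>K. R x a = ip I (u a) x)"
proof -
  have "finite K" using assms(1,2) finite_subset by blast
  then show ?thesis using assms(2,3)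
  proof (induction K rule: finite_induct)
    case empty
    then show ?case using gauss_iso_id by blast
  next
    case (insert b K)
    then obtain R where R: "gauss_iso I R" "\<forall>x. \<forall>a\<in>K. R x a = ip I (u a) x" by auto
    define v where "v = R (u b)"
    have "sq_norm I v = 1" using R(1) insert.prems(2)[of b b] by (simp add: gauss_iso_def v_def)
    moreover have "v a = 0" if "a \<in> K" for a
      using that R(2) insert.prems(2)[of a b] insert.hyps by (auto simp: v_def)
    ultimately obtain S where S: "gauss_iso I S" "\<forall>x. \<forall>b\<in>K. S x b = x b" "\<forall>x. S x b = ip I v x"
      using exists_gauss_iso_unit[OF assms(1), of b K v] insert by auto
    have "S (R x) b = ip I (u b) x" for x using S(3) R(1) by (simp add: gauss_iso_def v_def)
    then show ?case using gauss_iso_comp[OF S(1) R(1)] S(2) R(2)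
      by (intro exI[of _ "\<lambda>x. S (R x)"]) auto
  qed
qed

text \<open>The isometry turns the functionals into the coordinates in \<open>K\<close>, and
  restricting a product measure to fewer coordinates gives the smaller product.\<close>

theorem distr_gauss_orthonormal:
  assumes "finite I" "K \<subseteq> I" "\<And>a b. a \<in> K \<Longrightarrow> b \<in> K \<Longrightarrow> ip I (u a) (u b) = (if a = b then 1 else 0)"
  shows "distr (gauss_PiM I) (gauss_PiM K) (\<lambda>x. \<lambda>a\<in>K. ip I (u a) x) = gauss_PiM K"
proof -
  obtain R where R: "gauss_iso I R" "\<forall>x. \<forall>a\<in>K. R x a = ip I (u a) x"
    using exists_gauss_iso_orthonormal[OF assms] by blast
  have "finite K" using assms(1,2) finite_subset by blast
  have "distr (gauss_PiM I) (gauss_PiM K) (\<lambda>x. \<lambda>a\<in>K. ip I (u a) x)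
      = distr (gauss_PiM I) (gauss_PiM K) ((\<lambda>x. restrict x K) \<circ> R)"
    using R(2) by (intro distr_cong) (auto simp: restrict_def fun_eq_iff)
  also have "\<dots> = distr (distr (gauss_PiM I) (gauss_PiM I) R) (gauss_PiM K) (\<lambda>x. restrict x K)"
    using R(1) assms(2) by (intro distr_distr[symmetric] measurable_restrict_subset) (auto simp: gauss_iso_def)
  also have "\<dots> = distr (gauss_PiM I) (gauss_PiM K) (\<lambda>x. restrict x K)"
    using R(1) by (simp add: gauss_iso_def)
  also have "\<dots> = gauss_PiM K"
    by (rule gauss_product.distr_restrict[OF assms(2,1), symmetric])
  finally show ?thesis .
qed

lemma orthonormal_append:
  assumes "orthonormal I us" "orthonormal I vs" "\<And>u v. u \<in> set us \<Longrightarrow> v \<in> set vs \<Longrightarrow> ip I u v = 0"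
  shows "orthonormal I (us @ vs)"
  using assms(2,3)
proof (induction vs rule: rev_induct)
  case Nil
  then show ?case using assms(1) by simp
next
  case (snoc v vs)
  have "orthonormal I (us @ vs)" using snoc by (auto simp: orthonormal_snoc)
  then have "orthonormal I ((us @ vs) @ [v])"
    using snoc.prems by (subst orthonormal_snoc) (auto simp: orthonormal_snoc ip_commute)
  then show ?case by simp
qed

lemma sum_lessThan_add: "(\<Sum>i<m + k. f i) = (\<Sum>i<m. f i) + (\<Sum>i<k. f (m + i))" for m k :: nat
  by (induction k) (simp_all add: add.assoc)

section \<open>Gram--Schmidt orthogonalisation\<close>

text \<open>
  Unnormalised, so that a degenerate sequence needs no case distinction: a vanishing vector
  contributes nothing because of \<open>x / 0 = 0\<close>.
\<close>

function gram_schmidt :: "'a set \<Rightarrow> (nat \<Rightarrow> 'a \<Rightarrow> real) \<Rightarrow> nat \<Rightarrow> 'a \<Rightarrow> real" where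
  "gram_schmidt I g q = (\<lambda>b. g q b - (\<Sum>s<q. ip I (g q) (gram_schmidt I g s) /
     sq_norm I (gram_schmidt I g s) * gram_schmidt I g s b))"
  by auto
termination by (relation "Wellfounded.measure (\<lambda>(I, g, q). q)") auto

declare gram_schmidt.simps [simp del]

definition gs_residual :: "'a set \<Rightarrow> (nat \<Rightarrow> 'a \<Rightarrow> real) \<Rightarrow> nat \<Rightarrow> ('a \<Rightarrow> real) \<Rightarrow> 'a \<Rightarrow> real" where
  "gs_residual I g q y = (\<lambda>b. y b - (\<Sum>s<q. ip I y (gram_schmidt I g s) /
     sq_norm I (gram_schmidt I g s) * gram_schmidt I g s b))"

lemma gram_schmidt_residual: "gram_schmidt I g q = gs_residual I g q (g q)"
  by (subst gram_schmidt.simps) (simp add: gs_residual_def)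

lemma gs_residual_add: "gs_residual I g q (\<lambda>b. x b + y b) = (\<lambda>b. gs_residual I g q x b + gs_residual I g q y b)"
  by (simp add: gs_residual_def ip_add_left add_divide_distrib ring_distribs sum.distrib fun_eq_iff)

lemma gs_residual_scale: "gs_residual I g q (\<lambda>b. c * x b) = (\<lambda>b. c * gs_residual I g q x b)"
  by (simp add: gs_residual_def ip_scale_left right_diff_distrib sum_distrib_left mult.assoc fun_eq_iff)

lemma gs_residual_zero: "gs_residual I g q (\<lambda>b. 0) = (\<lambda>b. 0)"
  by (simp add: gs_residual_def ip_zero_left)

lemma gs_residual_sum: "gs_residual I g q (\<lambda>b. \<Sum>s\<in>S. f s b) = (\<lambda>b. \<Sum>s\<in>S. gs_residual I g q (f s) b)"
proof (cases "finite S")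
  case True
  then show ?thesis by (induction S) (simp_all add: gs_residual_zero gs_residual_add)
qed (simp add: gs_residual_zero)

lemma gram_schmidt_cong:
  "(\<And>s b. s \<le> q \<Longrightarrow> b \<in> I \<Longrightarrow> g s b = h s b) \<Longrightarrow> b \<in> I \<Longrightarrow> gram_schmidt I g q b = gram_schmidt I h q b"
proof (induction q arbitrary: b rule: less_induct)
  case (less q)
  have IH: "gram_schmidt I g s b = gram_schmidt I h s b" if "s < q" "b \<in> I" for s b
    using less.IH[of s b] less.prems(1) that by auto
  have "ip I (g q) (gram_schmidt I g s) = ip I (h q) (gram_schmidt I h s)"
    "sq_norm I (gram_schmidt I g s) = sq_norm I (gram_schmidt I h s)" if "s < q" for s
    using IH that less.prems(1) by (auto intro!: ip_cong)
  then show ?case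
    using less.prems IH by (subst (1 2) gram_schmidt.simps) auto
qed

text \<open>Orthogonality of the earlier vectors is a premise because
  \<open>gram_schmidt_orth\<close> applies this inside the induction that establishes it.\<close>

lemma gs_residual_orth_aux:
  assumes "finite I" "t < q" "\<And>s. s < q \<Longrightarrow> s \<noteq> t \<Longrightarrow> ip I (gram_schmidt I g s) (gram_schmidt I g t) = 0"
  shows "ip I (gs_residual I g q y) (gram_schmidt I g t) = 0"
proof -
  let ?r = "gram_schmidt I g"
  have "ip I (gs_residual I g q y) (?r t) =
      ip I y (?r t) - (\<Sum>s<q. ip I y (?r s) / sq_norm I (?r s) * ip I (?r s) (?r t))"
    unfolding gs_residual_def by (simp add: ip_diff_left ip_sum_left ip_scale_left del: times_divide_eq_left)
  also have "(\<Sum>s<q. ip I y (?r s) / sq_norm I (?r s) * ip I (?r s) (?r t)) =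
      (\<Sum>s<q. if s = t then ip I y (?r t) else 0)"
  proof (intro sum.cong refl)
    fix s assume "s \<in> {..<q}"
    then show "ip I y (?r s) / sq_norm I (?r s) * ip I (?r s) (?r t) = (if s = t then ip I y (?r t) else 0)"
      using assms ip_self_eq_0_imp[OF assms(1), of "?r t" y] by (auto simp: ip_commute)
  qed
  finally show ?thesis using assms(2) by simp
qed

lemma gram_schmidt_orth:
  assumes "finite I" "s \<noteq> t"
  shows "ip I (gram_schmidt I g s) (gram_schmidt I g t) = 0"
proof -
  have "\<forall>t<q. ip I (gram_schmidt I g q) (gram_schmidt I g t) = 0" for q
  proof (induction q rule: less_induct)
    case (less q)
    show ?case
    proof (intro allI impI)
      fix t assume t: "t < q"
      have "ip I (gram_schmidt I g s) (gram_schmidt I g t) = 0" if "s < q" "s \<noteq> t" for s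
        using less.IH[of s] less.IH[of t] t that ip_commute[of I "gram_schmidt I g s"] by (metis linorder_neqE_nat)
      then show "ip I (gram_schmidt I g q) (gram_schmidt I g t) = 0"
        unfolding gram_schmidt_residual[of I g q] using t assms(1) by (intro gs_residual_orth_aux) auto
    qed
  qed
  from this[of s] this[of t] show ?thesis using assms(2) by (metis ip_commute linorder_neqE_nat)
qed

lemma gs_residual_orth:
  "finite I \<Longrightarrow> t < q \<Longrightarrow> ip I (gs_residual I g q y) (gram_schmidt I g t) = 0"
  by (rule gs_residual_orth_aux) (auto intro: gram_schmidt_orth)

lemma gs_residual_gram_schmidt_eq_0:
  assumes "finite I" "s < q" "b \<in> I"
  shows "gs_residual I g q (gram_schmidt I g s) b = 0"
proof -
  let ?r = "gram_schmidt I g"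
  have "(\<Sum>t<q. ip I (?r s) (?r t) / sq_norm I (?r t) * ?r t b) = (\<Sum>t<q. if t = s then ?r s b else 0)"
  proof (intro sum.cong refl)
    fix t
    show "ip I (?r s) (?r t) / sq_norm I (?r t) * ?r t b = (if t = s then ?r s b else 0)"
      using gram_schmidt_orth[OF assms(1), of s t g] ip_self_eq_0[OF assms(1), of "?r s"] assms(3) by auto
  qed
  then show ?thesis using assms(2) by (simp add: gs_residual_def)
qed

lemma gs_residual_eq_0:
  assumes "finite I" "s < q" "b \<in> I"
  shows "gs_residual I g q (g s) b = 0"
proof -
  let ?r = "gram_schmidt I g"
  define c where "c t = ip I (g s) (?r t) / sq_norm I (?r t)" for t
  have "g s = (\<lambda>b. ?r s b + (\<Sum>t<s. c t * ?r t b))"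
    unfolding c_def by (subst gram_schmidt.simps) simp
  then have "gs_residual I g q (g s) = gs_residual I g q (\<lambda>b. ?r s b + (\<Sum>t<s. c t * ?r t b))"
    by (rule arg_cong)
  also have "\<dots> = (\<lambda>b. gs_residual I g q (?r s) b + (\<Sum>t<s. c t * gs_residual I g q (?r t) b))"
    by (simp only: gs_residual_add gs_residual_sum gs_residual_scale)
  finally have "gs_residual I g q (g s) =
      (\<lambda>b. gs_residual I g q (?r s) b + (\<Sum>t<s. c t * gs_residual I g q (?r t) b))" .
  then show ?thesis
    using gs_residual_gram_schmidt_eq_0[OF assms(1) _ assms(3)] assms(2) by simp
qed

lemma orth_gram_schmidt:
  assumes "\<And>s. s < q \<Longrightarrow> ip I z (g s) = 0" "s < q"
  shows "ip I z (gram_schmidt I g s) = 0"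
  using assms(2)
proof (induction s rule: less_induct)
  case (less s)
  show ?case
    using less assms(1) by (subst gram_schmidt.simps) (simp add: ip_diff_right ip_sum_right ip_scale_right del: times_divide_eq_left)
qed

lemma ip_gs_residual:
  assumes "\<And>s. s < q \<Longrightarrow> ip I z (g s) = 0"
  shows "ip I z (gs_residual I g q y) = ip I z y"
  using orth_gram_schmidt[of q I z g, OF assms]
  by (simp add: gs_residual_def ip_diff_right ip_sum_right ip_scale_right del: times_divide_eq_left)

lemma ip_gs_residual_gs:
  assumes "\<And>s. s < q \<Longrightarrow> ip I z (gram_schmidt I g s) = 0"
  shows "ip I z (gs_residual I g q y) = ip I z y"
  using assms by (simp add: gs_residual_def ip_diff_right ip_sum_right ip_scale_right del: times_divide_eq_left)

text \<open>\<open>y\<close> and its residual have the same components along vectors orthogonal to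
  the family. This turns distances from a span into bounds for every projection onto directions that
  avoid the span.\<close>

lemma orth_Bessel_gs_residual:
  assumes "orthonormal I ws" "\<And>w s. w \<in> set ws \<Longrightarrow> s < q \<Longrightarrow> ip I w (g s) = 0"
  shows "(\<Sum>i<length ws. (ip I (ws ! i) y)\<^sup>2) \<le> sq_norm I (gs_residual I g q y)"
proof -
  have "(\<Sum>i<length ws. (ip I (ws ! i) y)\<^sup>2) = (\<Sum>i<length ws. (ip I (gs_residual I g q y) (ws ! i))\<^sup>2)"
  proof (intro sum.cong refl)
    fix i assume "i \<in> {..<length ws}"
    then have "ip I (ws ! i) (gs_residual I g q y) = ip I (ws ! i) y"
      using assms(2) by (intro ip_gs_residual) auto
    then show "(ip I (ws ! i) y)\<^sup>2 = (ip I (gs_residual I g q y) (ws ! i))\<^sup>2" by (simp add: ip_commute)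
  qed
  then show ?thesis using Bessel[OF assms(1)] by simp
qed

text \<open>The normalised Gram-Schmidt vectors are completed by \<open>ws\<close> to a full
  orthonormal system, in which only the \<open>ws\<close> components of a residual survive. For
  Gaussian \<open>y\<close> the squared distance is therefore chi-squared with
  \<open>card I - q\<close> degrees of freedom.\<close>

lemma gs_residual_norm_complement:
  assumes "finite I" "q \<le> card I" "\<And>s. s < q \<Longrightarrow> sq_norm I (gram_schmidt I g s) \<noteq> 0"
  shows "\<exists>ws. length ws = card I - q \<and> orthonormal I ws \<and>
     (\<forall>y. sq_norm I (gs_residual I g q y) = (\<Sum>i<length ws. (ip I (ws ! i) y)\<^sup>2))"
proof -
  let ?r = "gram_schmidt I g"
  define c where "c s = 1 / sqrt (sq_norm I (?r s))" for s
  have cc: "c s * (c s * sq_norm I (?r s)) = 1" if "s < q" for s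
  proof -
    have "sq_norm I (?r s) > 0" using assms(3)[OF that] by (simp add: order_le_neq_trans)
    then show ?thesis by (simp add: c_def)
  qed
  define fs where "fs = map (\<lambda>s b. c s * ?r s b) [0..<q]"
  have fs: "orthonormal I fs"
    unfolding orthonormal_def
  proof (intro allI impI)
    fix i j assume "i < length fs" "j < length fs"
    then show "ip I (fs ! i) (fs ! j) = (if i = j then 1 else 0)"
      using cc gram_schmidt_orth[OF assms(1), of i j g]
      by (auto simp: fs_def ip_scale_left ip_scale_right)
  qed
  obtain ws where ws: "length ws = card I - q" "orthonormal I ws" "\<forall>w\<in>set ws. \<forall>v\<in>set fs. ip I w v = 0"
    using exists_orthonormal_complement[OF assms(1), of fs "card I - q"] assms(2) by (auto simp: fs_def)
  have full: "orthonormal I (fs @ ws)"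
    using fs ws by (intro orthonormal_append) (auto, metis ip_commute)
  have len: "length (fs @ ws) = card I" using ws assms(2) by (simp add: fs_def)
  have wr: "ip I w (?r s) = 0" if "w \<in> set ws" "s < q" for w s
  proof -
    have "(\<lambda>b. c s * ?r s b) \<in> set fs" using that by (auto simp: fs_def)
    then have "ip I w (\<lambda>b. c s * ?r s b) = 0" using ws(3) that by blast
    then show ?thesis using cc[OF that(2)] by (auto simp: ip_scale_right)
  qed
  have "sq_norm I (gs_residual I g q y) = (\<Sum>i<length ws. (ip I (ws ! i) y)\<^sup>2)" for y
  proof -
    let ?x = "gs_residual I g q y"
    have "sq_norm I (residual I (fs @ ws) ?x) = 0"
      using orthonormal_full_residual[OF assms(1) full len] ip_self_eq_0[OF assms(1)] by blast
    then have "sq_norm I ?x = (\<Sum>i<length (fs @ ws). (ip I ?x ((fs @ ws) ! i))\<^sup>2)"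
      using residual_norm[OF full, of ?x] by simp
    also have "\<dots> = (\<Sum>i<length fs. (ip I ?x (fs ! i))\<^sup>2) + (\<Sum>i<length ws. (ip I ?x (ws ! i))\<^sup>2)"
      by (simp add: sum_lessThan_add nth_append)
    also have "(\<Sum>i<length fs. (ip I ?x (fs ! i))\<^sup>2) = 0"
      using gs_residual_orth[OF assms(1), of _ q g y] by (intro sum.neutral) (auto simp: fs_def ip_scale_right)
    also have "(\<Sum>i<length ws. (ip I ?x (ws ! i))\<^sup>2) = (\<Sum>i<length ws. (ip I (ws ! i) y)\<^sup>2)"
      using wr by (intro sum.cong refl) (simp add: ip_commute[of I ?x] ip_gs_residual_gs)
    finally show ?thesis by simp
  qed
  then show ?thesis using ws by blast
qed

section \<open>Gaussian columns far from the span of the preceding ones\<close>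

text \<open>Independence, in the form of a product formula. \<open>distr_gauss_orthonormal\<close>
  indexes functionals by a subset of \<open>I\<close>, so the list is carried along a bijection with
  some \<open>K\<close> of the right size.\<close>

lemma nn_integral_prod_orthonormal:
  assumes "finite I" "orthonormal I ws" and [measurable]: "g \<in> borel_measurable borel"
  shows "(\<integral>\<^sup>+x. (\<Prod>i<length ws. g (ip I (ws ! i) x)) \<partial>gauss_PiM I) = (\<integral>\<^sup>+y. g y \<partial>std_gauss) ^ length ws"
proof -
  obtain K where K: "K \<subseteq> I" "card K = length ws"
    using obtain_subset_with_card_n[OF orthonormal_length_le_card[OF assms(1,2)]] by metis
  have "finite K" using K assms(1) finite_subset by blast
  then obtain h where h: "bij_betw h K {..<length ws}"
    using K(2) by (metis card_lessThan finite_lessThan finite_same_card_bij)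
  define u where "u a = ws ! h a" for a
  have on: "ip I (u a) (u b) = (if a = b then 1 else 0)" if "a \<in> K" "b \<in> K" for a b
  proof -
    have "h a < length ws" "h b < length ws" "h a = h b \<longleftrightarrow> a = b"
      using h that by (auto simp: bij_betw_def inj_on_def)
    then show ?thesis using assms(2) by (simp add: orthonormal_def u_def)
  qed
  have meas: "(\<lambda>x. \<lambda>a\<in>K. ip I (u a) x) \<in> measurable (gauss_PiM I) (gauss_PiM K)"
    unfolding ip_def by (intro measurable_gauss_PiM_I) auto
  have mK: "(\<lambda>x. \<Prod>a\<in>K. g (x a)) \<in> borel_measurable (gauss_PiM K)"
    by measurable
  have "(\<integral>\<^sup>+x. (\<Prod>i<length ws. g (ip I (ws ! i) x)) \<partial>gauss_PiM I)
      = (\<integral>\<^sup>+x. (\<Prod>a\<in>K. g (ip I (u a) x)) \<partial>gauss_PiM I)"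
    unfolding u_def by (subst prod.reindex_bij_betw[OF h, symmetric]) simp
  also have "\<dots> = (\<integral>\<^sup>+x. (\<Prod>a\<in>K. g ((\<lambda>a\<in>K. ip I (u a) x) a)) \<partial>gauss_PiM I)"
    by (intro nn_integral_cong prod.cong) auto
  also have "\<dots> = (\<integral>\<^sup>+x. (\<Prod>a\<in>K. g (x a)) \<partial>distr (gauss_PiM I) (gauss_PiM K) (\<lambda>x. \<lambda>a\<in>K. ip I (u a) x))"
    by (rule nn_integral_distr[OF meas, symmetric]) (use mK in simp)
  also have "\<dots> = (\<integral>\<^sup>+x. (\<Prod>a\<in>K. g (x a)) \<partial>gauss_PiM K)"
    by (subst distr_gauss_orthonormal[OF assms(1) K(1) on]) auto
  also have "\<dots> = (\<Prod>a\<in>K. \<integral>\<^sup>+y. g y \<partial>std_gauss)"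
    by (rule gauss_product.product_nn_integral_prod) (use \<open>finite K\<close> in auto)
  finally show ?thesis using K(2) by simp
qed

text \<open>Multiplying the standard density by \<open>exp (x\<^sup>2 / 4)\<close> gives a Gaussian
  density of variance 2, up to the factor \<open>sqrt 2\<close>.\<close>

lemma nn_integral_exp_square: "(\<integral>\<^sup>+x. ennreal (exp (x\<^sup>2 / 4)) \<partial>std_gauss) = ennreal (sqrt 2)"
proof -
  have eq: "std_normal_density x * exp (x\<^sup>2 / 4) = sqrt 2 * normal_density 0 (sqrt 2) x" for x
    by (simp add: normal_density_def real_sqrt_mult field_simps flip: exp_add)
  have "(\<integral>\<^sup>+x. ennreal (exp (x\<^sup>2 / 4)) \<partial>std_gauss) = (\<integral>\<^sup>+x. ennreal (sqrt 2) * ennreal (normal_density 0 (sqrt 2) x) \<partial>lborel)"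
    by (subst nn_integral_std_gauss) (auto simp: eq simp flip: ennreal_mult intro!: nn_integral_cong)
  also have "\<dots> = ennreal (sqrt 2) * (\<integral>\<^sup>+x. ennreal (normal_density 0 (sqrt 2) x) \<partial>lborel)"
    by (rule nn_integral_cmult) measurable
  also have "(\<integral>\<^sup>+x. ennreal (normal_density 0 (sqrt 2) x) \<partial>lborel) = 1"
    using prob_space.emeasure_space_1[OF prob_space_normal_density[of "sqrt 2" 0]]
    by (simp add: emeasure_density)
  finally show ?thesis by simp
qed

lemma measurable_gauss_ip [measurable]: "(\<lambda>x. ip I u x) \<in> borel_measurable (gauss_PiM I)"
  unfolding ip_def by measurable

lemma measurable_gs_residual_norm [measurable]:
  "(\<lambda>x. sq_norm I (gs_residual I g q x)) \<in> borel_measurable (gauss_PiM I)"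
proof -
  have [measurable]: "(\<lambda>x. gs_residual I g q x b) \<in> borel_measurable (gauss_PiM I)" if "b \<in> I" for b
    unfolding gs_residual_def ip_def using that by measurable
  show ?thesis unfolding ip_def by measurable
qed

text \<open>Exponential Markov inequality with parameter 1/4; each of the \<open>card I - q\<close>
  degrees of freedom costs a factor \<open>sqrt 2\<close>.\<close>

lemma nn_integral_gs_residual_tail:
  assumes "finite I" "q \<le> card I" "\<And>s. s < q \<Longrightarrow> sq_norm I (gram_schmidt I g s) \<noteq> 0"
  shows "(\<integral>\<^sup>+x. indicator {x. \<tau> \<le> sq_norm I (gs_residual I g q x)} x \<partial>gauss_PiM I)
     \<le> ennreal (sqrt 2 ^ (card I - q) * exp (- \<tau> / 4))"
proof -
  obtain ws where ws: "length ws = card I - q" "orthonormal I ws"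
    "\<And>y. sq_norm I (gs_residual I g q y) = (\<Sum>i<length ws. (ip I (ws ! i) y)\<^sup>2)"
    using gs_residual_norm_complement[OF assms] by blast
  have "(\<integral>\<^sup>+x. indicator {x. \<tau> \<le> sq_norm I (gs_residual I g q x)} x \<partial>gauss_PiM I)
      \<le> (\<integral>\<^sup>+x. ennreal (exp (- \<tau> / 4)) * (\<Prod>i<length ws. ennreal (exp ((ip I (ws ! i) x)\<^sup>2 / 4))) \<partial>gauss_PiM I)"
  proof (intro nn_integral_mono)
    fix x
    have "indicator {x. \<tau> \<le> sq_norm I (gs_residual I g q x)} x \<le>
      ennreal (exp (- \<tau> / 4 + (\<Sum>i<length ws. (ip I (ws ! i) x)\<^sup>2 / 4)))"
      by (auto simp: indicator_def ws(3) simp flip: sum_divide_distrib)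
    also have "\<dots> = ennreal (exp (- \<tau> / 4)) * (\<Prod>i<length ws. ennreal (exp ((ip I (ws ! i) x)\<^sup>2 / 4)))"
      by (subst exp_add) (simp add: exp_sum ennreal_mult prod_nonneg flip: prod_ennreal)
    finally show "indicator {x. \<tau> \<le> sq_norm I (gs_residual I g q x)} x \<le>
       ennreal (exp (- \<tau> / 4)) * (\<Prod>i<length ws. ennreal (exp ((ip I (ws ! i) x)\<^sup>2 / 4)))" .
  qed
  also have "\<dots> = ennreal (exp (- \<tau> / 4)) * (\<integral>\<^sup>+x. (\<Prod>i<length ws. ennreal (exp ((ip I (ws ! i) x)\<^sup>2 / 4))) \<partial>gauss_PiM I)"
    by (rule nn_integral_cmult) measurable
  also have "\<dots> = ennreal (exp (- \<tau> / 4)) * ennreal (sqrt 2) ^ length ws"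
    by (subst nn_integral_prod_orthonormal[OF assms(1) ws(2), where g = "\<lambda>y. ennreal (exp (y\<^sup>2 / 4))"])
       (auto simp: nn_integral_exp_square)
  finally show ?thesis by (simp add: ws(1) ennreal_power mult.commute flip: ennreal_mult)
qed

text \<open>At least one Gaussian coordinate would have to vanish; here \<open>q < card I\<close>
  enters.\<close>

lemma nn_integral_gs_residual_null:
  assumes "finite I" "q < card I" "\<And>s. s < q \<Longrightarrow> sq_norm I (gram_schmidt I g s) \<noteq> 0"
  shows "(\<integral>\<^sup>+x. indicator {x. sq_norm I (gs_residual I g q x) = 0} x \<partial>gauss_PiM I) = 0"
proof -
  obtain ws where ws: "length ws = card I - q" "orthonormal I ws"
    "\<And>y. sq_norm I (gs_residual I g q y) = (\<Sum>i<length ws. (ip I (ws ! i) y)\<^sup>2)"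
    using gs_residual_norm_complement[OF assms(1) less_imp_le[OF assms(2)] assms(3)] by blast
  have "(\<integral>\<^sup>+x. indicator {x. sq_norm I (gs_residual I g q x) = 0} x \<partial>gauss_PiM I)
     \<le> (\<integral>\<^sup>+x. (\<Prod>i<length ws. indicator {0::real} (ip I (ws ! i) x)) \<partial>gauss_PiM I)"
  proof (intro nn_integral_mono)
    fix x
    have "(\<Prod>i<length ws. indicator {0::real} (ip I (ws ! i) x)) = (1 :: ennreal)"
      if "(\<Sum>i<length ws. (ip I (ws ! i) x)\<^sup>2) = 0"
      using that by (subst (asm) sum_nonneg_eq_0_iff) auto
    then show "indicator {x. sq_norm I (gs_residual I g q x) = 0} x
       \<le> (\<Prod>i<length ws. indicator {0::real} (ip I (ws ! i) x) :: ennreal)"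
      by (auto simp: indicator_def ws(3))
  qed
  also have "\<dots> = (\<integral>\<^sup>+y. indicator {0::real} y \<partial>std_gauss) ^ length ws"
    by (rule nn_integral_prod_orthonormal[OF assms(1) ws(2)]) measurable
  also have "(\<integral>\<^sup>+y. indicator {0::real} y \<partial>std_gauss) = 0"
    by (subst nn_integral_std_gauss) (auto simp: nn_integral_0_iff_AE AE_lborel_singleton intro!: AE_mp[OF AE_lborel_singleton[of 0]])
  finally show ?thesis using ws(1) assms(2) by (simp add: power_0_left)
qed

section \<open>Distances of successive Gaussian columns from their predecessors\<close>

abbreviation col :: "(nat \<times> nat \<Rightarrow> real) \<Rightarrow> nat \<Rightarrow> nat \<Rightarrow> real" where
  "col Y s \<equiv> (\<lambda>b. Y (b, s))"

text \<open>Squared distance of \<open>g s\<close> from the span of its predecessors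
  \<open>g t\<close> with \<open>t < s\<close>.\<close>

definition gs_sqnorm :: "nat \<Rightarrow> (nat \<Rightarrow> nat \<Rightarrow> real) \<Rightarrow> nat \<Rightarrow> real" where
  "gs_sqnorm n g s = sq_norm {..<n} (gram_schmidt {..<n} g s)"

lemma gs_sqnorm_cong:
  assumes "\<And>t b. t \<le> s \<Longrightarrow> b < n \<Longrightarrow> g t b = h t b"
  shows "gs_sqnorm n g s = gs_sqnorm n h s"
proof -
  have "gram_schmidt {..<n} g s b = gram_schmidt {..<n} h s b" if "b \<in> {..<n}" for b
    using assms that by (intro gram_schmidt_cong) auto
  then show ?thesis unfolding gs_sqnorm_def by (intro ip_cong) auto
qed

lemma measurable_gram_schmidt:
  assumes "\<And>t b. t \<le> s \<Longrightarrow> b < n \<Longrightarrow> (\<lambda>x. g x t b) \<in> borel_measurable M"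
  shows "b < n \<Longrightarrow> (\<lambda>x. gram_schmidt {..<n} (g x) s b) \<in> borel_measurable M"
  using assms
proof (induction s arbitrary: b rule: less_induct)
  case (less s)
  have [measurable]: "(\<lambda>x. g x s b) \<in> borel_measurable M" if "b < n" for b
    using less.prems that by auto
  have [measurable]: "(\<lambda>x. gram_schmidt {..<n} (g x) t b) \<in> borel_measurable M" if "t < s" "b < n" for t b
    using less.prems that by (intro less.IH) auto
  show ?case
    using \<open>b < n\<close> by (subst gram_schmidt.simps, unfold ip_def) measurable
qed

lemma measurable_gs_sqnorm:
  assumes "\<And>t b. t \<le> s \<Longrightarrow> b < n \<Longrightarrow> (\<lambda>x. g x t b) \<in> borel_measurable M"
  shows "(\<lambda>x. gs_sqnorm n (g x) s) \<in> borel_measurable M"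
proof -
  have [measurable]: "(\<lambda>x. gram_schmidt {..<n} (g x) s b) \<in> borel_measurable M" if "b < n" for b
    using assms that by (intro measurable_gram_schmidt) auto
  show ?thesis unfolding gs_sqnorm_def ip_def by measurable
qed

lemma measurable_gs_sqnorm_col [measurable]:
  assumes "s < q"
  shows "(\<lambda>Y. gs_sqnorm n (col Y) s) \<in> borel_measurable (gauss_PiM ({..<n} \<times> {..<q}))"
  using assms by (intro measurable_gs_sqnorm measurable_gauss_component) auto

lemma distr_gauss_column:
  fixes n q :: nat
  shows "distr (gauss_PiM ({..<n} \<times> {q})) (gauss_PiM {..<n}) (\<lambda>y. \<lambda>b\<in>{..<n}. y (b, q)) = gauss_PiM {..<n}"
  by (rule gauss_product.distr_reorder[of "\<lambda>b. (b, q)" "{..<n}" "{..<n} \<times> {q}"])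
     (auto simp: inj_on_def)

text \<open>Fubini for conditioning on the first \<open>q\<close> columns. The last column is
  reindexed from pairs to \<open>{..<n}\<close>, so that the estimates for a single Gaussian vector
  apply to it.\<close>

lemma nn_integral_split_last_column:
  fixes n q :: nat
  assumes [measurable]: "f \<in> borel_measurable (gauss_PiM ({..<n} \<times> {..<Suc q}))"
    and "\<And>x y. x \<in> space (gauss_PiM ({..<n} \<times> {..<q})) \<Longrightarrow> y \<in> space (gauss_PiM ({..<n} \<times> {q})) \<Longrightarrow>
      f (merge ({..<n} \<times> {..<q}) ({..<n} \<times> {q}) (x, y)) = h x (\<lambda>b\<in>{..<n}. y (b, q))"
    and "\<And>x. x \<in> space (gauss_PiM ({..<n} \<times> {..<q})) \<Longrightarrow> h x \<in> borel_measurable (gauss_PiM {..<n})"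
  shows "(\<integral>\<^sup>+Y. f Y \<partial>gauss_PiM ({..<n} \<times> {..<Suc q})) =
     (\<integral>\<^sup>+x. \<integral>\<^sup>+y. h x y \<partial>gauss_PiM {..<n} \<partial>gauss_PiM ({..<n} \<times> {..<q}))"
proof -
  let ?J = "{..<n} \<times> {q}" and ?I = "{..<n} \<times> {..<q}"
  have IJ: "{..<n} \<times> {..<Suc q} = ?I \<union> ?J" by auto
  have m: "(\<lambda>y. \<lambda>b\<in>{..<n}. y (b, q)) \<in> measurable (gauss_PiM ?J) (gauss_PiM {..<n})"
    by (intro measurable_gauss_PiM_I) auto
  have "(\<integral>\<^sup>+Y. f Y \<partial>gauss_PiM ({..<n} \<times> {..<Suc q})) =
      (\<integral>\<^sup>+x. \<integral>\<^sup>+y. f (merge ?I ?J (x, y)) \<partial>gauss_PiM ?J \<partial>gauss_PiM ?I)"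
    unfolding IJ using assms(1)[unfolded IJ]
    by (intro gauss_product.product_nn_integral_fold) auto
  also have "\<dots> = (\<integral>\<^sup>+x. \<integral>\<^sup>+y. h x y \<partial>gauss_PiM {..<n} \<partial>gauss_PiM ?I)"
  proof (rule nn_integral_cong)
    fix x assume x: "x \<in> space (gauss_PiM ?I)"
    have "(\<integral>\<^sup>+y. f (merge ?I ?J (x, y)) \<partial>gauss_PiM ?J) = (\<integral>\<^sup>+y. h x (\<lambda>b\<in>{..<n}. y (b, q)) \<partial>gauss_PiM ?J)"
      using x assms(2) by (intro nn_integral_cong) auto
    also have "\<dots> = (\<integral>\<^sup>+y. h x y \<partial>distr (gauss_PiM ?J) (gauss_PiM {..<n}) (\<lambda>y. \<lambda>b\<in>{..<n}. y (b, q)))"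
      using assms(3)[OF x] by (intro nn_integral_distr[symmetric] m) auto
    finally show "(\<integral>\<^sup>+y. f (merge ?I ?J (x, y)) \<partial>gauss_PiM ?J) = (\<integral>\<^sup>+y. h x y \<partial>gauss_PiM {..<n})"
      by (simp add: distr_gauss_column)
  qed
  finally show ?thesis .
qed

lemma gs_sqnorm_merge_less:
  assumes "s < q"
  shows "gs_sqnorm n (col (merge ({..<n} \<times> {..<q}) ({..<n} \<times> {q}) (x, y))) s = gs_sqnorm n (col x) s"
  using assms by (intro gs_sqnorm_cong) (auto simp: merge_def)

lemma gs_sqnorm_merge_last:
  "gs_sqnorm n (col (merge ({..<n} \<times> {..<q}) ({..<n} \<times> {q}) (x, y))) q =
     sq_norm {..<n} (gs_residual {..<n} (col x) q (\<lambda>b\<in>{..<n}. y (b, q)))"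
proof -
  let ?Y = "merge ({..<n} \<times> {..<q}) ({..<n} \<times> {q}) (x, y)"
  have gs: "gram_schmidt {..<n} (col ?Y) s b = gram_schmidt {..<n} (col x) s b" if "s < q" "b \<in> {..<n}" for s b
    using that by (intro gram_schmidt_cong) (auto simp: merge_def)
  have "gram_schmidt {..<n} (col ?Y) q b = gs_residual {..<n} (col x) q (\<lambda>b\<in>{..<n}. y (b, q)) b"
    if b: "b \<in> {..<n}" for b
  proof -
    have cY: "col ?Y q c = (\<lambda>b\<in>{..<n}. y (b, q)) c" if "c \<in> {..<n}" for c using that by (simp add: merge_def)
    have "ip {..<n} (col ?Y q) (gram_schmidt {..<n} (col ?Y) s) = ip {..<n} (\<lambda>b\<in>{..<n}. y (b, q)) (gram_schmidt {..<n} (col x) s)"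
      "sq_norm {..<n} (gram_schmidt {..<n} (col ?Y) s)
       = sq_norm {..<n} (gram_schmidt {..<n} (col x) s)" if "s < q" for s
      using gs[OF that] cY by (auto intro!: ip_cong simp del: restrict_apply)
    then show ?thesis
      using gs cY[OF b] b unfolding gs_residual_def by (subst gram_schmidt.simps) simp
  qed
  then show ?thesis unfolding gs_sqnorm_def by (intro ip_cong) auto
qed

text \<open>Supplies the nondegeneracy that the tail bound assumes: almost surely a new column
  avoids the proper subspace spanned by the earlier ones.\<close>

lemma AE_gs_sqnorm_nonzero:
  "q \<le> n \<Longrightarrow> AE Y in gauss_PiM ({..<n} \<times> {..<q}). \<forall>s<q. gs_sqnorm n (col Y) s \<noteq> 0"
proof (induction q)
  case (Suc q)
  let ?I = "{..<n} \<times> {..<q}"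
  define f where "f Y = (indicator {Y. \<exists>s<Suc q. gs_sqnorm n (col Y) s = 0} Y :: ennreal)" for Y
  define h where "h x y = (indicator {y. (\<exists>s<q. gs_sqnorm n (col x) s = 0) \<or>
     sq_norm {..<n} (gs_residual {..<n} (col x) q y) = 0} y :: ennreal)" for x y
  have fm[measurable]: "f \<in> borel_measurable (gauss_PiM ({..<n} \<times> {..<Suc q}))"
    unfolding f_def indicator_def mem_Collect_eq by measurable
  have fh: "f (merge ?I ({..<n} \<times> {q}) (x, y)) = h x (\<lambda>b\<in>{..<n}. y (b, q))" for x y
    unfolding f_def h_def indicator_def mem_Collect_eq less_Suc_eq ex_disj_distrib conj_disj_distribR
    by (simp add: gs_sqnorm_merge_less gs_sqnorm_merge_last ex_disj_distrib conj_disj_distribR disj_commute cong: conj_cong)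
  have "(\<integral>\<^sup>+Y. f Y \<partial>gauss_PiM ({..<n} \<times> {..<Suc q})) = (\<integral>\<^sup>+x. \<integral>\<^sup>+y. h x y \<partial>gauss_PiM {..<n} \<partial>gauss_PiM ?I)"
  proof (rule nn_integral_split_last_column[OF fm fh])
    fix x
    show "h x \<in> borel_measurable (gauss_PiM {..<n})"
      unfolding h_def indicator_def mem_Collect_eq by measurable
  qed
  also have "\<dots> = (\<integral>\<^sup>+x. 0 \<partial>gauss_PiM ?I)"
  proof (rule nn_integral_cong_AE)
    have "AE x in gauss_PiM ?I. \<forall>s<q. gs_sqnorm n (col x) s \<noteq> 0" using Suc by simp
    then show "AE x in gauss_PiM ?I. (\<integral>\<^sup>+y. h x y \<partial>gauss_PiM {..<n}) = 0"
    proof eventually_elim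
      case (elim x)
      have "(\<integral>\<^sup>+y. h x y \<partial>gauss_PiM {..<n}) =
         (\<integral>\<^sup>+y. indicator {y. sq_norm {..<n} (gs_residual {..<n} (col x) q y) = 0} y \<partial>gauss_PiM {..<n})"
        using elim by (intro nn_integral_cong) (simp add: h_def indicator_def)
      also have "\<dots> = 0"
        using elim Suc.prems by (intro nn_integral_gs_residual_null) (auto simp: gs_sqnorm_def)
      finally show ?case .
    qed
  qed
  finally have "AE Y in gauss_PiM ({..<n} \<times> {..<Suc q}). f Y = 0"
    using nn_integral_0_iff_AE[OF fm] by simp
  then show ?case by eventually_elim (auto simp: f_def indicator_def split: if_splits)
qed simp

text \<open>The conditional tail bound for a new column holds for almost every choice of the earlier
  columns, so the bounds multiply.\<close>

lemma nn_integral_gs_tail_product: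
  "p + r \<le> n \<Longrightarrow>
   (\<integral>\<^sup>+Y. indicator {Y. \<forall>t<r. \<tau> \<le> gs_sqnorm n (col Y) (p + t)} Y \<partial>gauss_PiM ({..<n} \<times> {..<p + r}))
     \<le> ennreal (sqrt 2 ^ (n - p) * exp (- \<tau> / 4)) ^ r"
proof (induction r)
  case 0
  show ?case using gauss_product.P.emeasure_space_1[of "{..<n} \<times> {..<p}"] by simp
next
  case (Suc r)
  let ?q = "p + r"
  let ?I = "{..<n} \<times> {..<?q}"
  let ?\<beta> = "ennreal (sqrt 2 ^ (n - p) * exp (- \<tau> / 4))"
  define f where "f Y = (indicator {Y. \<forall>t<Suc r. \<tau> \<le> gs_sqnorm n (col Y) (p + t)} Y :: ennreal)" for Y
  define F where "F x = (indicator {Y. \<forall>t<r. \<tau> \<le> gs_sqnorm n (col Y) (p + t)} x :: ennreal)" for x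
  define h where "h x y = F x * indicator {y. \<tau> \<le> sq_norm {..<n} (gs_residual {..<n} (col x) ?q y)} y" for x y
  have fm[measurable]: "f \<in> borel_measurable (gauss_PiM ({..<n} \<times> {..<Suc ?q}))"
    unfolding f_def indicator_def mem_Collect_eq by measurable
  have Fm[measurable]: "F \<in> borel_measurable (gauss_PiM ?I)"
    unfolding F_def indicator_def mem_Collect_eq by measurable
  have hm[measurable]: "(\<lambda>y. indicator {y. \<tau> \<le> sq_norm {..<n} (gs_residual {..<n} (col x) ?q y)} y :: ennreal)
      \<in> borel_measurable (gauss_PiM {..<n})" for x
    unfolding indicator_def mem_Collect_eq by measurable
  have fh: "f (merge ?I ({..<n} \<times> {?q}) (x, y)) = h x (\<lambda>b\<in>{..<n}. y (b, ?q))" for x y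
    unfolding f_def h_def F_def indicator_def mem_Collect_eq less_Suc_eq all_conj_distrib
    by (auto simp: gs_sqnorm_merge_less gs_sqnorm_merge_last)
  have "(\<integral>\<^sup>+Y. f Y \<partial>gauss_PiM ({..<n} \<times> {..<p + Suc r})) = (\<integral>\<^sup>+x. \<integral>\<^sup>+y. h x y \<partial>gauss_PiM {..<n} \<partial>gauss_PiM ?I)"
    unfolding add_Suc_right
  proof (rule nn_integral_split_last_column[OF fm fh])
    fix x
    show "h x \<in> borel_measurable (gauss_PiM {..<n})"
      unfolding h_def by measurable
  qed
  also have "\<dots> \<le> (\<integral>\<^sup>+x. F x * ?\<beta> \<partial>gauss_PiM ?I)"
  proof (rule nn_integral_mono_AE)
    have "AE x in gauss_PiM ?I. \<forall>s<?q. gs_sqnorm n (col x) s \<noteq> 0"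
      using Suc.prems by (intro AE_gs_sqnorm_nonzero) auto
    then show "AE x in gauss_PiM ?I. (\<integral>\<^sup>+y. h x y \<partial>gauss_PiM {..<n}) \<le> F x * ?\<beta>"
    proof eventually_elim
      case (elim x)
      have "(\<integral>\<^sup>+y. h x y \<partial>gauss_PiM {..<n}) = F x *
         (\<integral>\<^sup>+y. indicator {y. \<tau> \<le> sq_norm {..<n} (gs_residual {..<n} (col x) ?q y)} y \<partial>gauss_PiM {..<n})"
        unfolding h_def by (rule nn_integral_cmult) measurable
      also have "\<dots> \<le> F x * ennreal (sqrt 2 ^ (card {..<n} - ?q) * exp (- \<tau> / 4))"
        using elim Suc.prems by (intro mult_left_mono nn_integral_gs_residual_tail) (auto simp: gs_sqnorm_def)
      \<comment> \<open>Column \<open>p + r\<close> has only \<open>n - p - r\<close> degrees of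
        freedom; \<open>n - p\<close> serves all factors alike.\<close>
      also have "\<dots> \<le> F x * ?\<beta>"
        by (intro mult_left_mono ennreal_leI mult_right_mono power_increasing) auto
      finally show ?case .
    qed
  qed
  also have "\<dots> = (\<integral>\<^sup>+x. F x \<partial>gauss_PiM ?I) * ?\<beta>"
    by (rule nn_integral_multc) measurable
  also have "\<dots> \<le> ?\<beta> ^ r * ?\<beta>"
    using Suc unfolding F_def by (intro mult_right_mono) auto
  finally show ?case by (simp add: f_def mult.commute)
qed

text \<open>\<open>mat_apply\<close> without the truncation to the first rows; the norms below read
  only coordinates under \<open>n\<close>.\<close>

definition mv :: "nat \<Rightarrow> (nat \<times> nat \<Rightarrow> real) \<Rightarrow> (nat \<Rightarrow> real) \<Rightarrow> nat \<Rightarrow> real" where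
  "mv m G w = (\<lambda>b. \<Sum>j<m. G (b, j) * w j)"

text \<open>A Gaussian matrix maps an orthonormal list to independent standard Gaussian columns, so
  the bound for the first \<open>p + r\<close> columns holds for every such list fixed in
  advance.\<close>

theorem prob_orthonormal_columns_far:
  fixes \<tau> :: real
  assumes "orthonormal {..<m} us" "length us = p + r" "p + r \<le> n" "n \<le> m"
  defines "B \<equiv> {G \<in> space (gaussian_matrix n m). \<forall>t<r. \<tau> \<le> gs_sqnorm n (\<lambda>s. mv m G (us ! s)) (p + t)}"
  shows "B \<in> sets (gaussian_matrix n m)"
    "emeasure (gaussian_matrix n m) B \<le> ennreal (sqrt 2 ^ (n - p) * exp (- \<tau> / 4)) ^ r"
proof -
  let ?I = "{..<n} \<times> {..<m}" and ?K = "{..<n} \<times> {..<p + r}"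
  have GM: "gaussian_matrix n m = gauss_PiM ?I" by (simp add: gaussian_matrix_def)
  have mvm[measurable]: "(\<lambda>G. mv m G w b) \<in> borel_measurable (gauss_PiM ?I)" if "b < n" for w b
    unfolding mv_def using that
    by (intro borel_measurable_sum borel_measurable_times borel_measurable_const measurable_gauss_component) auto
  have [measurable]: "(\<lambda>G. gs_sqnorm n (\<lambda>s. mv m G (us ! s)) t) \<in> borel_measurable (gauss_PiM ?I)" for t
    by (intro measurable_gs_sqnorm mvm)
  show B: "B \<in> sets (gaussian_matrix n m)"
    unfolding B_def GM by measurable
  \<comment> \<open>Entry \<open>(b, s)\<close> of the image is the inner product of the matrix with
    the one that has \<open>us ! s\<close> as row \<open>b\<close> and zeros elsewhere. These are
    orthonormal as vectors indexed by pairs.\<close>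
  define u :: "nat \<times> nat \<Rightarrow> nat \<times> nat \<Rightarrow> real" where
    "u = (\<lambda>(b, s). \<lambda>(c, j). if c = b then (us ! s) j else (0 :: real))"
  have ipu: "ip ?I (u (b, s)) x = (\<Sum>j<m. (us ! s) j * x (b, j))" if "b < n" for b s x
  proof -
    have "ip ?I (u (b, s)) x = (\<Sum>c<n. \<Sum>j<m. u (b, s) (c, j) * x (c, j))"
      unfolding ip_def by (simp add: sum.cartesian_product)
    also have "\<dots> = (\<Sum>c<n. if c = b then (\<Sum>j<m. (us ! s) j * x (b, j)) else 0)"
      by (intro sum.cong) (auto simp: u_def)
    finally show ?thesis using that by simp
  qed
  have on: "ip ?I (u a) (u a') = (if a = a' then 1 else 0)" if "a \<in> ?K" "a' \<in> ?K" for a a'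
  proof -
    obtain b s b' s' where a: "a = (b, s)" "a' = (b', s')" by (metis surj_pair)
    have "ip ?I (u a) (u a') = (\<Sum>j<m. (us ! s) j * u a' (b, j))"
      using that a by (simp add: ipu)
    also have "\<dots> = (if b = b' then ip {..<m} (us ! s) (us ! s') else 0)"
      by (auto simp: a u_def ip_def)
    also have "\<dots> = (if a = a' then 1 else 0)"
      using assms(1,2) that a by (auto simp: orthonormal_def)
    finally show ?thesis .
  qed
  let ?T = "\<lambda>x. \<lambda>a\<in>?K. ip ?I (u a) x"
  have meas: "?T \<in> measurable (gauss_PiM ?I) (gauss_PiM ?K)"
    by (intro measurable_gauss_PiM_I) auto
  have eq: "gs_sqnorm n (\<lambda>s. mv m x (us ! s)) (p + t) = gs_sqnorm n (col (?T x)) (p + t)" if "t < r" for t x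
    using that by (intro gs_sqnorm_cong) (auto simp: mv_def ipu mult.commute)
  have fm: "(\<lambda>Y. indicator {Y. \<forall>t<r. \<tau> \<le> gs_sqnorm n (col Y) (p + t)} Y :: ennreal) \<in> borel_measurable (gauss_PiM ?K)"
    unfolding indicator_def mem_Collect_eq by measurable
  have "emeasure (gauss_PiM ?I) B = (\<integral>\<^sup>+x. indicator B x \<partial>gauss_PiM ?I)"
    using B by (simp add: GM)
  also have "\<dots> = (\<integral>\<^sup>+x. indicator {Y. \<forall>t<r. \<tau> \<le> gs_sqnorm n (col Y) (p + t)} (?T x) \<partial>gauss_PiM ?I)"
    by (intro nn_integral_cong) (simp add: B_def GM indicator_def eq del: restrict_apply)
  also have "\<dots> = (\<integral>\<^sup>+Y. indicator {Y. \<forall>t<r. \<tau> \<le> gs_sqnorm n (col Y) (p + t)} Y \<partial>distr (gauss_PiM ?I) (gauss_PiM ?K) ?T)"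
    by (rule nn_integral_distr[OF meas, symmetric]) (use fm in simp)
  also have "\<dots> = (\<integral>\<^sup>+Y. indicator {Y. \<forall>t<r. \<tau> \<le> gs_sqnorm n (col Y) (p + t)} Y \<partial>gauss_PiM ?K)"
    using assms(3,4) by (subst distr_gauss_orthonormal[OF _ _ on]) auto
  also have "\<dots> \<le> ennreal (sqrt 2 ^ (n - p) * exp (- \<tau> / 4)) ^ r"
    by (rule nn_integral_gs_tail_product[OF assms(3)])
  finally show "emeasure (gaussian_matrix n m) B \<le> ennreal (sqrt 2 ^ (n - p) * exp (- \<tau> / 4)) ^ r"
    by (simp add: GM)
qed

section \<open>Maurey's empirical method\<close>

text \<open>
  Derandomised: the cross term of the next summand averages to zero, so some choice does not
  increase the squared error by more than the bound on a single summand.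
\<close>

lemma empirical_method:
  fixes y :: "'s \<Rightarrow> 'x \<Rightarrow> real"
  assumes X: "finite X" "\<And>x. x \<in> X \<Longrightarrow> 0 \<le> p x" "(\<Sum>x\<in>X. p x) = 1"
    and C: "\<And>x. x \<in> X \<Longrightarrow> (\<Sum>s\<in>F. (y s x)\<^sup>2) \<le> C"
  defines "\<mu> \<equiv> \<lambda>s. \<Sum>x\<in>X. p x * y s x"
  shows "\<exists>c. (\<forall>t. c t \<in> X) \<and> (\<Sum>s\<in>F. (\<Sum>t<k. y s (c t) - \<mu> s)\<^sup>2) \<le> real k * C"
proof (induction k)
  case 0
  have "X \<noteq> {}" using X(3) by auto
  then obtain x where "x \<in> X" by blast
  then show ?case by (intro exI[of _ "\<lambda>_. x"]) simp
next
  case (Suc k)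
  then obtain c where c: "\<And>t. c t \<in> X" "(\<Sum>s\<in>F. (\<Sum>t<k. y s (c t) - \<mu> s)\<^sup>2) \<le> real k * C" by auto
  define R where "R s = (\<Sum>t<k. y s (c t) - \<mu> s)" for s
  have avg: "(\<Sum>x\<in>X. p x * (R s + (y s x - \<mu> s))\<^sup>2) = (R s)\<^sup>2 + (\<Sum>x\<in>X. p x * (y s x)\<^sup>2) - (\<mu> s)\<^sup>2" for s
  proof -
    have "(\<Sum>x\<in>X. p x * (R s + (y s x - \<mu> s))\<^sup>2)
        = (\<Sum>x\<in>X. p x * (R s - \<mu> s)\<^sup>2 + 2 * (R s - \<mu> s) * (p x * y s x) + p x * (y s x)\<^sup>2)"
      by (intro sum.cong) (auto simp: power2_eq_square algebra_simps)
    also have "\<dots> = (R s - \<mu> s)\<^sup>2 + 2 * (R s - \<mu> s) * \<mu> s + (\<Sum>x\<in>X. p x * (y s x)\<^sup>2)"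
      using X(3) by (simp add: sum.distrib \<mu>_def flip: sum_distrib_left sum_distrib_right)
    also have "(R s - \<mu> s)\<^sup>2 + 2 * (R s - \<mu> s) * \<mu> s = (R s)\<^sup>2 - (\<mu> s)\<^sup>2"
      by (simp add: power2_eq_square algebra_simps)
    finally show ?thesis by simp
  qed
  have "\<exists>x\<in>X. (\<Sum>s\<in>F. (R s + (y s x - \<mu> s))\<^sup>2) \<le> real k * C + C"
  proof (rule ccontr)
    assume "\<not> ?thesis"
    then have gt: "real k * C + C < (\<Sum>s\<in>F. (R s + (y s x - \<mu> s))\<^sup>2)" if "x \<in> X" for x
      using that by force
    \<comment> \<open>A point of positive weight makes the averaged inequality strict.\<close>
    obtain x0 where x0: "x0 \<in> X" "p x0 > 0"
      using X by (metis (no_types, lifting) order_le_less sum.neutral zero_neq_one)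
    have "(\<Sum>x\<in>X. p x * (real k * C + C)) < (\<Sum>x\<in>X. p x * (\<Sum>s\<in>F. (R s + (y s x - \<mu> s))\<^sup>2))"
    proof (rule sum_strict_mono_ex1)
      show "\<forall>x\<in>X. p x * (real k * C + C) \<le> p x * (\<Sum>s\<in>F. (R s + (y s x - \<mu> s))\<^sup>2)"
        by (intro ballI mult_left_mono less_imp_le[OF gt] X(2))
      show "\<exists>x\<in>X. p x * (real k * C + C) < p x * (\<Sum>s\<in>F. (R s + (y s x - \<mu> s))\<^sup>2)"
        using x0 gt by (intro bexI[of _ x0] mult_strict_left_mono) auto
    qed (rule X(1))
    also have "\<dots> = (\<Sum>s\<in>F. \<Sum>x\<in>X. p x * (R s + (y s x - \<mu> s))\<^sup>2)"
      unfolding sum_distrib_left by (rule sum.swap)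
    also have "\<dots> \<le> (\<Sum>s\<in>F. (R s)\<^sup>2 + (\<Sum>x\<in>X. p x * (y s x)\<^sup>2))"
      unfolding avg by (intro sum_mono) simp
    also have "\<dots> = (\<Sum>s\<in>F. (R s)\<^sup>2) + (\<Sum>x\<in>X. p x * (\<Sum>s\<in>F. (y s x)\<^sup>2))"
      unfolding sum.distrib sum_distrib_left by (subst sum.swap[of _ F]) simp
    also have "\<dots> \<le> real k * C + (\<Sum>x\<in>X. p x * C)"
      using c(2) C X(2) by (intro add_mono sum_mono mult_left_mono) (auto simp: R_def)
    finally show False using X(3) by (simp flip: sum_distrib_right)
  qed
  then obtain x where x: "x \<in> X" "(\<Sum>s\<in>F. (R s + (y s x - \<mu> s))\<^sup>2) \<le> real k * C + C" by blast
  show ?case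
    using c(1) x by (intro exI[of _ "c(k := x)"]) (auto simp: R_def algebra_simps)
qed

text \<open>The codes \<open>0..<m\<close>, \<open>m..<2 * m\<close> and \<open>2 * m\<close> stand for \<open>e\<^sub>j\<close>, \<open>-e\<^sub>j\<close> and \<open>0\<close>.\<close>

definition atom :: "nat \<Rightarrow> nat \<Rightarrow> nat \<Rightarrow> real" where
  "atom m x j = (if x = j then 1 else if x = m + j then -1 else 0)"

text \<open>A point of \<open>\<rho>\<close> times the cross-polytope described by \<open>k\<close>
  codes below \<open>2 * m + 1\<close>, so that all such points can be counted.\<close>

definition sparse_avg :: "nat \<Rightarrow> nat \<Rightarrow> real \<Rightarrow> (nat \<Rightarrow> nat) \<Rightarrow> nat \<Rightarrow> real" where
  "sparse_avg m k \<rho> c = (\<lambda>j. \<rho> / real k * (\<Sum>t<k. atom m (c t) j))"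

lemma sum_atom:
  fixes f :: "nat \<Rightarrow> real"
  assumes "x \<le> 2 * m"
  shows "(\<Sum>j<m. f j * atom m x j) = (if x < m then f x else if x < 2 * m then - f (x - m) else 0)"
proof -
  have "(\<Sum>j<m. f j * atom m x j) = (\<Sum>j<m. if j = x then f x else if j = x - m \<and> m \<le> x then - f (x - m) else 0)"
    using assms by (intro sum.cong) (auto simp: atom_def)
  also have "\<dots> = (if x < m then f x else if x < 2 * m then - f (x - m) else 0)"
  proof (cases "x < m")
    case True
    then have "(\<Sum>j<m. if j = x then f x else if j = x - m \<and> m \<le> x then - f (x - m) else 0) = (\<Sum>j<m. if j = x then f x else 0)"
      by (intro sum.cong) auto
    then show ?thesis using True by simp
  next
    case False
    then have "(\<Sum>j<m. if j = x then f x else if j = x - m \<and> m \<le> x then - f (x - m) else 0) = (\<Sum>j<m. if j = x - m then - f (x - m) else 0)"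
      by (intro sum.cong) auto
    then show ?thesis using False by auto
  qed
  finally show ?thesis .
qed

text \<open>The functionals \<open>\<phi> s\<close> are the coordinates of a linear map into a
  Euclidean space, and \<open>B\<close> bounds the squared lengths of the images of the unit
  vectors. The error is measured after this map, which later is chosen to suit the
  projection.\<close>

lemma maurey_l1:
  assumes a: "(\<Sum>j<m. \<bar>a j\<bar>) \<le> \<rho>" and "\<rho> > 0" "k > 0" "B \<ge> 0"
    and B: "\<And>j. j < m \<Longrightarrow> (\<Sum>s\<in>F. (\<phi> s j)\<^sup>2) \<le> B"
  shows "\<exists>c\<in>{..<k} \<rightarrow>\<^sub>E {..2 * m}. (\<Sum>s\<in>F. (\<Sum>j<m. \<phi> s j * (a j - sparse_avg m k \<rho> c j))\<^sup>2) \<le> B * \<rho>\<^sup>2 / real k"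
proof -
  \<comment> \<open>A random atom of mean \<open>a / \<rho>\<close>: the positive and negative parts
    of \<open>a\<close> weight the signed unit vectors, and the zero atom takes the missing
    mass.\<close>
  define p where "p x = (if x < m then max (a x) 0 / \<rho> else if x < 2 * m then max (- a (x - m)) 0 / \<rho>
     else 1 - (\<Sum>j<m. \<bar>a j\<bar>) / \<rho>)" for x
  define y where "y s x = \<rho> * (\<Sum>j<m. \<phi> s j * atom m x j)" for s x
  have split: "(\<Sum>x\<in>{..2 * m}. h x) = (\<Sum>j<m. h j) + (\<Sum>j<m. h (m + j)) + h (2 * m)" for h :: "nat \<Rightarrow> real"
  proof -
    have "{..2 * m} = insert (2 * m) {..<m + m}" by auto
    then show ?thesis by (simp add: sum_lessThan_add)
  qed
  have p0: "0 \<le> p x" for x using a assms(2) by (auto simp: p_def field_simps)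
  have p1: "(\<Sum>x\<in>{..2 * m}. p x) = 1"
  proof -
    have "(\<Sum>j<m. p j) + (\<Sum>j<m. p (m + j)) = (\<Sum>j<m. \<bar>a j\<bar> / \<rho>)"
      unfolding sum.distrib[symmetric]
      by (intro sum.cong) (auto simp: p_def max_def simp flip: add_divide_distrib)
    then show ?thesis by (simp add: split p_def sum_divide_distrib)
  qed
  have yval: "y s x = \<rho> * (if x < m then \<phi> s x else if x < 2 * m then - \<phi> s (x - m) else 0)" if "x \<le> 2 * m" for s x
    using sum_atom[OF that] by (simp add: y_def)
  have mean: "(\<Sum>x\<in>{..2 * m}. p x * y s x) = (\<Sum>j<m. \<phi> s j * a j)" for s
  proof -
    have "(\<Sum>x\<in>{..2 * m}. p x * y s x) = (\<Sum>j<m. p j * y s j) + (\<Sum>j<m. p (m + j) * y s (m + j))"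
      by (simp add: split yval)
    also have "\<dots> = (\<Sum>j<m. \<phi> s j * a j)"
      unfolding sum.distrib[symmetric] using assms(2)
      by (intro sum.cong) (auto simp: p_def yval max_def)
    finally show ?thesis .
  qed
  have bound: "(\<Sum>s\<in>F. (y s x)\<^sup>2) \<le> B * \<rho>\<^sup>2" if "x \<in> {..2 * m}" for x
  proof -
    have "(\<Sum>s\<in>F. (y s x)\<^sup>2) = \<rho>\<^sup>2 * (\<Sum>s\<in>F. (if x < m then \<phi> s x else if x < 2 * m then - \<phi> s (x - m) else 0)\<^sup>2)"
      using that by (simp add: yval power_mult_distrib sum_distrib_left)
    also have "\<dots> \<le> \<rho>\<^sup>2 * B"
    proof (rule mult_left_mono)
      show "(\<Sum>s\<in>F. (if x < m then \<phi> s x else if x < 2 * m then - \<phi> s (x - m) else 0)\<^sup>2) \<le> B"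
        using B[of x] B[of "x - m"] \<open>B \<ge> 0\<close> by (cases "x < m"; cases "x < 2 * m") auto
    qed simp
    finally show ?thesis by (simp add: mult.commute)
  qed
  obtain c where c: "\<And>t. c t \<in> {..2 * m}"
    "(\<Sum>s\<in>F. (\<Sum>t<k. y s (c t) - (\<Sum>j<m. \<phi> s j * a j))\<^sup>2) \<le> real k * (B * \<rho>\<^sup>2)"
    using empirical_method[where X = "{..2 * m}" and p = p and F = F and y = y and C = "B * \<rho>\<^sup>2" and k = k]
      p0 p1 bound unfolding mean by auto
  \<comment> \<open>Cutting off at \<open>k\<close> puts the code into the finite set over which the
    union bound runs.\<close>
  define c' where "c' = restrict c {..<k}"
  have sp: "sparse_avg m k \<rho> c' = sparse_avg m k \<rho> c" by (simp add: sparse_avg_def c'_def)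
  have "(\<Sum>j<m. \<phi> s j * (a j - sparse_avg m k \<rho> c' j)) = - (\<Sum>t<k. y s (c t) - (\<Sum>j<m. \<phi> s j * a j)) / real k" for s
  proof -
    have "(\<Sum>t<k. y s (c t)) = \<rho> * (\<Sum>j<m. \<phi> s j * (\<Sum>t<k. atom m (c t) j))"
      unfolding y_def sum_distrib_left by (subst sum.swap) (simp add: mult_ac)
    also have "\<dots> = real k * (\<Sum>j<m. \<phi> s j * sparse_avg m k \<rho> c j)"
      using assms(3) by (simp add: sparse_avg_def sum_distrib_left mult_ac)
    finally show ?thesis using assms(3)
      by (simp add: sp sum_subtractf right_diff_distrib field_simps)
  qed
  then have "(\<Sum>s\<in>F. (\<Sum>j<m. \<phi> s j * (a j - sparse_avg m k \<rho> c' j))\<^sup>2)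
     = (\<Sum>s\<in>F. (\<Sum>t<k. y s (c t) - (\<Sum>j<m. \<phi> s j * a j))\<^sup>2) / (real k)\<^sup>2"
    by (simp only: power_divide power2_minus sum_divide_distrib)
  also have "\<dots> \<le> real k * (B * \<rho>\<^sup>2) / (real k)\<^sup>2"
    by (intro divide_right_mono c) simp
  also have "\<dots> = B * \<rho>\<^sup>2 / real k" using assms(3) by (simp add: power2_eq_square)
  finally show ?thesis using c(1) by (intro bexI[of _ c']) (auto simp: c'_def)
qed

section \<open>Greedy extension of an orthonormal list\<close>

lemma mv_cong: "(\<And>j. j < m \<Longrightarrow> w j = w' j) \<Longrightarrow> mv m G w = mv m G w'"
  by (auto simp: mv_def intro!: ext sum.cong)

lemma mv_add: "mv m G (\<lambda>j. v j + w j) = (\<lambda>b. mv m G v b + mv m G w b)"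
  and mv_scale: "mv m G (\<lambda>j. c * w j) = (\<lambda>b. c * mv m G w b)"
  by (simp_all add: mv_def algebra_simps sum.distrib sum_subtractf sum_distrib_left fun_eq_iff)

lemma mv_sum: "mv m G (\<lambda>j. \<Sum>s\<in>S. f s j) = (\<lambda>b. \<Sum>s\<in>S. mv m G (f s) b)"
  unfolding mv_def sum_distrib_left by (intro ext sum.swap)

text \<open>Squared distance of the image of \<open>w\<close> from the span of the images of
  \<open>us\<close>.\<close>

definition dist_sq :: "nat \<Rightarrow> nat \<Rightarrow> (nat \<times> nat \<Rightarrow> real) \<Rightarrow> (nat \<Rightarrow> real) list \<Rightarrow> (nat \<Rightarrow> real) \<Rightarrow> real" where
  "dist_sq n m G us w = (let r = gs_residual {..<n} (\<lambda>s. mv m G (us ! s)) (length us) (mv m G w)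
     in sq_norm {..<n} r)"

lemma dist_sq_nonneg: "0 \<le> dist_sq n m G us w"
  by (simp add: dist_sq_def Let_def)

lemma dist_sq_scale: "dist_sq n m G us (\<lambda>j. c * w j) = c\<^sup>2 * dist_sq n m G us w"
  by (simp add: dist_sq_def Let_def mv_scale gs_residual_scale ip_scale_left ip_scale_right power2_eq_square)

text \<open>The part of \<open>w\<close> inside the span of \<open>us\<close> is mapped into the
  span of the images, where the residual vanishes.\<close>

lemma dist_sq_residual: "dist_sq n m G us (residual {..<m} us w) = dist_sq n m G us w"
proof -
  let ?g = "\<lambda>s. mv m G (us ! s)"
  let ?r = "gs_residual {..<n} ?g (length us)"
  define c where "c i = ip {..<m} w (us ! i)" for i
  have w: "w = (\<lambda>j. residual {..<m} us w j + (\<Sum>i<length us. c i * (us ! i) j))"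
    by (simp add: residual_def c_def)
  have "?r (mv m G w) = ?r (mv m G (\<lambda>j. residual {..<m} us w j + (\<Sum>i<length us. c i * (us ! i) j)))"
    using w by (rule arg_cong)
  also have "\<dots> = (\<lambda>b. ?r (mv m G (residual {..<m} us w)) b + (\<Sum>i<length us. c i * ?r (?g i) b))"
    by (simp only: mv_add mv_sum mv_scale gs_residual_add gs_residual_sum gs_residual_scale)
  finally have eq: "?r (mv m G w) = (\<lambda>b. ?r (mv m G (residual {..<m} us w)) b + (\<Sum>i<length us. c i * ?r (?g i) b))" .
  have "?r (?g i) b = 0" if "i < length us" "b \<in> {..<n}" for i b
    using gs_residual_eq_0[of "{..<n}" i "length us" b ?g] that by simp
  then have "?r (mv m G w) b = ?r (mv m G (residual {..<m} us w)) b" if "b \<in> {..<n}" for b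
    using that by (simp add: eq)
  then show ?thesis unfolding dist_sq_def Let_def by (intro ip_cong) auto
qed

lemma gs_sqnorm_eq_dist_sq:
  assumes "\<And>s. s < length us \<Longrightarrow> vs ! s = us ! s"
  shows "gs_sqnorm n (\<lambda>s. mv m G (vs ! s)) (length us) = dist_sq n m G us (vs ! length us)"
proof -
  let ?q = "length us"
  have gs: "gram_schmidt {..<n} (\<lambda>s. mv m G (vs ! s)) s b = gram_schmidt {..<n} (\<lambda>s. mv m G (us ! s)) s b"
    if "s < ?q" "b \<in> {..<n}" for s b
    using that assms by (intro gram_schmidt_cong) auto
  have "ip {..<n} z (gram_schmidt {..<n} (\<lambda>s. mv m G (vs ! s)) s) = ip {..<n} z (gram_schmidt {..<n} (\<lambda>s. mv m G (us ! s)) s)"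
    "sq_norm {..<n} (gram_schmidt {..<n} (\<lambda>s. mv m G (vs ! s)) s) =
     sq_norm {..<n} (gram_schmidt {..<n} (\<lambda>s. mv m G (us ! s)) s)"
    if "s < ?q" for s z
    using gs[OF that] by (auto intro!: ip_cong)
  then have "gram_schmidt {..<n} (\<lambda>s. mv m G (vs ! s)) ?q b =
     gs_residual {..<n} (\<lambda>s. mv m G (us ! s)) ?q (mv m G (vs ! ?q)) b" if "b \<in> {..<n}" for b
    using gs that unfolding gs_residual_def by (subst gram_schmidt.simps) simp
  then show ?thesis unfolding gs_sqnorm_def dist_sq_def Let_def by (intro ip_cong) auto
qed

text \<open>The direction is orthogonalised and normalised in coefficient space, not after applying
  the matrix: that keeps the images of the list independent Gaussian columns.\<close>

definition add_dir :: "nat \<Rightarrow> (nat \<Rightarrow> real) list \<Rightarrow> (nat \<Rightarrow> real) \<Rightarrow> (nat \<Rightarrow> real) list" where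
  "add_dir m us w = us @ [let r = residual {..<m} us w in (\<lambda>b. (1 / sqrt (sq_norm {..<m} r)) * r b)]"

text \<open>All possible records of \<open>r\<close> greedy steps with directions from
  \<open>S\<close>. No matrix occurs, which is what permits a union bound.\<close>

fun extensions :: "nat \<Rightarrow> (nat \<Rightarrow> real) set \<Rightarrow> nat \<Rightarrow> (nat \<Rightarrow> real) list \<Rightarrow> (nat \<Rightarrow> real) list set" where
  "extensions m S 0 us = {us}"
| "extensions m S (Suc r) us =
     (\<Union>w\<in>{w\<in>S. sq_norm {..<m} (residual {..<m} us w) \<noteq> 0}. extensions m S r (add_dir m us w))"

lemma orthonormal_add_dir:
  assumes "orthonormal {..<m} us" "sq_norm {..<m} (residual {..<m} us w) \<noteq> 0"
  shows "orthonormal {..<m} (add_dir m us w)"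
proof -
  have "sq_norm {..<m} (residual {..<m} us w) > 0"
    using assms(2) by (simp add: order_le_neq_trans)
  then show ?thesis
    unfolding add_dir_def Let_def orthonormal_snoc ip_scale_left ip_scale_right
    using assms(1) residual_orth[OF assms(1)] by simp
qed

lemma extensions_props:
  "orthonormal {..<m} us \<Longrightarrow> us' \<in> extensions m S r us \<Longrightarrow>
     orthonormal {..<m} us' \<and> length us' = length us + r \<and> (\<exists>vs. us' = us @ vs)"
proof (induction r arbitrary: us)
  case (Suc r)
  then obtain w where w: "us' \<in> extensions m S r (add_dir m us w)"
    "sq_norm {..<m} (residual {..<m} us w) \<noteq> 0" by auto
  from Suc.IH[OF orthonormal_add_dir[OF Suc.prems(1) w(2)] w(1)] show ?case
    by (auto simp: add_dir_def)
qed auto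

lemma finite_extensions: "finite S \<Longrightarrow> finite (extensions m S r us)"
  by (induction r arbitrary: us) auto

lemma card_extensions:
  assumes "finite S"
  shows "card (extensions m S r us) \<le> card S ^ r"
proof (induction r arbitrary: us)
  case (Suc r)
  let ?S = "{w\<in>S. sq_norm {..<m} (residual {..<m} us w) \<noteq> 0}"
  have "card (extensions m S (Suc r) us) \<le> (\<Sum>w\<in>?S. card (extensions m S r (add_dir m us w)))"
    using assms by (simp add: card_UN_le)
  also have "\<dots> \<le> (\<Sum>w\<in>?S. card S ^ r)" by (intro sum_mono Suc.IH)
  also have "\<dots> \<le> card S ^ Suc r"
    using assms by (simp add: card_mono mult_right_mono)
  finally show ?case .
qed simp

text \<open>While some \<open>w\<close> in \<open>S\<close> is farther than \<open>\<tau>\<close>,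
  its direction is appended and yields a column far from its predecessors. After \<open>r\<close>
  such steps all \<open>r\<close> new columns would be far, against the last assumption.\<close>

lemma greedy_extension:
  assumes "orthonormal {..<m} us" "\<And>w. w \<in> S \<Longrightarrow> sq_norm {..<m} w \<le> 1" "0 \<le> \<tau>"
    and "\<And>us'. us' \<in> extensions m S r us \<Longrightarrow>
      \<exists>t<r. gs_sqnorm n (\<lambda>s. mv m G (us' ! s)) (length us + t) < \<tau>"
  shows "\<exists>r'<r. \<exists>us'\<in>extensions m S r' us. \<forall>w\<in>S. dist_sq n m G us' w \<le> \<tau>"
  using assms(1,4)
proof (induction r arbitrary: us)
  case (Suc r)
  show ?case
  proof (cases "\<forall>w\<in>S. dist_sq n m G us w \<le> \<tau>")
    case True
    then show ?thesis by (intro exI[of _ 0]) auto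
  next
    case False
    then obtain w where w: "w \<in> S" "dist_sq n m G us w > \<tau>" by force
    let ?r = "residual {..<m} us w"
    have nz: "sq_norm {..<m} ?r \<noteq> 0"
    proof
      assume "sq_norm {..<m} ?r = 0"
      then have "mv m G ?r = mv m G (\<lambda>j. 0)" by (intro mv_cong) (simp add: ip_self_eq_0)
      then have "dist_sq n m G us ?r = dist_sq n m G us (\<lambda>j. 0 * w j)" by (simp add: dist_sq_def)
      also have "\<dots> = 0" by (subst dist_sq_scale) simp
      finally show False using w(2) assms(3) unfolding dist_sq_residual by simp
    qed
    have pos: "sq_norm {..<m} ?r > 0" using nz by (simp add: order_le_neq_trans)
    have le1: "sq_norm {..<m} ?r \<le> 1"
      using residual_norm[OF Suc.prems(1), of w] assms(2)[OF w(1)] sum_nonneg[of "{..<length us}" "\<lambda>i. (ip {..<m} w (us ! i))\<^sup>2"]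
      by simp
    let ?us = "add_dir m us w"
    have last: "?us ! length us = (\<lambda>b. (1 / sqrt (sq_norm {..<m} ?r)) * ?r b)"
      by (simp add: add_dir_def Let_def)
    \<comment> \<open>The residual has norm at most 1, so normalising it can only increase the
      distance.\<close>
    have "\<tau> \<le> (1 / sqrt (sq_norm {..<m} ?r))\<^sup>2 * dist_sq n m G us w"
    proof -
      have "1 * dist_sq n m G us w \<le> (1 / sqrt (sq_norm {..<m} ?r))\<^sup>2 * dist_sq n m G us w"
        using pos le1 dist_sq_nonneg by (intro mult_right_mono) (auto simp: power_divide)
      then show ?thesis using w(2) by simp
    qed
    then have big: "\<tau> \<le> dist_sq n m G us (?us ! length us)"
      unfolding last by (subst dist_sq_scale, subst dist_sq_residual)
    have on: "orthonormal {..<m} ?us" by (rule orthonormal_add_dir[OF Suc.prems(1) nz])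
    have len: "length ?us = Suc (length us)" by (simp add: add_dir_def)
    have "\<exists>r'<r. \<exists>us'\<in>extensions m S r' ?us. \<forall>w\<in>S. dist_sq n m G us' w \<le> \<tau>"
    proof (rule Suc.IH[OF on])
      fix us' assume us': "us' \<in> extensions m S r ?us"
      then have "us' \<in> extensions m S (Suc r) us" using w(1) nz by auto
      from Suc.prems(2)[OF this] obtain t where
        t: "t < Suc r" "gs_sqnorm n (\<lambda>s. mv m G (us' ! s)) (length us + t) < \<tau>" by blast
      obtain vs where vs: "us' = ?us @ vs" using extensions_props[OF on us'] by blast
      have "gs_sqnorm n (\<lambda>s. mv m G (us' ! s)) (length us) = dist_sq n m G us (us' ! length us)"
        by (rule gs_sqnorm_eq_dist_sq) (simp add: vs add_dir_def nth_append)
      also have "us' ! length us = ?us ! length us" by (simp add: vs add_dir_def nth_append)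
      \<comment> \<open>The near column is not the one just appended; it belongs to the remaining
        \<open>r\<close> steps, counted from one position later.\<close>
      finally have "t \<noteq> 0" using t(2) big by (cases "t = 0") auto
      then show "\<exists>t<r. gs_sqnorm n (\<lambda>s. mv m G (us' ! s)) (length ?us + t) < \<tau>"
        using t len by (intro exI[of _ "t - 1"]) auto
    qed
    then obtain r' us' where r': "r' < r" "us' \<in> extensions m S r' ?us" "\<forall>w\<in>S. dist_sq n m G us' w \<le> \<tau>" by blast
    then show ?thesis using w(1) nz by (intro exI[of _ "Suc r'"]) auto
  qed
qed simp

section \<open>A lower bound for the \<open>\<ell>\<^sub>1\<close> norm of the transposed matrix\<close>

definition l1_image :: "nat \<Rightarrow> nat \<Rightarrow> (nat \<times> nat \<Rightarrow> real) \<Rightarrow> (nat \<Rightarrow> real) \<Rightarrow> real" where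
  "l1_image n m G t = (\<Sum>j<m. \<bar>\<Sum>b<n. G (b, j) * t b\<bar>)"

lemma l1_image_scale: "l1_image n m G (\<lambda>b. c * t b) = \<bar>c\<bar> * l1_image n m G t"
proof -
  have "(\<Sum>b<n. G (b, j) * (c * t b)) = c * (\<Sum>b<n. G (b, j) * t b)" for j
    by (simp add: sum_distrib_left mult_ac)
  then show ?thesis by (simp only: l1_image_def abs_mult flip: sum_distrib_left)
qed

text \<open>The interval \<open>{- (1/4)..1/4}\<close> has probability at most 1/4, the density
  being at most 1/2; outside it the integrand is at most \<open>exp (- 2)\<close>, hence at most
  1/5.\<close>

lemma nn_integral_exp_abs: "(\<integral>\<^sup>+y. ennreal (exp (- 8 * \<bar>y\<bar>)) \<partial>std_gauss) \<le> ennreal (1 / 2)"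
proof -
  have e2: "exp (- 2 :: real) \<le> 1 / 5"
  proof -
    have "(5 :: real) \<le> exp 2" using exp_lower_Taylor_quadratic[of 2] by simp
    then show ?thesis by (simp add: exp_minus field_simps)
  qed
  have dens: "std_normal_density y \<le> 1 / 2" for y
  proof -
    have "2 \<le> sqrt (2 * pi)" by (rule real_le_rsqrt) (use pi_gt3 in \<open>simp add: power2_eq_square\<close>)
    then have "1 / sqrt (2 * pi) \<le> 1 / 2" by (intro divide_left_mono) auto
    moreover have "exp (- y\<^sup>2 / 2) \<le> 1" by simp
    ultimately have "1 / sqrt (2 * pi) * exp (- y\<^sup>2 / 2) \<le> 1 / 2 * 1" by (intro mult_mono) auto
    then show ?thesis by (simp add: std_normal_density_def)
  qed
  have "(\<integral>\<^sup>+y. ennreal (exp (- 8 * \<bar>y\<bar>)) \<partial>std_gauss) \<le>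
     (\<integral>\<^sup>+y. indicator {- (1/4)..1/4} y + ennreal (1 / 5) \<partial>std_gauss)"
  proof (intro nn_integral_mono)
    fix y :: real
    show "ennreal (exp (- 8 * \<bar>y\<bar>)) \<le> indicator {- (1/4)..1/4} y + ennreal (1 / 5)"
    proof (cases "\<bar>y\<bar> \<le> 1 / 4")
      case True
      then have "y \<in> {- (1/4)..1/4}" by auto
      then have "ennreal (exp (- 8 * \<bar>y\<bar>)) \<le> indicator {- (1/4)..1/4} y" by simp
      then show ?thesis by (rule order_trans) simp
    next
      case False
      then have "exp (- 8 * \<bar>y\<bar>) \<le> exp (- 2)" by simp
      also note e2
      finally have "ennreal (exp (- 8 * \<bar>y\<bar>)) \<le> ennreal (1 / 5)" by (rule ennreal_leI)
      then show ?thesis by (rule order_trans) simp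
    qed
  qed
  also have "\<dots> = (\<integral>\<^sup>+y. indicator {- (1/4)..1/4} y \<partial>std_gauss) + ennreal (1 / 5)"
    using prob_space.emeasure_space_1[OF prob_space_std_normal] by (subst nn_integral_add) auto
  also have "(\<integral>\<^sup>+y. indicator {- (1/4)..1/4} y \<partial>std_gauss) \<le> (\<integral>\<^sup>+y. ennreal (1 / 2) * indicator {- (1/4)..1/4 :: real} y \<partial>lborel)"
    by (subst nn_integral_std_gauss, measurable, intro nn_integral_mono mult_right_mono ennreal_leI dens) simp
  also have "\<dots> = ennreal (1 / 2) * ennreal (1 / 2)"
    by (subst nn_integral_cmult) (auto simp del: ennreal_half)
  also have "\<dots> = ennreal (1 / 4)" by (simp add: ennreal_mult[symmetric] del: ennreal_half)
  also have "ennreal (1 / 4) + ennreal (1 / 5) \<le> ennreal (1 / 2)"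
    by (subst ennreal_plus[symmetric]) (auto intro!: ennreal_leI simp del: ennreal_half)
  finally show ?thesis by simp
qed

text \<open>For unit \<open>t\<close> the \<open>m\<close> entries are independent standard
  Gaussians, and the exponential Markov inequality with parameter 8 costs
  \<open>exp (1 / 2) / 2\<close>, at most 5/6, per entry. Decay at a rate in \<open>m\<close> rather
  than \<open>n\<close> pays for the net.\<close>

lemma emeasure_l1_image_small:
  assumes "sq_norm {..<n} t = 1"
  shows "emeasure (gaussian_matrix n m) {G \<in> space (gaussian_matrix n m). l1_image n m G t < real m / 16} \<le> ennreal ((5 / 6) ^ m)"
proof -
  let ?I = "{..<n} \<times> {..<m}"
  have GM: "gaussian_matrix n m = gauss_PiM ?I" by (simp add: gaussian_matrix_def)
  \<comment> \<open>Entry \<open>j\<close> of the transposed matrix times \<open>t\<close>, read as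
    a functional of the whole matrix: \<open>t\<close> is placed in column \<open>j\<close>.\<close>
  define ws where "ws = map (\<lambda>j (b, i). if i = j then t b else 0 :: real) [0..<m]"
  have wsip: "ip ?I (ws ! j) G = (\<Sum>b<n. G (b, j) * t b)" if "j < m" for j G
  proof -
    have "ip ?I (ws ! j) G = (\<Sum>b<n. \<Sum>i<m. (ws ! j) (b, i) * G (b, i))"
      unfolding ip_def by (simp add: sum.cartesian_product)
    also have "\<dots> = (\<Sum>b<n. \<Sum>i<m. if i = j then t b * G (b, j) else 0)"
      using that by (intro sum.cong) (auto simp: ws_def)
    finally show ?thesis using that by (simp add: mult.commute)
  qed
  have on: "orthonormal ?I ws"
    unfolding orthonormal_def
  proof (intro allI impI)
    fix i j assume ij: "i < length ws" "j < length ws"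
    then have "ip ?I (ws ! i) (ws ! j) = (\<Sum>b<n. (ws ! j) (b, i) * t b)"
      by (intro wsip) (simp add: ws_def)
    also have "\<dots> = (if i = j then sq_norm {..<n} t else 0)" using ij by (auto simp: ws_def ip_def)
    finally show "ip ?I (ws ! i) (ws ! j) = (if i = j then 1 else 0)" using assms by simp
  qed
  have len: "length ws = m" by (simp add: ws_def)
  have l1: "l1_image n m G t = (\<Sum>j<m. \<bar>ip ?I (ws ! j) G\<bar>)" for G
    by (simp add: l1_image_def wsip)
  have e: "exp (1 / 2 :: real) \<le> 5 / 3"
  proof -
    have "exp (1 / 2 :: real) * exp (1 / 2) = exp 1" by (simp flip: exp_add)
    also have "\<dots> < 272 / 100" using e_less_272 by simp
    finally have "(exp (1 / 2 :: real))\<^sup>2 \<le> (5 / 3)\<^sup>2" by (simp add: power2_eq_square)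
    then show ?thesis by (rule power2_le_imp_le) simp
  qed
  have [measurable]: "(\<lambda>G. l1_image n m G t) \<in> borel_measurable (gauss_PiM ?I)" unfolding l1 by measurable
  have "emeasure (gauss_PiM ?I) {G \<in> space (gauss_PiM ?I). l1_image n m G t < real m / 16}
     = (\<integral>\<^sup>+G. indicator {G \<in> space (gauss_PiM ?I). l1_image n m G t < real m / 16} G \<partial>gauss_PiM ?I)"
    by (subst nn_integral_indicator) measurable
  also have "\<dots> \<le> (\<integral>\<^sup>+G. ennreal (exp (real m / 2)) * (\<Prod>j<length ws. ennreal (exp (- 8 * \<bar>ip ?I (ws ! j) G\<bar>))) \<partial>gauss_PiM ?I)"
  proof (intro nn_integral_mono)
    fix G
    have "(\<Sum>j<m. - 8 * \<bar>ip ?I (ws ! j) G\<bar>) = - 8 * l1_image n m G t"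
      by (simp only: l1 sum_distrib_left)
    then have "indicator {G \<in> space (gauss_PiM ?I). l1_image n m G t < real m / 16} G \<le>
       ennreal (exp (real m / 2 + (\<Sum>j<m. - 8 * \<bar>ip ?I (ws ! j) G\<bar>)))"
      by (auto simp: indicator_def)
    also have "\<dots> = ennreal (exp (real m / 2)) * (\<Prod>j<length ws. ennreal (exp (- 8 * \<bar>ip ?I (ws ! j) G\<bar>)))"
      by (subst exp_add) (simp add: len exp_sum ennreal_mult prod_nonneg flip: prod_ennreal)
    finally show "indicator {G \<in> space (gauss_PiM ?I). l1_image n m G t < real m / 16} G \<le>
       ennreal (exp (real m / 2)) * (\<Prod>j<length ws. ennreal (exp (- 8 * \<bar>ip ?I (ws ! j) G\<bar>)))" .
  qed
  also have "\<dots> = ennreal (exp (real m / 2)) * (\<integral>\<^sup>+y. ennreal (exp (- 8 * \<bar>y\<bar>)) \<partial>std_gauss) ^ m"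
  proof -
    have "(\<integral>\<^sup>+G. (\<Prod>j<length ws. ennreal (exp (- 8 * \<bar>ip ?I (ws ! j) G\<bar>))) \<partial>gauss_PiM ?I)
       = (\<integral>\<^sup>+y. ennreal (exp (- 8 * \<bar>y\<bar>)) \<partial>std_gauss) ^ length ws"
      by (rule nn_integral_prod_orthonormal[OF _ on, where g = "\<lambda>y. ennreal (exp (- 8 * \<bar>y\<bar>))"]) auto
    then show ?thesis by (subst nn_integral_cmult, measurable) (simp only: len)
  qed
  also have "\<dots> \<le> ennreal (exp (real m / 2)) * ennreal (1 / 2) ^ m"
    by (intro mult_left_mono power_mono nn_integral_exp_abs) auto
  also have "\<dots> = ennreal ((exp (1 / 2) * (1 / 2)) ^ m)"
  proof -
    have "exp (real m / 2) = exp (1 / 2) ^ m" using exp_of_nat_mult[of m "1 / 2 :: real"] by simp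
    then show ?thesis
      by (simp only: ennreal_power ennreal_mult[symmetric] power_mult_distrib zero_le_power exp_ge_zero)
  qed
  also have "\<dots> \<le> ennreal ((5 / 6) ^ m)"
    using e by (intro ennreal_leI power_mono) auto
  finally show ?thesis by (simp add: GM)
qed

text \<open>Controls the rounding error of the net argument. The exponential Markov inequality with
  parameter 1/4 leaves \<open>exp (- 1) * sqrt 2\<close>, at most 3/4, per entry.\<close>

lemma emeasure_sum_squares_large:
  "emeasure (gaussian_matrix n m) {G \<in> space (gaussian_matrix n m). 4 * real (n * m) \<le> (\<Sum>a\<in>{..<n} \<times> {..<m}. (G a)\<^sup>2)}
     \<le> ennreal ((3 / 4) ^ (n * m))"
proof -
  let ?I = "{..<n} \<times> {..<m}"
  have GM: "gaussian_matrix n m = gauss_PiM ?I" by (simp add: gaussian_matrix_def)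
  have e1: "exp (- 1 :: real) \<le> 1 / 2"
    using exp_ge_add_one_self[of 1] by (simp add: exp_minus field_simps)
  have s2: "sqrt 2 \<le> (3 / 2 :: real)" by (rule real_le_lsqrt) (auto simp: power2_eq_square)
  have "emeasure (gauss_PiM ?I) {G \<in> space (gauss_PiM ?I). 4 * real (n * m) \<le> (\<Sum>a\<in>?I. (G a)\<^sup>2)}
     = (\<integral>\<^sup>+G. indicator {G \<in> space (gauss_PiM ?I). 4 * real (n * m) \<le> (\<Sum>a\<in>?I. (G a)\<^sup>2)} G \<partial>gauss_PiM ?I)"
    by (subst nn_integral_indicator) measurable
  also have "\<dots> \<le> (\<integral>\<^sup>+G. ennreal (exp (- real (n * m))) * (\<Prod>a\<in>?I. ennreal (exp ((G a)\<^sup>2 / 4))) \<partial>gauss_PiM ?I)"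
  proof (intro nn_integral_mono)
    fix G :: "nat \<times> nat \<Rightarrow> real"
    have "indicator {G \<in> space (gauss_PiM ?I). 4 * real (n * m) \<le> (\<Sum>a\<in>?I. (G a)\<^sup>2)} G \<le>
       ennreal (exp (- real (n * m) + (\<Sum>a\<in>?I. (G a)\<^sup>2 / 4)))"
      by (auto simp: indicator_def simp flip: sum_divide_distrib)
    also have "\<dots> = ennreal (exp (- real (n * m))) * (\<Prod>a\<in>?I. ennreal (exp ((G a)\<^sup>2 / 4)))"
      by (subst exp_add) (simp add: exp_sum ennreal_mult prod_nonneg flip: prod_ennreal)
    finally show "indicator {G \<in> space (gauss_PiM ?I). 4 * real (n * m) \<le> (\<Sum>a\<in>?I. (G a)\<^sup>2)} G \<le>
       ennreal (exp (- real (n * m))) * (\<Prod>a\<in>?I. ennreal (exp ((G a)\<^sup>2 / 4)))" .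
  qed
  also have "\<dots> = ennreal (exp (- real (n * m))) * (\<Prod>a\<in>?I. ennreal (sqrt 2))"
    by (subst nn_integral_cmult, measurable)
       (simp add: gauss_product.product_nn_integral_prod[where f = "\<lambda>_ x. ennreal (exp (x\<^sup>2 / 4))"] nn_integral_exp_square)
  also have "\<dots> = ennreal ((exp (- 1) * sqrt 2) ^ (n * m))"
    by (simp add: ennreal_power ennreal_mult[symmetric] power_mult_distrib exp_of_nat_mult[symmetric])
  also have "\<dots> \<le> ennreal ((3 / 4) ^ (n * m))"
    using mult_mono[OF e1 s2] by (intro ennreal_leI power_mono) auto
  finally show ?thesis by (simp add: GM)
qed

text \<open>If the squared entries of the matrix sum to at most \<open>4 * n * m\<close>, rounding
  to mesh \<open>1 / (128 * n)\<close> changes the l1 image by at most \<open>m / 64\<close>. Grid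
  points fill a cube and are not unit vectors, hence the normalisation in
  \<open>l1_bad\<close>.\<close>

definition grid :: "nat \<Rightarrow> (nat \<Rightarrow> real) set" where
  "grid n = {..<n} \<rightarrow>\<^sub>E (\<lambda>z. of_int z / (128 * real n)) ` {- (128 * int n)..128 * int n}"

lemma finite_grid: "finite (grid n)"
  unfolding grid_def by (intro finite_PiE) auto

lemma card_grid_le: "card (grid n) \<le> (256 * n + 1) ^ n"
proof -
  have "card ((\<lambda>z. of_int z / (128 * real n)) ` {- (128 * int n)..128 * int n}) \<le> card {- (128 * int n)..128 * int n}"
    by (intro card_image_le) auto
  also have "\<dots> = 256 * n + 1" by simp
  finally show ?thesis unfolding grid_def by (simp add: card_PiE power_mono)
qed

lemma grid_approx:
  assumes "n > 0" "sq_norm {..<n} t = 1"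
  shows "\<exists>t'\<in>grid n. \<forall>b<n. \<bar>t b - t' b\<bar> \<le> 1 / (128 * real n)"
proof -
  define t' where "t' = (\<lambda>b\<in>{..<n}. of_int \<lfloor>128 * real n * t b\<rfloor> / (128 * real n))"
  have tb: "\<bar>t b\<bar> \<le> 1" if "b < n" for b
  proof -
    have "(t b)\<^sup>2 \<le> (\<Sum>b<n. (t b)\<^sup>2)" using that by (intro member_le_sum) auto
    also have "\<dots> = 1" using assms(2) by (simp add: ip_def power2_eq_square)
    finally show ?thesis by (simp add: abs_square_le_1)
  qed
  have "t' \<in> grid n"
    unfolding grid_def
  proof (rule PiE_I)
    fix b assume b: "b \<in> {..<n}"
    have "\<bar>128 * real n * t b\<bar> \<le> 128 * real n * 1"
      unfolding abs_mult using tb[of b] b by (intro mult_mono) auto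
    then have "- (128 * real n) \<le> 128 * real n * t b" "128 * real n * t b \<le> 128 * real n" by auto
    then have "\<lfloor>128 * real n * t b\<rfloor> \<in> {- (128 * int n)..128 * int n}"
      by (auto simp: le_floor_iff floor_le_iff)
    then show "t' b \<in> (\<lambda>z. of_int z / (128 * real n)) ` {- (128 * int n)..128 * int n}"
      using b by (auto simp: t'_def)
  qed (simp add: t'_def)
  moreover have "\<bar>t b - t' b\<bar> \<le> 1 / (128 * real n)" if "b < n" for b
  proof -
    let ?x = "128 * real n * t b"
    have "\<bar>?x - of_int \<lfloor>?x\<rfloor>\<bar> \<le> 1" by linarith
    moreover have "t b - t' b = (?x - of_int \<lfloor>?x\<rfloor>) / (128 * real n)"
      using that assms(1) by (simp add: t'_def field_simps)
    ultimately show ?thesis using assms(1) by (simp add: abs_divide divide_right_mono)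
  qed
  ultimately show ?thesis by blast
qed

definition l1_bad :: "nat \<Rightarrow> nat \<Rightarrow> (nat \<times> nat \<Rightarrow> real) set" where
  "l1_bad n m = {G \<in> space (gaussian_matrix n m). 4 * real (n * m) \<le> (\<Sum>a\<in>{..<n} \<times> {..<m}. (G a)\<^sup>2)} \<union>
     (\<Union>t\<in>{t\<in>grid n. sq_norm {..<n} t \<noteq> 0}. {G \<in> space (gaussian_matrix n m).
        l1_image n m G (\<lambda>b. 1 / sqrt (sq_norm {..<n} t) * t b) < real m / 16})"

lemma l1_bad_measure:
  shows "l1_bad n m \<in> sets (gaussian_matrix n m)"
    and "emeasure (gaussian_matrix n m) (l1_bad n m) \<le> ennreal ((3 / 4) ^ (n * m) + (256 * real n + 1) ^ n * (5 / 6) ^ m)"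
proof -
  let ?I = "{..<n} \<times> {..<m}" and ?M = "gaussian_matrix n m"
  let ?T = "{t\<in>grid n. sq_norm {..<n} t \<noteq> 0}"
  let ?A = "{G \<in> space ?M. 4 * real (n * m) \<le> (\<Sum>a\<in>?I. (G a)\<^sup>2)}"
  let ?B = "\<lambda>t. {G \<in> space ?M. l1_image n m G (\<lambda>b. 1 / sqrt (sq_norm {..<n} t) * t b) < real m / 16}"
  have GM: "?M = gauss_PiM ?I" by (simp add: gaussian_matrix_def)
  have finT: "finite ?T" using finite_grid by simp
  have A: "?A \<in> sets ?M" unfolding GM by measurable
  have lm: "(\<lambda>G. l1_image n m G t) \<in> borel_measurable (gauss_PiM ?I)" for t
    unfolding l1_image_def
    by (intro borel_measurable_sum borel_measurable_abs borel_measurable_times borel_measurable_const measurable_gauss_component) auto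
  have B: "?B t \<in> sets ?M" for t
    unfolding GM using lm by measurable
  have UB: "(\<Union>t\<in>?T. ?B t) \<in> sets ?M" using finT B by (intro sets.finite_UN) auto
  show "l1_bad n m \<in> sets ?M" unfolding l1_bad_def using A UB by (rule sets.Un)
  have "emeasure ?M (l1_bad n m) \<le> emeasure ?M ?A + emeasure ?M (\<Union>t\<in>?T. ?B t)"
    unfolding l1_bad_def by (rule emeasure_subadditive[OF A UB])
  also have "emeasure ?M (\<Union>t\<in>?T. ?B t) \<le> (\<Sum>t\<in>?T. emeasure ?M (?B t))"
    using finT B by (intro emeasure_subadditive_finite) auto
  also have "\<dots> \<le> (\<Sum>t\<in>?T. ennreal ((5 / 6) ^ m))"
  proof (intro sum_mono emeasure_l1_image_small)
    fix t assume "t \<in> ?T"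
    then have "sq_norm {..<n} t > 0" by (simp add: order_le_neq_trans)
    then show "sq_norm {..<n} (\<lambda>b. 1 / sqrt (sq_norm {..<n} t) * t b) = 1"
      unfolding ip_scale_left ip_scale_right by simp
  qed
  also have "\<dots> = ennreal (real (card ?T) * (5 / 6) ^ m)"
    by (simp add: ennreal_mult ennreal_of_nat_eq_real_of_nat)
  also have "\<dots> \<le> ennreal ((256 * real n + 1) ^ n * (5 / 6) ^ m)"
  proof (intro ennreal_leI mult_right_mono)
    have "card ?T \<le> card (grid n)" by (intro card_mono finite_grid) auto
    also note card_grid_le
    finally have "real (card ?T) \<le> real ((256 * n + 1) ^ n)" by (rule of_nat_mono)
    then show "real (card ?T) \<le> (256 * real n + 1) ^ n" by (simp add: add.commute)
  qed simp
  also have "emeasure ?M ?A \<le> ennreal ((3 / 4) ^ (n * m))" by (rule emeasure_sum_squares_large)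
  finally show "emeasure ?M (l1_bad n m) \<le> ennreal ((3 / 4) ^ (n * m) + (256 * real n + 1) ^ n * (5 / 6) ^ m)"
    by (simp add: add_mono)
qed

text \<open>The rounded vector has norm at least 1/2, so its l1 image is at least
  \<open>m / 32\<close>; the rounding error takes away at most \<open>m / 64\<close>.\<close>

lemma l1_image_lower_unit:
  assumes G: "G \<in> space (gaussian_matrix n m)" "G \<notin> l1_bad n m" and "n > 0" and t: "sq_norm {..<n} t = 1"
  shows "real m / 64 \<le> l1_image n m G t"
proof -
  let ?I = "{..<n} \<times> {..<m}"
  obtain t' where t': "t' \<in> grid n" "\<forall>b<n. \<bar>t b - t' b\<bar> \<le> 1 / (128 * real n)"
    using grid_approx[OF assms(3) t] by blast
  define h where "h = (\<lambda>b. t' b - t b)"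
  have hb: "\<bar>h b\<bar> \<le> 1 / (128 * real n)" if "b < n" for b using t'(2) that by (simp add: h_def abs_minus_commute)
  have hh: "sqrt (sq_norm {..<n} h) \<le> 1 / 2"
  proof -
    have "sq_norm {..<n} h \<le> (\<Sum>b<n. (1 / (128 * real n))\<^sup>2)"
      unfolding ip_def
    proof (intro sum_mono)
      fix b assume "b \<in> {..<n}"
      then have "\<bar>h b\<bar>\<^sup>2 \<le> (1 / (128 * real n))\<^sup>2" using hb by (intro power_mono) auto
      then show "h b * h b \<le> (1 / (128 * real n))\<^sup>2" by (simp add: power2_eq_square)
    qed
    also have "\<dots> \<le> (1 / 2)\<^sup>2"
      using assms(3) by (simp add: power2_eq_square field_simps)
    finally show ?thesis using real_sqrt_le_mono by fastforce
  qed
  have "sqrt (sq_norm {..<n} t) \<le> sqrt (sq_norm {..<n} t') + sqrt (sq_norm {..<n} h)"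
  proof -
    have "sq_norm {..<n} (\<lambda>b. - h b) = sq_norm {..<n} h" by (simp add: ip_def)
    then show ?thesis using ip_triangle[of "{..<n}" t' "\<lambda>b. - h b"] by (simp add: h_def)
  qed
  then have nt': "1 / 2 \<le> sqrt (sq_norm {..<n} t')" using hh t by simp
  then have nz: "sq_norm {..<n} t' \<noteq> 0" by auto
  have A: "(\<Sum>a\<in>?I. (G a)\<^sup>2) \<le> 4 * real (n * m)"
    using G unfolding l1_bad_def by auto
  have "real m / 16 \<le> l1_image n m G (\<lambda>b. 1 / sqrt (sq_norm {..<n} t') * t' b)"
    using G t'(1) nz unfolding l1_bad_def by auto
  also have "\<dots> = l1_image n m G t' / sqrt (sq_norm {..<n} t')"
    unfolding l1_image_scale using nt' by simp
  finally have "real m / 16 * sqrt (sq_norm {..<n} t') \<le> l1_image n m G t'"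
    using nz by (subst (asm) pos_le_divide_eq) (auto simp: order_le_neq_trans)
  moreover have "real m / 16 * (1 / 2) \<le> real m / 16 * sqrt (sq_norm {..<n} t')"
    by (intro mult_left_mono nt') auto
  ultimately have low: "real m / 32 \<le> l1_image n m G t'" by simp
  have "l1_image n m G t' \<le> l1_image n m G t + l1_image n m G h"
  proof -
    have "l1_image n m G t' = (\<Sum>j<m. \<bar>(\<Sum>b<n. G (b, j) * t b) + (\<Sum>b<n. G (b, j) * h b)\<bar>)"
      unfolding l1_image_def h_def by (simp add: algebra_simps sum_subtractf)
    also have "\<dots> \<le> (\<Sum>j<m. \<bar>\<Sum>b<n. G (b, j) * t b\<bar> + \<bar>\<Sum>b<n. G (b, j) * h b\<bar>)"
      by (intro sum_mono abs_triangle_ineq)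
    also have "\<dots> = l1_image n m G t + l1_image n m G h"
      unfolding l1_image_def by (rule sum.distrib)
    finally show ?thesis .
  qed
  moreover have "l1_image n m G h \<le> real m / 64"
  proof -
    have "l1_image n m G h \<le> (\<Sum>j<m. \<Sum>b<n. \<bar>G (b, j)\<bar> * (1 / (128 * real n)))"
      unfolding l1_image_def
    proof (intro sum_mono order_trans[OF sum_abs])
      fix j b assume "b \<in> {..<n}"
      then show "\<bar>G (b, j) * h b\<bar> \<le> \<bar>G (b, j)\<bar> * (1 / (128 * real n))"
        unfolding abs_mult using hb by (intro mult_left_mono) auto
    qed
    also have "\<dots> = (\<Sum>a\<in>?I. \<bar>G a\<bar>) * (1 / (128 * real n))"
      by (subst sum.swap) (simp add: sum.cartesian_product flip: sum_distrib_right sum_divide_distrib)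
    also have "\<dots> \<le> 2 * real (n * m) * (1 / (128 * real n))"
    proof (rule mult_right_mono)
      have "(\<Sum>a\<in>?I. \<bar>G a\<bar> * 1)\<^sup>2 \<le> (\<Sum>a\<in>?I. \<bar>G a\<bar>\<^sup>2) * (\<Sum>a\<in>?I. 1\<^sup>2)"
        by (rule Cauchy_Schwarz_ineq_sum)
      also have "\<dots> \<le> (4 * real (n * m)) * real (n * m)"
        using A by (intro mult_mono) (auto simp: sum_nonneg)
      also have "\<dots> = (2 * real (n * m))\<^sup>2" by (simp add: power2_eq_square)
      finally have "(\<Sum>a\<in>?I. \<bar>G a\<bar>)\<^sup>2 \<le> (2 * real (n * m))\<^sup>2" by (simp only: mult_1_right)
      then show "(\<Sum>a\<in>?I. \<bar>G a\<bar>) \<le> 2 * real (n * m)" by (rule power2_le_imp_le) simp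
    qed simp
    also have "2 * real (n * m) * (1 / (128 * real n)) = real m / 64" using assms(3) by simp
    finally show ?thesis .
  qed
  ultimately show ?thesis using low by simp
qed

lemma l1_image_lower:
  assumes "G \<in> space (gaussian_matrix n m)" "G \<notin> l1_bad n m" "n > 0"
  shows "real m / 64 * sqrt (sq_norm {..<n} t) \<le> l1_image n m G t"
proof (cases "sq_norm {..<n} t = 0")
  case True
  then show ?thesis by (simp add: l1_image_def sum_nonneg)
next
  case False
  then have pos: "sq_norm {..<n} t > 0" by (simp add: order_le_neq_trans)
  let ?u = "\<lambda>b. 1 / sqrt (sq_norm {..<n} t) * t b"
  have "sq_norm {..<n} ?u = 1" unfolding ip_scale_left ip_scale_right using pos by simp
  from l1_image_lower_unit[OF assms this] show ?thesis
    unfolding l1_image_scale using pos by (simp add: field_simps)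
qed

section \<open>The exceptional event\<close>

definition code_set :: "nat \<Rightarrow> nat \<Rightarrow> nat \<Rightarrow> (nat \<Rightarrow> nat \<Rightarrow> nat) set" where
  "code_set n m k = {..<n} \<rightarrow>\<^sub>E ({..<k} \<rightarrow>\<^sub>E {..2 * m})"

lemma finite_code_set: "finite (code_set n m k)"
  unfolding code_set_def by (intro finite_PiE) auto

lemma card_code_set: "card (code_set n m k) = (2 * m + 1) ^ (k * n)"
  by (simp add: code_set_def card_PiE power_mult)

text \<open>The choice depends on the index set and the codes alone, so each pair contributes one
  list to the union bound. Length \<open>n - 4 * l\<close> suffices because that many indices lie
  outside \<open>I\<close>.\<close>

definition initial_list ::
  "nat \<Rightarrow> nat \<Rightarrow> nat \<Rightarrow> real \<Rightarrow> nat \<Rightarrow> nat set \<Rightarrow> (nat \<Rightarrow> nat \<Rightarrow> nat) \<Rightarrow> (nat \<Rightarrow> real) list" where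
  "initial_list n m k \<rho> l I C = (SOME us. length us = n - 4 * l \<and> orthonormal {..<m} us \<and>
     (\<forall>i\<in>{..<n} - I. \<forall>j\<in>{..<m}. residual {..<m} us (sparse_avg m k \<rho> (C i)) j = 0))"

lemma initial_list:
  assumes "I \<subseteq> {..<n}" "card I = 4 * l" "n \<le> m"
  shows "length (initial_list n m k \<rho> l I C) = n - 4 * l"
    and "orthonormal {..<m} (initial_list n m k \<rho> l I C)"
    and "\<And>i j. i < n \<Longrightarrow> i \<notin> I \<Longrightarrow> j < m \<Longrightarrow>
      residual {..<m} (initial_list n m k \<rho> l I C) (sparse_avg m k \<rho> (C i)) j = 0"
proof -
  let ?P = "\<lambda>us. length us = n - 4 * l \<and> orthonormal {..<m} us \<and>
     (\<forall>i\<in>{..<n} - I. \<forall>j\<in>{..<m}. residual {..<m} us (sparse_avg m k \<rho> (C i)) j = 0)"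
  let ?vs = "map (\<lambda>i. sparse_avg m k \<rho> (C i)) (sorted_list_of_set ({..<n} - I))"
  have "card ({..<n} - I) = n - 4 * l"
    using assms by (simp add: card_Diff_subset finite_subset)
  then have "length ?vs \<le> n - 4 * l" by simp
  from exists_orthonormal_spanning[OF _ this, of "{..<m}"] assms(3)
  have "\<exists>us. ?P us" by auto
  from someI_ex[OF this] have P: "?P (initial_list n m k \<rho> l I C)" unfolding initial_list_def .
  then show "length (initial_list n m k \<rho> l I C) = n - 4 * l"
    "orthonormal {..<m} (initial_list n m k \<rho> l I C)" by blast+
  show "residual {..<m} (initial_list n m k \<rho> l I C) (sparse_avg m k \<rho> (C i)) j = 0"
    if "i < n" "i \<notin> I" "j < m" for i j using P that by blast
qed

definition unit_vecs :: "nat \<Rightarrow> (nat \<Rightarrow> real) set" where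
  "unit_vecs m = unit_vec ` {..<m}"

text \<open>The two Maurey approximations differ by at most \<open>3 * \<rho> / sqrt k\<close> for
  the codes that will be used, whence the scaling. For arbitrary pairs of codes this may fail, so
  the norm bound required by \<open>greedy_extension\<close> is enforced by a filter.\<close>

definition diff_vecs :: "nat \<Rightarrow> nat \<Rightarrow> nat \<Rightarrow> real \<Rightarrow> (nat \<Rightarrow> nat \<Rightarrow> nat) \<Rightarrow> (nat \<Rightarrow> nat \<Rightarrow> nat) \<Rightarrow> (nat \<Rightarrow> real) set" where
  "diff_vecs n m k \<rho> C C' =
     {w \<in> (\<lambda>i j. sqrt (real k) / (3 * \<rho>) * (sparse_avg m k \<rho> (C' i) j - sparse_avg m k \<rho> (C i) j)) ` {..<n}.
        sq_norm {..<m} w \<le> 1}"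

lemma finite_unit_vecs: "finite (unit_vecs m)" and card_unit_vecs: "card (unit_vecs m) \<le> m"
  using card_image_le[of "{..<m}" unit_vec] by (auto simp: unit_vecs_def)

lemma finite_diff_vecs: "finite (diff_vecs n m k \<rho> C C')"
  by (simp add: diff_vecs_def)

lemma card_diff_vecs: "card (diff_vecs n m k \<rho> C C') \<le> n"
proof -
  let ?f = "\<lambda>i j. sqrt (real k) / (3 * \<rho>) * (sparse_avg m k \<rho> (C' i) j - sparse_avg m k \<rho> (C i) j)"
  have "card (diff_vecs n m k \<rho> C C') \<le> card (?f ` {..<n})"
    unfolding diff_vecs_def by (intro card_mono) auto
  also have "\<dots> \<le> n" using card_image_le[of "{..<n}" ?f] by simp
  finally show ?thesis .
qed

lemma sum_unit_vec: "finite I \<Longrightarrow> j \<in> I \<Longrightarrow> (\<Sum>i\<in>I. f i * unit_vec j i) = f j"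
proof -
  assume "finite I" "j \<in> I"
  have "(\<Sum>i\<in>I. f i * unit_vec j i) = (\<Sum>i\<in>I. if i = j then f j else 0)"
    by (intro sum.cong) (auto simp: unit_vec_def)
  then show ?thesis using \<open>finite I\<close> \<open>j \<in> I\<close> by simp
qed

definition first_lists where
  "first_lists n m k \<rho> l r =
    (\<Union>I\<in>{I\<in>Pow {..<n}. card I = 4 * l}. \<Union>C\<in>code_set n m k. extensions m (unit_vecs m) r (initial_list n m k \<rho> l I C))"

definition second_lists where
  "second_lists n m k \<rho> l r =
    (\<Union>I\<in>{I\<in>Pow {..<n}. card I = 4 * l}. \<Union>C\<in>code_set n m k. \<Union>C'\<in>code_set n m k.
       \<Union>us\<in>extensions m (unit_vecs m) r (initial_list n m k \<rho> l I C). extensions m (diff_vecs n m k \<rho> C C') l us)"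

definition far_event :: "nat \<Rightarrow> nat \<Rightarrow> real \<Rightarrow> nat \<Rightarrow> nat \<Rightarrow> (nat \<Rightarrow> real) list \<Rightarrow> (nat \<times> nat \<Rightarrow> real) set" where
  "far_event n m \<tau> r q us =
     {G \<in> space (gaussian_matrix n m). \<forall>t<r. \<tau> \<le> gs_sqnorm n (\<lambda>s. mv m G (us ! s)) (q + t)}"

text \<open>The number \<open>r\<close> of steps after which the first stage stops depends on the
  matrix and decides where the second stage begins, so each \<open>r < l\<close> needs its own
  family of lists.\<close>

definition greedy_bad :: "nat \<Rightarrow> nat \<Rightarrow> nat \<Rightarrow> real \<Rightarrow> nat \<Rightarrow> real \<Rightarrow> (nat \<times> nat \<Rightarrow> real) set" where
  "greedy_bad n m k \<rho> l \<tau> =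
     (\<Union>us\<in>first_lists n m k \<rho> l l. far_event n m \<tau> l (n - 4 * l) us) \<union>
     (\<Union>r<l. \<Union>us\<in>second_lists n m k \<rho> l r. far_event n m \<tau> l (n - 4 * l + r) us)"

lemma finite_first_lists: "finite (first_lists n m k \<rho> l r)"
  unfolding first_lists_def by (intro finite_UN_I finite_extensions finite_unit_vecs finite_code_set) auto

lemma finite_second_lists: "finite (second_lists n m k \<rho> l r)"
  unfolding second_lists_def
  by (intro finite_UN_I finite_extensions finite_unit_vecs finite_code_set finite_diff_vecs) auto

lemma card_UN_le_mult:
  assumes "finite A" "card A \<le> a" "\<And>x. x \<in> A \<Longrightarrow> card (f x) \<le> b"
  shows "card (\<Union>x\<in>A. f x) \<le> a * b"
proof -
  have "card (\<Union>x\<in>A. f x) \<le> (\<Sum>x\<in>A. card (f x))" by (rule card_UN_le[OF assms(1)])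
  also have "\<dots> \<le> (\<Sum>x\<in>A. b)" using assms(3) by (intro sum_mono) auto
  also have "\<dots> \<le> a * b" using assms(2) by simp
  finally show ?thesis .
qed

lemma card_index_sets: "card {I\<in>Pow {..<n}. card I = 4 * l} \<le> 2 ^ n"
proof -
  have "card {I\<in>Pow {..<n::nat}. card I = 4 * l} \<le> card (Pow {..<n})" by (intro card_mono) auto
  then show ?thesis by (simp add: card_Pow)
qed

lemma card_first_lists: "card (first_lists n m k \<rho> l r) \<le> 2 ^ n * ((2 * m + 1) ^ (k * n) * m ^ r)"
proof -
  have "card (extensions m (unit_vecs m) r us) \<le> m ^ r" for us
    using card_extensions[OF finite_unit_vecs, of m m r us] card_unit_vecs[of m] by (meson le_trans power_mono zero_le)
  then show ?thesis unfolding first_lists_def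
    by (intro card_UN_le_mult card_index_sets) (auto simp: card_code_set finite_code_set)
qed

lemma card_second_lists:
  "card (second_lists n m k \<rho> l r) \<le> 2 ^ n * ((2 * m + 1) ^ (k * n) * ((2 * m + 1) ^ (k * n) * (m ^ r * n ^ l)))"
proof -
  have 1: "card (extensions m (unit_vecs m) r us) \<le> m ^ r" for us
    using card_extensions[OF finite_unit_vecs, of m m r us] card_unit_vecs[of m] by (meson le_trans power_mono zero_le)
  have 2: "card (extensions m (diff_vecs n m k \<rho> C C') l us) \<le> n ^ l" for us C C'
    using card_extensions[OF finite_diff_vecs, of m n m k \<rho> C C' l us] card_diff_vecs[of n m k \<rho> C C'] by (meson le_trans power_mono zero_le)
  show ?thesis unfolding second_lists_def
    by (intro card_UN_le_mult card_index_sets 1 2) (auto simp: card_code_set finite_code_set finite_extensions finite_unit_vecs)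
qed

lemma first_lists_props:
  assumes "us \<in> first_lists n m k \<rho> l r" "n \<le> m"
  shows "orthonormal {..<m} us \<and> length us = n - 4 * l + r"
proof -
  obtain I C where IC: "I \<subseteq> {..<n}" "card I = 4 * l" "us \<in> extensions m (unit_vecs m) r (initial_list n m k \<rho> l I C)"
    using assms(1) by (auto simp: first_lists_def)
  from extensions_props[OF initial_list(2)[OF IC(1,2) assms(2)] IC(3)] initial_list(1)[OF IC(1,2) assms(2)]
  show ?thesis by simp
qed

lemma second_lists_props:
  assumes "us \<in> second_lists n m k \<rho> l r" "n \<le> m"
  shows "orthonormal {..<m} us \<and> length us = n - 4 * l + r + l"
proof -
  obtain I C C' us1 where IC: "I \<subseteq> {..<n}" "card I = 4 * l" "C \<in> code_set n m k"
    "us1 \<in> extensions m (unit_vecs m) r (initial_list n m k \<rho> l I C)" "us \<in> extensions m (diff_vecs n m k \<rho> C C') l us1"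
    using assms(1) by (auto simp: second_lists_def)
  then have "us1 \<in> first_lists n m k \<rho> l r" by (auto simp: first_lists_def)
  from first_lists_props[OF this assms(2)] extensions_props[OF _ IC(5)] show ?thesis by auto
qed

text \<open>At most \<open>4 * l\<close> degrees of freedom are left, and
  \<open>sqrt 2 ^ (4 * l) = 4 ^ l\<close>.\<close>

lemma far_event_measure:
  assumes "orthonormal {..<m} us" "length us = q + l" "q + l \<le> n" "n \<le> m" "n \<le> q + 4 * l"
  shows "far_event n m \<tau> l q us \<in> sets (gaussian_matrix n m)"
    and "emeasure (gaussian_matrix n m) (far_event n m \<tau> l q us) \<le> ennreal ((4 ^ l * exp (- \<tau> / 4)) ^ l)"
proof -
  show "far_event n m \<tau> l q us \<in> sets (gaussian_matrix n m)"
    unfolding far_event_def by (rule prob_orthonormal_columns_far[OF assms(1-4)])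
  have "emeasure (gaussian_matrix n m) (far_event n m \<tau> l q us) \<le> ennreal (sqrt 2 ^ (n - q) * exp (- \<tau> / 4)) ^ l"
    unfolding far_event_def by (rule prob_orthonormal_columns_far[OF assms(1-4)])
  also have "\<dots> \<le> ennreal (4 ^ l * exp (- \<tau> / 4)) ^ l"
  proof (intro power_mono ennreal_leI mult_right_mono)
    have "sqrt 2 ^ (n - q) \<le> (sqrt 2 :: real) ^ (4 * l)"
      using assms(5) by (intro power_increasing) auto
    also have "\<dots> = 4 ^ l" by (simp add: power_mult power4_eq_xxxx mult.assoc)
    finally show "sqrt 2 ^ (n - q) \<le> (4 :: real) ^ l" .
  qed auto
  finally show "emeasure (gaussian_matrix n m) (far_event n m \<tau> l q us) \<le> ennreal ((4 ^ l * exp (- \<tau> / 4)) ^ l)"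
    by (simp add: ennreal_power)
qed

text \<open>Union bound over one family of lists for the first stage and \<open>l\<close> families
  for the second, with a common bound on their sizes; the resulting factor \<open>1 + l\<close> is
  replaced by \<open>2 * l\<close>.\<close>

lemma greedy_bad_measure:
  assumes "4 * l \<le> n" "n \<le> m" "0 < l"
  shows "greedy_bad n m k \<rho> l \<tau> \<in> sets (gaussian_matrix n m)"
    and "emeasure (gaussian_matrix n m) (greedy_bad n m k \<rho> l \<tau>) \<le>
      ennreal (2 * real l * (2 ^ n * (2 * real m + 1) ^ (2 * k * n) * (real m * real n) ^ l) * (4 ^ l * exp (- \<tau> / 4)) ^ l)"
proof -
  let ?M = "gaussian_matrix n m" and ?\<beta> = "(4 ^ l * exp (- \<tau> / 4)) ^ l :: real"
  let ?N = "2 ^ n * (2 * m + 1) ^ (2 * k * n) * (m * n) ^ l"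
  let ?A = "\<Union>us\<in>first_lists n m k \<rho> l l. far_event n m \<tau> l (n - 4 * l) us"
  let ?B = "\<lambda>r. \<Union>us\<in>second_lists n m k \<rho> l r. far_event n m \<tau> l (n - 4 * l + r) us"
  have fin: "0 < n" "0 < m" using assms by auto
  have c1: "card (first_lists n m k \<rho> l l) \<le> ?N"
  proof -
    have "card (first_lists n m k \<rho> l l) \<le> 2 ^ n * ((2 * m + 1) ^ (k * n) * m ^ l)" by (rule card_first_lists)
    also have "\<dots> \<le> 2 ^ n * ((2 * m + 1) ^ (2 * k * n) * (m * n) ^ l)"
      using fin by (intro mult_mono power_mono power_increasing) auto
    finally show ?thesis by (simp add: mult.assoc)
  qed
  have c2: "card (second_lists n m k \<rho> l r) \<le> ?N" if "r < l" for r
  proof -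
    have "card (second_lists n m k \<rho> l r) \<le> 2 ^ n * ((2 * m + 1) ^ (k * n) * ((2 * m + 1) ^ (k * n) * (m ^ r * n ^ l)))"
      by (rule card_second_lists)
    also have "\<dots> \<le> 2 ^ n * ((2 * m + 1) ^ (k * n) * ((2 * m + 1) ^ (k * n) * (m ^ l * n ^ l)))"
      using fin that by (intro mult_mono power_increasing) auto
    also have "(2 * m + 1) ^ (k * n) * ((2 * m + 1) ^ (k * n) * (m ^ l * n ^ l)) = (2 * m + 1) ^ (2 * k * n) * (m * n) ^ l"
      by (simp add: power_add[symmetric] mult.assoc[symmetric] power_mult_distrib mult_2 add_mult_distrib)
    finally show ?thesis by (simp add: mult.assoc)
  qed
  have e1: "far_event n m \<tau> l (n - 4 * l) us \<in> sets ?M \<and> emeasure ?M (far_event n m \<tau> l (n - 4 * l) us) \<le> ennreal ?\<beta>"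
    if "us \<in> first_lists n m k \<rho> l l" for us
    by (intro conjI far_event_measure) (use first_lists_props[OF that assms(2)] assms in auto)
  have e2: "far_event n m \<tau> l (n - 4 * l + r) us \<in> sets ?M \<and> emeasure ?M (far_event n m \<tau> l (n - 4 * l + r) us) \<le> ennreal ?\<beta>"
    if "us \<in> second_lists n m k \<rho> l r" "r < l" for us r
    by (intro conjI far_event_measure) (use second_lists_props[OF that(1) assms(2)] assms that(2) in auto)
  have A: "?A \<in> sets ?M" using e1 by (intro sets.finite_UN finite_first_lists) auto
  have B: "?B r \<in> sets ?M" if "r < l" for r using e2 that by (intro sets.finite_UN finite_second_lists) auto
  have UB: "(\<Union>r<l. ?B r) \<in> sets ?M" by (rule sets.finite_UN) (use B in auto)
  show "greedy_bad n m k \<rho> l \<tau> \<in> sets ?M" unfolding greedy_bad_def using A UB by (rule sets.Un)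
  have bnd: "emeasure ?M (\<Union>us\<in>L. f us) \<le> ennreal (real ?N * ?\<beta>)"
    if "finite L" "card L \<le> ?N" "\<And>us. us \<in> L \<Longrightarrow> f us \<in> sets ?M \<and> emeasure ?M (f us) \<le> ennreal ?\<beta>" for L and f :: "(nat \<Rightarrow> real) list \<Rightarrow> _"
  proof -
    have "emeasure ?M (\<Union>us\<in>L. f us) \<le> (\<Sum>us\<in>L. emeasure ?M (f us))"
      using that by (intro emeasure_subadditive_finite) auto
    also have "\<dots> \<le> (\<Sum>us\<in>L. ennreal ?\<beta>)" using that by (intro sum_mono) auto
    also have "\<dots> = ennreal (real (card L) * ?\<beta>)"
      by (simp add: ennreal_mult ennreal_of_nat_eq_real_of_nat)
    also have "\<dots> \<le> ennreal (real ?N * ?\<beta>)"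
      using that(2) by (intro ennreal_leI mult_right_mono of_nat_mono) auto
    finally show ?thesis .
  qed
  have "emeasure ?M (greedy_bad n m k \<rho> l \<tau>) \<le> emeasure ?M ?A + emeasure ?M (\<Union>r<l. ?B r)"
    unfolding greedy_bad_def by (rule emeasure_subadditive[OF A UB])
  also have "\<dots> \<le> ennreal (real ?N * ?\<beta>) + (\<Sum>r<l. ennreal (real ?N * ?\<beta>))"
  proof (rule add_mono)
    show "emeasure ?M ?A \<le> ennreal (real ?N * ?\<beta>)" using e1 c1 by (intro bnd finite_first_lists) auto
    have "emeasure ?M (\<Union>r<l. ?B r) \<le> (\<Sum>r<l. emeasure ?M (?B r))"
      using B by (intro emeasure_subadditive_finite) auto
    also have "\<dots> \<le> (\<Sum>r<l. ennreal (real ?N * ?\<beta>))"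
      using e2 c2 by (intro sum_mono bnd finite_second_lists) auto
    finally show "emeasure ?M (\<Union>r<l. ?B r) \<le> (\<Sum>r<l. ennreal (real ?N * ?\<beta>))" .
  qed
  also have "\<dots> = ennreal (real ?N * ?\<beta> + (\<Sum>r<l. real ?N * ?\<beta>))"
    by (subst sum_ennreal, simp, subst ennreal_plus) (auto intro!: sum_nonneg)
  also have "\<dots> \<le> ennreal (2 * real l * (2 ^ n * (2 * real m + 1) ^ (2 * k * n) * (real m * real n) ^ l) * ?\<beta>)"
  proof (rule ennreal_leI)
    have N: "real ?N = 2 ^ n * (2 * real m + 1) ^ (2 * k * n) * (real m * real n) ^ l" by (simp add: add.commute)
    have "real ?N * ?\<beta> + (\<Sum>r<l. real ?N * ?\<beta>) = (1 + real l) * (real ?N * ?\<beta>)"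
      by (simp add: algebra_simps)
    also have "\<dots> \<le> (2 * real l) * (real ?N * ?\<beta>)"
      using assms(3) by (intro mult_right_mono) auto
    finally show "real ?N * ?\<beta> + (\<Sum>r<l. real ?N * ?\<beta>) \<le>
      2 * real l * (2 ^ n * (2 * real m + 1) ^ (2 * k * n) * (real m * real n) ^ l) * ?\<beta>"
      unfolding N by (simp only: mult.assoc)
  qed
  finally show "emeasure ?M (greedy_bad n m k \<rho> l \<tau>) \<le>
      ennreal (2 * real l * (2 ^ n * (2 * real m + 1) ^ (2 * k * n) * (real m * real n) ^ l) * ?\<beta>)" .
qed

section \<open>The deterministic estimate\<close>

text \<open>Discarding the largest value does not increase the mean; repeat until \<open>s\<close>
  elements remain.\<close>

lemma exists_subset_small_sum:
  fixes f :: "'a \<Rightarrow> real"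
  assumes "finite X" "s \<le> card X" "\<And>x. x \<in> X \<Longrightarrow> 0 \<le> f x"
  shows "\<exists>I\<subseteq>X. card I = s \<and> real (card X) * (\<Sum>x\<in>I. f x) \<le> real s * (\<Sum>x\<in>X. f x)"
  using assms
proof (induction "card X - s" arbitrary: X)
  case 0
  then show ?case by (intro exI[of _ X]) auto
next
  case (Suc d)
  then have ne: "X \<noteq> {}" by auto
  have "Max (f ` X) \<in> f ` X" using ne Suc.prems(1) by (intro Max_in) auto
  then obtain x where x: "x \<in> X" "f x = Max (f ` X)" by auto
  then have x: "x \<in> X" "\<And>y. y \<in> X \<Longrightarrow> f y \<le> f x" using Suc.prems(1) by auto
  define Y where "Y = X - {x}"
  have cY: "card X = Suc (card Y)" using x Suc.prems(1) by (simp add: Y_def card_gt_0_iff ne)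
  have "d = card Y - s" "s \<le> card Y" using Suc.hyps(2) cY by arith+
  moreover have "finite Y" "\<And>y. y \<in> Y \<Longrightarrow> 0 \<le> f y" using Suc.prems by (auto simp: Y_def)
  ultimately obtain I where I: "I \<subseteq> Y" "card I = s" "real (card Y) * (\<Sum>x\<in>I. f x) \<le> real s * (\<Sum>x\<in>Y. f x)"
    using Suc.hyps(1)[of Y] by auto
  have "finite I" using I Suc.prems(1) by (auto simp: Y_def intro: finite_subset)
  have "(\<Sum>y\<in>I. f y) \<le> (\<Sum>y\<in>I. f x)" using I x(2) by (intro sum_mono) (auto simp: Y_def)
  then have "(\<Sum>y\<in>I. f y) \<le> real s * f x" using I by simp
  moreover have "(\<Sum>y\<in>X. f y) = f x + (\<Sum>y\<in>Y. f y)"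
    unfolding Y_def using x Suc.prems(1) by (simp add: sum.remove)
  ultimately have "real (card X) * (\<Sum>x\<in>I. f x) \<le> real s * (\<Sum>x\<in>X. f x)"
    using I(3) by (simp add: cY algebra_simps)
  then show ?case using I by (intro exI[of _ I]) (auto simp: Y_def)
qed

text \<open>Each of the \<open>m\<close> columns contributes at most 1 to the total, while row
  \<open>i\<close> accounts for at least \<open>m / 64\<close> times its norm.\<close>

lemma row_norms_le:
  assumes "G \<in> space (gaussian_matrix n m)" "G \<notin> l1_bad n m" "n > 0" "m > 0"
    and "\<And>j. j < m \<Longrightarrow> (\<Sum>i<n. \<bar>\<Sum>b<n. G (b, j) * T i b\<bar>) \<le> 1"
  shows "(\<Sum>i<n. sqrt (sq_norm {..<n} (T i))) \<le> 64"
proof -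
  have "(\<Sum>i<n. real m / 64 * sqrt (sq_norm {..<n} (T i))) \<le> (\<Sum>i<n. l1_image n m G (T i))"
    by (intro sum_mono l1_image_lower[OF assms(1-3)])
  also have "\<dots> = (\<Sum>j<m. \<Sum>i<n. \<bar>\<Sum>b<n. G (b, j) * T i b\<bar>)"
    unfolding l1_image_def by (rule sum.swap)
  also have "\<dots> \<le> (\<Sum>j<m. 1)" using assms(5) by (intro sum_mono) auto
  finally have "real m / 64 * (\<Sum>i<n. sqrt (sq_norm {..<n} (T i))) \<le> real m"
    by (simp add: sum_distrib_left)
  then show ?thesis using assms(4) by (simp add: field_simps)
qed

section \<open>Maurey approximation of the coefficient vectors\<close>

lemma gs_residual_mv_unit_vec:
  "gs_residual {..<n} g q (mv m G w) b = (\<Sum>j<m. gs_residual {..<n} g q (mv m G (unit_vec j)) b * w j)"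
proof -
  have "mv m G w = mv m G (\<lambda>i. \<Sum>j<m. w j * unit_vec j i)" (is "_ = mv m G ?v")
  proof (rule mv_cong)
    fix i assume "i < m"
    have "(\<Sum>j<m. w j * unit_vec j i) = (\<Sum>j<m. w j * unit_vec i j)"
      by (intro sum.cong) (auto simp: unit_vec_def)
    then show "w i = (\<Sum>j<m. w j * unit_vec j i)" using sum_unit_vec[of "{..<m}" i w] \<open>i < m\<close> by simp
  qed
  then have "gs_residual {..<n} g q (mv m G w) = gs_residual {..<n} g q (mv m G ?v)"
    by (rule arg_cong)
  also have "\<dots> =
     (\<lambda>b. \<Sum>j<m. w j * gs_residual {..<n} g q (mv m G (unit_vec j)) b)"
    by (simp only: mv_sum mv_scale gs_residual_sum gs_residual_scale)
  finally show ?thesis by (simp only: mult.commute[of "w _"])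
qed

lemma maurey_coordinates:
  assumes "(\<Sum>j<m. \<bar>a j\<bar>) \<le> \<rho>" "\<rho> > 0" "k > 0"
  shows "\<exists>c\<in>{..<k} \<rightarrow>\<^sub>E {..2 * m}.
     sq_norm {..<m} (\<lambda>j. a j - sparse_avg m k \<rho> c j) \<le> \<rho>\<^sup>2 / real k"
proof -
  have "\<exists>c\<in>{..<k} \<rightarrow>\<^sub>E {..2 * m}. (\<Sum>s\<in>{..<m}. (\<Sum>j<m. unit_vec s j * (a j - sparse_avg m k \<rho> c j))\<^sup>2) \<le> 1 * \<rho>\<^sup>2 / real k"
  proof (rule maurey_l1[OF assms])
    fix j assume "j < m"
    have "(\<Sum>s<m. (unit_vec s j)\<^sup>2) = (\<Sum>s<m. if s = j then 1 else 0)"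
      by (intro sum.cong) (auto simp: unit_vec_def)
    then show "(\<Sum>s\<in>{..<m}. (unit_vec s j)\<^sup>2) \<le> 1" using \<open>j < m\<close> by simp
  qed simp
  moreover have "(\<Sum>s\<in>{..<m}. (\<Sum>j<m. unit_vec s j * w j)\<^sup>2) = sq_norm {..<m} w" for w
    unfolding ip_def
    by (intro sum.cong refl) (simp add: mult.commute[of "unit_vec _ _"] sum_unit_vec power2_eq_square)
  ultimately show ?thesis by simp
qed

text \<open>One code must serve two norms: the distance for the error itself, the coefficient norm
  for the later difference vectors. The identity and the residual map divided by
  \<open>sqrt \<tau>\<close> are stacked into one linear map; unit vectors then have squared image
  norm at most 1 + 1, the origin of the factor 2.\<close>

lemma maurey_two_norms:
  assumes "(\<Sum>j<m. \<bar>a j\<bar>) \<le> \<rho>" "\<rho> > 0" "k > 0" "\<tau> > 0"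
    and "\<And>j. j < m \<Longrightarrow> dist_sq n m G us (unit_vec j) \<le> \<tau>"
  shows "\<exists>c\<in>{..<k} \<rightarrow>\<^sub>E {..2 * m}.
     sq_norm {..<m} (\<lambda>j. a j - sparse_avg m k \<rho> c j) \<le> 2 * \<rho>\<^sup>2 / real k \<and>
     dist_sq n m G us (\<lambda>j. a j - sparse_avg m k \<rho> c j) \<le> \<tau> * (2 * \<rho>\<^sup>2 / real k)"
proof -
  let ?r = "\<lambda>w. gs_residual {..<n} (\<lambda>s. mv m G (us ! s)) (length us) (mv m G w)"
  define \<phi> where "\<phi> s j = (if s < m then unit_vec s j else 1 / sqrt \<tau> * ?r (unit_vec j) (s - m))" for s j
  have sq: "(\<Sum>s<m + n. (\<Sum>j<m. \<phi> s j * w j)\<^sup>2) = sq_norm {..<m} w + dist_sq n m G us w / \<tau>" for w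
  proof -
    have "(\<Sum>s<m. (\<Sum>j<m. \<phi> s j * w j)\<^sup>2) = sq_norm {..<m} w"
      unfolding ip_def
      by (intro sum.cong refl) (simp add: \<phi>_def mult.commute[of "unit_vec _ _"] sum_unit_vec power2_eq_square)
    moreover have "(\<Sum>b<n. (\<Sum>j<m. \<phi> (m + b) j * w j)\<^sup>2) = dist_sq n m G us w / \<tau>"
    proof -
      have "(\<Sum>j<m. \<phi> (m + b) j * w j) = 1 / sqrt \<tau> * ?r w b" for b
        unfolding gs_residual_mv_unit_vec[of n _ _ m G w b] by (simp add: \<phi>_def sum_divide_distrib)
      then show ?thesis
        using assms(4) by (simp add: dist_sq_def Let_def ip_def power_divide power2_eq_square sum_divide_distrib)
    qed
    ultimately show ?thesis by (simp add: sum_lessThan_add)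
  qed
  have "\<exists>c\<in>{..<k} \<rightarrow>\<^sub>E {..2 * m}. (\<Sum>s\<in>{..<m + n}. (\<Sum>j<m. \<phi> s j * (a j - sparse_avg m k \<rho> c j))\<^sup>2) \<le> 2 * \<rho>\<^sup>2 / real k"
  proof (rule maurey_l1[OF assms(1-3)])
    fix j assume j: "j < m"
    have "(\<Sum>i<m. \<phi> s i * unit_vec j i) = \<phi> s j" for s using j by (simp add: sum_unit_vec)
    then have "(\<Sum>s\<in>{..<m + n}. (\<phi> s j)\<^sup>2) = sq_norm {..<m} (unit_vec j) + dist_sq n m G us (unit_vec j) / \<tau>"
      using sq[of "unit_vec j"] by simp
    also have "sq_norm {..<m} (unit_vec j) = 1"
      using j sum_unit_vec[of "{..<m}" j "unit_vec j"] by (simp add: ip_def) (simp add: unit_vec_def)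
    also have "1 + dist_sq n m G us (unit_vec j) / \<tau> \<le> 2"
      using assms(4) assms(5)[OF j] by simp
    finally show "(\<Sum>s\<in>{..<m + n}. (\<phi> s j)\<^sup>2) \<le> 2" .
  qed simp
  then obtain c where c: "c \<in> {..<k} \<rightarrow>\<^sub>E {..2 * m}"
    "sq_norm {..<m} (\<lambda>j. a j - sparse_avg m k \<rho> c j) +
     dist_sq n m G us (\<lambda>j. a j - sparse_avg m k \<rho> c j) / \<tau> \<le> 2 * \<rho>\<^sup>2 / real k"
    unfolding sq by blast
  have "dist_sq n m G us (\<lambda>j. a j - sparse_avg m k \<rho> c j) / \<tau> \<ge> 0"
    using dist_sq_nonneg assms(4) by simp
  then have "sq_norm {..<m} (\<lambda>j. a j - sparse_avg m k \<rho> c j) \<le> 2 * \<rho>\<^sup>2 / real k"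
    "dist_sq n m G us (\<lambda>j. a j - sparse_avg m k \<rho> c j) / \<tau> \<le> 2 * \<rho>\<^sup>2 / real k"
    using c(2) ip_self_nonneg[of "{..<m}" "\<lambda>j. a j - sparse_avg m k \<rho> c j"] by linarith+
  then show ?thesis using c(1) assms(4) by (intro bexI[of _ c]) (auto simp: field_simps)
qed

text \<open>For orthonormal \<open>ws\<close>, the Euclidean norm of the orthogonal projection of
  \<open>y\<close> onto their span.\<close>

definition proj_norm :: "nat \<Rightarrow> (nat \<Rightarrow> real) list \<Rightarrow> (nat \<Rightarrow> real) \<Rightarrow> real" where
  "proj_norm n ws y = L2_set (\<lambda>s. ip {..<n} (ws ! s) y) {..<length ws}"

lemma proj_norm_add: "proj_norm n ws (\<lambda>b. x b + y b) \<le> proj_norm n ws x + proj_norm n ws y"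
  unfolding proj_norm_def ip_add_right by (rule L2_set_triangle_ineq)

lemma proj_norm_scale: "proj_norm n ws (\<lambda>b. c * x b) = \<bar>c\<bar> * proj_norm n ws x"
  unfolding proj_norm_def ip_scale_right
  by (simp add: L2_set_def power_mult_distrib real_sqrt_mult flip: sum_distrib_left)

lemma proj_norm_zero: "proj_norm n ws (\<lambda>b. 0) = 0"
  by (simp add: proj_norm_def L2_set_def ip_zero_right)

lemma proj_norm_nonneg: "0 \<le> proj_norm n ws x"
  by (simp add: proj_norm_def)

lemma proj_norm_sum:
  "finite S \<Longrightarrow> proj_norm n ws (\<lambda>b. \<Sum>s\<in>S. f s b) \<le> (\<Sum>s\<in>S. proj_norm n ws (f s))"
proof (induction S rule: finite_induct)
  case empty
  show ?case by (simp add: proj_norm_zero)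
next
  case (insert x F)
  then show ?case using proj_norm_add[of n ws "f x" "\<lambda>b. \<Sum>s\<in>F. f s b"] by simp
qed

lemma proj_norm_le_dist:
  assumes "orthonormal {..<n} ws" "\<And>w s. w \<in> set ws \<Longrightarrow> s < length us \<Longrightarrow> ip {..<n} w (mv m G (us ! s)) = 0"
  shows "proj_norm n ws (mv m G w) \<le> sqrt (dist_sq n m G us w)"
  unfolding proj_norm_def L2_set_def dist_sq_def Let_def
  by (intro real_sqrt_le_mono orth_Bessel_gs_residual assms)

lemma dist_sq_eq_0:
  assumes "\<And>j. j < m \<Longrightarrow> residual {..<m} us w j = 0"
  shows "dist_sq n m G us w = 0"
proof -
  have "mv m G (residual {..<m} us w) = mv m G (\<lambda>j. 0 * w j)" using assms by (intro mv_cong) simp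
  then have "dist_sq n m G us (residual {..<m} us w) = dist_sq n m G us (\<lambda>j. 0 * w j)" by (simp add: dist_sq_def)
  then show ?thesis unfolding dist_sq_residual by (subst (asm) dist_sq_scale) simp
qed

text \<open>Evaluates the trace of the projection onto \<open>ws\<close> through \<open>Id = \<Sum>\<^sub>i x\<^sub>i T\<^sub>i\<^sup>T\<close>.\<close>

lemma length_le_sum_proj_norm:
  assumes "orthonormal {..<n} ws"
    and id: "\<And>r q. r < n \<Longrightarrow> q < n \<Longrightarrow> (\<Sum>i<n. x i r * T i q) = (if r = q then 1 else 0)"
  shows "real (length ws) \<le> (\<Sum>i<n. sqrt (sq_norm {..<n} (T i)) * proj_norm n ws (x i))"
proof -
  have one: "(\<Sum>i<n. ip {..<n} (T i) w * ip {..<n} w (x i)) = sq_norm {..<n} w" for w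
  proof -
    have "(\<Sum>i<n. ip {..<n} (T i) w * ip {..<n} w (x i)) = (\<Sum>i<n. \<Sum>q<n. \<Sum>r<n. w q * w r * (x i r * T i q))"
      unfolding ip_def sum_product by (intro sum.cong refl) (simp add: mult_ac)
    also have "\<dots> = (\<Sum>q<n. \<Sum>i<n. \<Sum>r<n. w q * w r * (x i r * T i q))" by (rule sum.swap)
    also have "\<dots> = (\<Sum>q<n. \<Sum>r<n. w q * w r * (\<Sum>i<n. x i r * T i q))"
      unfolding sum_distrib_left by (rule sum.cong[OF refl], rule sum.swap)
    also have "\<dots> = (\<Sum>q<n. \<Sum>r<n. if r = q then w q * w r else 0)"
      using id by (intro sum.cong refl) auto
    finally show ?thesis by (simp add: ip_def)
  qed
  have "real (length ws) = (\<Sum>s<length ws. sq_norm {..<n} (ws ! s))"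
    using assms(1) by (simp add: orthonormal_def)
  also have "\<dots> = (\<Sum>s<length ws. \<Sum>i<n. ip {..<n} (T i) (ws ! s) * ip {..<n} (ws ! s) (x i))"
    by (simp add: one)
  also have "\<dots> = (\<Sum>i<n. \<Sum>s<length ws. ip {..<n} (T i) (ws ! s) * ip {..<n} (ws ! s) (x i))"
    by (rule sum.swap)
  also have "\<dots> \<le> (\<Sum>i<n. sqrt (sq_norm {..<n} (T i)) * proj_norm n ws (x i))"
  proof (rule sum_mono)
    fix i
    have "(\<Sum>s<length ws. ip {..<n} (T i) (ws ! s) * ip {..<n} (ws ! s) (x i)) \<le>
        (\<Sum>s<length ws. \<bar>ip {..<n} (T i) (ws ! s)\<bar> * \<bar>ip {..<n} (ws ! s) (x i)\<bar>)"
      by (intro sum_mono) (metis abs_ge_self abs_mult)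
    also have "\<dots> \<le> L2_set (\<lambda>s. ip {..<n} (T i) (ws ! s)) {..<length ws} * proj_norm n ws (x i)"
      unfolding proj_norm_def by (rule L2_set_mult_ineq)
    also have "\<dots> \<le> sqrt (sq_norm {..<n} (T i)) * proj_norm n ws (x i)"
      unfolding L2_set_def by (intro mult_right_mono real_sqrt_le_mono Bessel assms(1) proj_norm_nonneg)
    finally show "(\<Sum>s<length ws. ip {..<n} (T i) (ws ! s) * ip {..<n} (ws ! s) (x i)) \<le>
       sqrt (sq_norm {..<n} (T i)) * proj_norm n ws (x i)" .
  qed
  finally show ?thesis .
qed

text \<open>Both greedy stages stop before \<open>l\<close> steps, so of the \<open>4 * l\<close>
  free dimensions at least \<open>2 * l\<close> survive. Indices in \<open>I\<close> have only the
  crude bound \<open>\<rho> * sqrt \<tau>\<close>, but their row norms are a share of at most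
  \<open>4 * l / n\<close>. For the others, 5 = 2 + 3 adds the second Maurey error and the
  difference of the two approximations.\<close>

theorem good_matrix_estimate:
  assumes G: "G \<in> space (gaussian_matrix n m)" "G \<notin> l1_bad n m" "G \<notin> greedy_bad n m k \<rho> l \<tau>"
    and dims: "0 < l" "4 * l \<le> n" "n \<le> m" "0 < k" and \<rho>: "\<rho> > 0" and \<tau>: "\<tau> > 0"
    and a: "\<And>i. i < n \<Longrightarrow> (\<Sum>j<m. \<bar>a i j\<bar>) \<le> \<rho>"
    and T: "\<And>j. j < m \<Longrightarrow> (\<Sum>i<n. \<bar>\<Sum>b<n. G (b, j) * T i b\<bar>) \<le> 1"
    and id: "\<And>r q. r < n \<Longrightarrow> q < n \<Longrightarrow> (\<Sum>i<n. mv m G (a i) r * T i q) = (if r = q then 1 else 0)"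
  shows "2 * real l \<le> 64 * (4 * real l / real n * (\<rho> * sqrt \<tau>) + 5 * \<rho> * sqrt (\<tau> / real k))"
proof -
  have n0: "n > 0" "m > 0" using dims by auto
  let ?T = "\<lambda>i. sqrt (sq_norm {..<n} (T i))"
  have sumT: "(\<Sum>i<n. ?T i) \<le> 64" using row_norms_le[OF G(1,2) n0] T by blast
  obtain I where I: "I \<subseteq> {..<n}" "card I = 4 * l" "real n * (\<Sum>i\<in>I. ?T i) \<le> real (4 * l) * (\<Sum>i<n. ?T i)"
    using exists_subset_small_sum[of "{..<n}" "4 * l" ?T] dims by auto
  have sumI: "(\<Sum>i\<in>I. ?T i) \<le> 64 * (4 * real l / real n)"
  proof -
    have "real n * (\<Sum>i\<in>I. ?T i) \<le> real (4 * l) * 64"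
      using I(3) sumT by (meson mult_left_mono of_nat_0_le_iff order_trans)
    then show ?thesis using n0 by (simp add: field_simps)
  qed
  have "\<forall>i\<in>{..<n}. \<exists>c. c \<in> {..<k} \<rightarrow>\<^sub>E {..2 * m} \<and>
     sq_norm {..<m} (\<lambda>j. a i j - sparse_avg m k \<rho> c j) \<le> \<rho>\<^sup>2 / real k"
    using maurey_coordinates[OF a \<rho> dims(4)] by blast
  from bchoice[OF this] obtain C0 where C0: "\<forall>i\<in>{..<n}. C0 i \<in> {..<k} \<rightarrow>\<^sub>E {..2 * m} \<and>
     sq_norm {..<m} (\<lambda>j. a i j - sparse_avg m k \<rho> (C0 i) j) \<le> \<rho>\<^sup>2 / real k"
    by blast
  define C where "C = restrict C0 {..<n}"
  have C: "C \<in> code_set n m k" using C0 by (auto simp: C_def code_set_def)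
  have Cn: "sq_norm {..<m} (\<lambda>j. a i j - sparse_avg m k \<rho> (C i) j) \<le> \<rho>\<^sup>2 / real k"
    if "i < n" for i using C0 that by (simp add: C_def)
  let ?us0 = "initial_list n m k \<rho> l I C"
  note us0 = initial_list[OF I(1,2) dims(3), where k = k and \<rho> = \<rho> and C = C]
  have "\<exists>r<l. \<exists>us\<in>extensions m (unit_vecs m) r ?us0. \<forall>w\<in>unit_vecs m. dist_sq n m G us w \<le> \<tau>"
  proof (rule greedy_extension[OF us0(2)])
    fix w assume "w \<in> unit_vecs m"
    then obtain j where "w = unit_vec j" "j < m" by (auto simp: unit_vecs_def)
    then show "sq_norm {..<m} w \<le> 1"
      using sum_unit_vec[of "{..<m}" j "unit_vec j"] by (simp add: ip_def) (simp add: unit_vec_def)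
  next
    fix us assume "us \<in> extensions m (unit_vecs m) l ?us0"
    then have "us \<in> first_lists n m k \<rho> l l" using I C by (auto simp: first_lists_def)
    then have "G \<notin> far_event n m \<tau> l (n - 4 * l) us" using G(3) by (auto simp: greedy_bad_def)
    then show "\<exists>t<l. gs_sqnorm n (\<lambda>s. mv m G (us ! s)) (length ?us0 + t) < \<tau>"
      using G(1) by (auto simp: far_event_def us0(1) not_le)
  qed (use \<tau> in simp)
  then obtain r1 us1 where us1: "r1 < l" "us1 \<in> extensions m (unit_vecs m) r1 ?us0"
    "\<And>j. j < m \<Longrightarrow> dist_sq n m G us1 (unit_vec j) \<le> \<tau>" by (auto simp: unit_vecs_def)
  have us1p: "orthonormal {..<m} us1" "length us1 = n - 4 * l + r1" "\<exists>vs. us1 = ?us0 @ vs"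
    using extensions_props[OF us0(2) us1(2)] us0(1) by auto
  have "\<forall>i\<in>{..<n}. \<exists>c. c \<in> {..<k} \<rightarrow>\<^sub>E {..2 * m} \<and>
     sq_norm {..<m} (\<lambda>j. a i j - sparse_avg m k \<rho> c j) \<le> 2 * \<rho>\<^sup>2 / real k \<and>
     dist_sq n m G us1 (\<lambda>j. a i j - sparse_avg m k \<rho> c j) \<le> \<tau> * (2 * \<rho>\<^sup>2 / real k)"
    using maurey_two_norms[OF a \<rho> dims(4) \<tau> us1(3)] by blast
  from bchoice[OF this] obtain C1 where C1: "\<forall>i\<in>{..<n}. C1 i \<in> {..<k} \<rightarrow>\<^sub>E {..2 * m} \<and>
     sq_norm {..<m} (\<lambda>j. a i j - sparse_avg m k \<rho> (C1 i) j) \<le> 2 * \<rho>\<^sup>2 / real k \<and>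
     dist_sq n m G us1 (\<lambda>j. a i j - sparse_avg m k \<rho> (C1 i) j) \<le> \<tau> * (2 * \<rho>\<^sup>2 / real k)"
    by blast
  define C' where "C' = restrict C1 {..<n}"
  have C': "C' \<in> code_set n m k" using C1 by (auto simp: C'_def code_set_def)
  have Cn': "sq_norm {..<m} (\<lambda>j. a i j - sparse_avg m k \<rho> (C' i) j) \<le> 2 * \<rho>\<^sup>2 / real k"
    "dist_sq n m G us1 (\<lambda>j. a i j - sparse_avg m k \<rho> (C' i) j) \<le> \<tau> * (2 * \<rho>\<^sup>2 / real k)"
    if "i < n" for i using C1 that by (auto simp: C'_def)
  define d where "d i = (\<lambda>j. sparse_avg m k \<rho> (C' i) j - sparse_avg m k \<rho> (C i) j)" for i
  have dn: "sq_norm {..<m} (d i) \<le> (3 * \<rho> / sqrt (real k))\<^sup>2" if "i < n" for i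
  proof -
    let ?u = "\<lambda>j. a i j - sparse_avg m k \<rho> (C i) j" and ?v = "\<lambda>j. - (a i j - sparse_avg m k \<rho> (C' i) j)"
    have "sq_norm {..<m} ?v = sq_norm {..<m} (\<lambda>j. a i j - sparse_avg m k \<rho> (C' i) j)"
      by (simp add: ip_def algebra_simps)
    then have "sq_norm {..<m} ?v \<le> 2 * \<rho>\<^sup>2 / real k" using Cn'(1)[OF that] by simp
    \<comment> \<open>Rounding 2 up to 4 makes the square root exact; 1 + 2 is the 3 in
      \<open>diff_vecs\<close>.\<close>
    also have "\<dots> \<le> 4 * (\<rho>\<^sup>2 / real k)" by (simp add: divide_right_mono)
    finally have v: "sq_norm {..<m} ?v \<le> 4 * (\<rho>\<^sup>2 / real k)" .
    have "sqrt (sq_norm {..<m} (d i)) \<le> sqrt (sq_norm {..<m} ?u) + sqrt (sq_norm {..<m} ?v)"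
      using ip_triangle[of "{..<m}" ?u ?v] by (simp add: d_def)
    also have "\<dots> \<le> sqrt (\<rho>\<^sup>2 / real k) + sqrt (4 * (\<rho>\<^sup>2 / real k))"
      by (intro add_mono real_sqrt_le_mono Cn[OF that] v)
    also have "\<dots> = 3 * \<rho> / sqrt (real k)"
      using \<rho> by (simp add: real_sqrt_mult real_sqrt_divide)
    finally show ?thesis by (rule sqrt_le_D)
  qed
  have wS: "(\<lambda>j. sqrt (real k) / (3 * \<rho>) * d i j) \<in> diff_vecs n m k \<rho> C C'" if "i < n" for i
  proof -
    have "sq_norm {..<m} (\<lambda>j. sqrt (real k) / (3 * \<rho>) * d i j)
       = (sqrt (real k) / (3 * \<rho>))\<^sup>2 * sq_norm {..<m} (d i)"
      unfolding ip_scale_left ip_scale_right by (simp add: power2_eq_square)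
    also have "\<dots> \<le> (sqrt (real k) / (3 * \<rho>))\<^sup>2 * (3 * \<rho> / sqrt (real k))\<^sup>2"
      by (intro mult_left_mono dn that) simp
    also have "\<dots> = 1" using \<rho> dims(4) by (simp add: power_divide)
    finally show ?thesis using that by (auto simp: diff_vecs_def d_def)
  qed
  have "\<exists>r<l. \<exists>us\<in>extensions m (diff_vecs n m k \<rho> C C') r us1. \<forall>w\<in>diff_vecs n m k \<rho> C C'. dist_sq n m G us w \<le> \<tau>"
  proof (rule greedy_extension[OF us1p(1)])
    show "sq_norm {..<m} w \<le> 1" if "w \<in> diff_vecs n m k \<rho> C C'" for w using that by (simp add: diff_vecs_def)
  next
    fix us assume "us \<in> extensions m (diff_vecs n m k \<rho> C C') l us1"
    then have "us \<in> second_lists n m k \<rho> l r1" using I C C' us1(2) by (auto simp: second_lists_def)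
    then have "G \<notin> far_event n m \<tau> l (n - 4 * l + r1) us" using G(3) us1(1) by (auto simp: greedy_bad_def)
    then show "\<exists>t<l. gs_sqnorm n (\<lambda>s. mv m G (us ! s)) (length us1 + t) < \<tau>"
      using G(1) by (auto simp: far_event_def us1p(2) not_le)
  qed (use \<tau> in simp)
  then obtain r2 us2 where us2: "r2 < l" "us2 \<in> extensions m (diff_vecs n m k \<rho> C C') r2 us1"
    "\<And>w. w \<in> diff_vecs n m k \<rho> C C' \<Longrightarrow> dist_sq n m G us2 w \<le> \<tau>" by blast
  have us2p: "length us2 = n - 4 * l + r1 + r2" "\<exists>vs. us2 = us1 @ vs"
    using extensions_props[OF us1p(1) us2(2)] us1p(2) by auto
  have dd: "dist_sq n m G us2 (d i) \<le> 9 * \<rho>\<^sup>2 / real k * \<tau>" if "i < n" for i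
  proof -
    have "d i = (\<lambda>j. 3 * \<rho> / sqrt (real k) * (sqrt (real k) / (3 * \<rho>) * d i j))"
      using \<rho> dims(4) by auto
    then have "dist_sq n m G us2 (d i) = (3 * \<rho> / sqrt (real k))\<^sup>2 * dist_sq n m G us2 (\<lambda>j. sqrt (real k) / (3 * \<rho>) * d i j)"
      by (metis dist_sq_scale)
    also have "\<dots> \<le> (3 * \<rho> / sqrt (real k))\<^sup>2 * \<tau>"
      by (intro mult_left_mono us2(3) wS that) simp
    finally show ?thesis by (simp add: power_divide power_mult_distrib)
  qed
  \<comment> \<open>Orthogonality to the images of the longest list \<open>us2\<close> passes to its
    prefixes \<open>us1\<close> and \<open>?us0\<close>, so the distance bounds from all stages
    apply to the projection onto \<open>ws\<close>.\<close>
  have "length (map (\<lambda>u. mv m G u) us2) + (n - length us2) \<le> card {..<n}"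
    using us2p(1) us1(1) us2(1) dims by simp
  from exists_orthonormal_complement[OF _ this] obtain ws where ws: "length ws = n - length us2"
    "orthonormal {..<n} ws" "\<forall>w\<in>set ws. \<forall>v\<in>set (map (\<lambda>u. mv m G u) us2). ip {..<n} w v = 0" by auto
  obtain vs1 vs2 where vs: "us1 = ?us0 @ vs1" "us2 = us1 @ vs2" using us1p(3) us2p(2) by blast
  have perp2: "ip {..<n} w (mv m G (us2 ! s)) = 0" if "w \<in> set ws" "s < length us2" for w s
    using ws(3) that by auto
  have perp1: "ip {..<n} w (mv m G (us1 ! s)) = 0" if "w \<in> set ws" "s < length us1" for w s
    using perp2[OF that(1), of s] that(2) by (simp add: vs(2) nth_append)
  have perp0: "ip {..<n} w (mv m G (?us0 ! s)) = 0" if "w \<in> set ws" "s < length ?us0" for w s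
    using perp1[OF that(1), of s] that(2) by (simp add: vs(1) nth_append)
  let ?p = "proj_norm n ws"
  have pI: "?p (mv m G (a i)) \<le> \<rho> * sqrt \<tau>" if "i < n" for i
  proof -
    have "mv m G (a i) = (\<lambda>b. \<Sum>j<m. a i j * mv m G (unit_vec j) b)"
    proof
      fix b
      have "mv m G (unit_vec j) b = G (b, j)" if "j < m" for j
        using sum_unit_vec[of "{..<m}" j "\<lambda>i. G (b, i)"] that by (simp add: mv_def)
      then show "mv m G (a i) b = (\<Sum>j<m. a i j * mv m G (unit_vec j) b)"
        by (simp add: mv_def[of m G "a i"] mult.commute)
    qed
    then have "?p (mv m G (a i)) \<le> (\<Sum>j<m. ?p (\<lambda>b. a i j * mv m G (unit_vec j) b))"
      using proj_norm_sum[of "{..<m}" n ws "\<lambda>j b. a i j * mv m G (unit_vec j) b"] by simp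
    also have "\<dots> \<le> (\<Sum>j<m. \<bar>a i j\<bar> * sqrt \<tau>)"
      unfolding proj_norm_scale
    proof (intro sum_mono mult_left_mono)
      fix j assume "j \<in> {..<m}"
      have "?p (mv m G (unit_vec j)) \<le> sqrt (dist_sq n m G us1 (unit_vec j))"
        by (rule proj_norm_le_dist[OF ws(2) perp1])
      also have "\<dots> \<le> sqrt \<tau>" using us1(3) \<open>j \<in> {..<m}\<close> by simp
      finally show "?p (mv m G (unit_vec j)) \<le> sqrt \<tau>" .
    qed simp
    also have "\<dots> = (\<Sum>j<m. \<bar>a i j\<bar>) * sqrt \<tau>" by (simp add: sum_distrib_right)
    also have "\<dots> \<le> \<rho> * sqrt \<tau>" using a[OF that] \<tau> by (intro mult_right_mono) auto
    finally show ?thesis .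
  qed
  have pO: "?p (mv m G (a i)) \<le> 5 * \<rho> * sqrt (\<tau> / real k)" if i: "i < n" "i \<notin> I" for i
  proof -
    \<comment> \<open>Three pieces: \<open>?e\<close> is small because \<open>C'\<close> was adapted
      to \<open>us1\<close>, \<open>d i\<close> by the second greedy stage, and \<open>?s\<close> is
      killed by the initial list since \<open>i\<close> lies outside \<open>I\<close>.\<close>
    let ?e = "\<lambda>j. a i j - sparse_avg m k \<rho> (C' i) j" and ?s = "sparse_avg m k \<rho> (C i)"
    have "mv m G (a i) = mv m G (\<lambda>j. (?e j + d i j) + ?s j)" by (simp add: d_def)
    also have "\<dots> = (\<lambda>b. (mv m G ?e b + mv m G (d i) b) + mv m G ?s b)" by (simp only: mv_add)
    finally have "?p (mv m G (a i)) \<le> ?p (mv m G ?e) + ?p (mv m G (d i)) + ?p (mv m G ?s)"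
      using proj_norm_add[of n ws "\<lambda>b. mv m G ?e b + mv m G (d i) b" "mv m G ?s"] proj_norm_add[of n ws "mv m G ?e" "mv m G (d i)"]
      by simp
    moreover have "?p (mv m G ?s) \<le> 0"
      using proj_norm_le_dist[OF ws(2) perp0, of ?s] dist_sq_eq_0[of m ?us0 ?s n G] us0(3)[OF i] by simp
    moreover have "?p (mv m G ?e) \<le> 2 * \<rho> * sqrt (\<tau> / real k)"
    proof -
      have "?p (mv m G ?e) \<le> sqrt (dist_sq n m G us1 ?e)" by (rule proj_norm_le_dist[OF ws(2) perp1])
      also have "\<dots> \<le> sqrt ((2 * \<rho>)\<^sup>2 * (\<tau> / real k))"
        using Cn'(2)[OF i(1)] \<rho> \<tau>
        by (intro real_sqrt_le_mono) (erule order_trans, simp add: power_mult_distrib divide_right_mono)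
      also have "\<dots> = 2 * \<rho> * sqrt (\<tau> / real k)"
        unfolding real_sqrt_mult real_sqrt_abs using \<rho> by simp
      finally show ?thesis .
    qed
    moreover have "?p (mv m G (d i)) \<le> 3 * \<rho> * sqrt (\<tau> / real k)"
    proof -
      have "?p (mv m G (d i)) \<le> sqrt (dist_sq n m G us2 (d i))" by (rule proj_norm_le_dist[OF ws(2) perp2])
      also have "\<dots> \<le> sqrt ((3 * \<rho>)\<^sup>2 * (\<tau> / real k))"
        using dd[OF i(1)] by (intro real_sqrt_le_mono) (simp add: power_mult_distrib)
      also have "\<dots> = 3 * \<rho> * sqrt (\<tau> / real k)"
        unfolding real_sqrt_mult real_sqrt_abs using \<rho> by simp
      finally show ?thesis .
    qed
    ultimately show ?thesis by simp
  qed
  have "2 * real l \<le> real (length ws)"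
    using ws(1) us2p(1) us1(1) us2(1) dims by simp
  also have "\<dots> \<le> (\<Sum>i<n. ?T i * ?p (mv m G (a i)))"
    by (rule length_le_sum_proj_norm[OF ws(2) id])
  also have "\<dots> = (\<Sum>i\<in>I. ?T i * ?p (mv m G (a i))) + (\<Sum>i\<in>{..<n} - I. ?T i * ?p (mv m G (a i)))"
    using I(1) by (simp add: sum.subset_diff add.commute)
  also have "\<dots> \<le> (\<Sum>i\<in>I. ?T i * (\<rho> * sqrt \<tau>)) + (\<Sum>i\<in>{..<n} - I. ?T i * (5 * \<rho> * sqrt (\<tau> / real k)))"
    using I(1) pI pO by (intro add_mono sum_mono mult_left_mono) auto
  also have "\<dots> = (\<Sum>i\<in>I. ?T i) * (\<rho> * sqrt \<tau>) + (\<Sum>i\<in>{..<n} - I. ?T i) * (5 * \<rho> * sqrt (\<tau> / real k))"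
    by (simp add: sum_distrib_right)
  also have "\<dots> \<le> (64 * (4 * real l / real n)) * (\<rho> * sqrt \<tau>) + 64 * (5 * \<rho> * sqrt (\<tau> / real k))"
  proof (intro add_mono mult_right_mono sumI)
    have "(\<Sum>i\<in>{..<n} - I. ?T i) \<le> (\<Sum>i<n. ?T i)" by (intro sum_mono2) auto
    then show "(\<Sum>i\<in>{..<n} - I. ?T i) \<le> 64" using sumT by simp
  qed (use \<rho> \<tau> in auto)
  finally show ?thesis by (simp add: algebra_simps)
qed

section \<open>The Banach--Mazur distance in coordinates\<close>

lemma unit_vec_in_Rn: "i < n \<Longrightarrow> unit_vec i \<in> Rn n"
  by (simp add: topspace_Euclidean_space unit_vec_def)

lemma unit_vec_in_cross_polytope:
  assumes "i < n" shows "unit_vec i \<in> cross_polytope n"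
proof -
  have "(\<Sum>k<n. \<bar>unit_vec i k\<bar>) = 1"
    using sum_unit_vec[of "{..<n}" i "\<lambda>_. 1"] assms by (simp add: unit_vec_def if_distrib cong: if_cong)
  then show ?thesis using assms by (simp add: cross_polytope_eq_l1_ball unit_vec_in_Rn)
qed

lemma mat_apply_unit_vec: "j < m \<Longrightarrow> mat_apply n m A (unit_vec j) = (\<lambda>i. if i < n then A (i, j) else 0)"
  by (auto simp: mat_apply_def sum_unit_vec fun_eq_iff)

lemma mat_apply_scale: "mat_apply n m A (\<lambda>j. c * x j) = (\<lambda>i. c * mat_apply n m A x i)"
  by (auto simp: mat_apply_def sum_distrib_left mult_ac intro!: sum.cong)

lemma mat_apply_in_Rn: "mat_apply n m A x \<in> Rn n"
  by (simp add: topspace_Euclidean_space mat_apply_def)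

lemma mat_apply_eq_mv: "r < n \<Longrightarrow> mat_apply n m G y r = mv m G y r"
  by (simp add: mat_apply_def mv_def)

text \<open>
  \<open>T\<close> maps \<open>G(B\<^sub>1\<^sup>m)\<close> into \<open>B\<^sub>1\<^sup>n\<close>, and column \<open>i\<close> of \<open>Y\<close> witnesses
  \<open>e\<^sub>i \<in> \<rho> T G(B\<^sub>1\<^sup>m)\<close>.
\<close>

definition bm_witness ::
  "nat \<Rightarrow> nat \<Rightarrow> real \<Rightarrow> (nat \<times> nat \<Rightarrow> real) \<Rightarrow> (nat \<times> nat \<Rightarrow> real) \<Rightarrow> (nat \<times> nat \<Rightarrow> real) \<Rightarrow> (nat \<times> nat \<Rightarrow> real) \<Rightarrow> bool" where
  "bm_witness n m \<rho> G T S Y \<longleftrightarrow>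
     (\<forall>i<n. \<forall>q<n. (\<Sum>r<n. S (i, r) * T (r, q)) = unit_vec q i) \<and>
     (\<forall>i<n. \<forall>q<n. (\<Sum>r<n. T (i, r) * S (r, q)) = unit_vec q i) \<and>
     (\<forall>j<m. (\<Sum>i<n. \<bar>\<Sum>b<n. T (i, b) * G (b, j)\<bar>) \<le> 1) \<and>
     (\<forall>i<n. (\<Sum>j<m. \<bar>Y (j, i)\<bar>) \<le> 1) \<and>
     (\<forall>i<n. \<forall>r<n. \<rho> * (\<Sum>b<n. T (r, b) * (\<Sum>j<m. G (b, j) * Y (j, i))) = unit_vec i r)"

lemma mat_apply_inverse:
  assumes "\<And>i q. i < n \<Longrightarrow> q < n \<Longrightarrow> (\<Sum>r<n. S (i, r) * T (r, q)) = unit_vec q i" "x \<in> Rn n"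
  shows "mat_apply n n S (mat_apply n n T x) = x"
proof
  fix i
  show "mat_apply n n S (mat_apply n n T x) i = x i"
  proof (cases "i < n")
    case True
    have "mat_apply n n S (mat_apply n n T x) i = (\<Sum>r<n. \<Sum>q<n. x q * (S (i, r) * T (r, q)))"
      using True by (simp add: mat_apply_def sum_distrib_left mult_ac)
    also have "\<dots> = (\<Sum>q<n. x q * (\<Sum>r<n. S (i, r) * T (r, q)))"
      unfolding sum_distrib_left by (rule sum.swap)
    also have "\<dots> = (\<Sum>q<n. x q * unit_vec i q)"
      using assms(1) True by (intro sum.cong) (auto simp: unit_vec_def)
    finally show ?thesis using True by (simp add: sum_unit_vec)
  next
    case False
    then show ?thesis using assms(2) by (simp add: mat_apply_def topspace_Euclidean_space)
  qed
qed

text \<open>By linearity, \<open>z\<close> in the cross-polytope is reached from the combination of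
  the columns of \<open>Y\<close> with coefficients \<open>z i\<close>. With
  \<open>witness_of_BM_dist_less\<close> this makes small distance equivalent to the existence of a
  witness, as measurability requires.\<close>

lemma BM_dist_le_of_witness:
  assumes "bm_witness n m \<rho> G T S Y" "1 \<le> \<rho>" "n > 0" "m > 0"
  shows "BM_dist n (mat_apply n m G ` cross_polytope m) (cross_polytope n) \<le> ereal \<rho>"
proof -
  let ?TG = "\<lambda>x. mat_apply n n T (mat_apply n m G x)"
  have W: "\<And>i q. i < n \<Longrightarrow> q < n \<Longrightarrow> (\<Sum>r<n. S (i, r) * T (r, q)) = unit_vec q i"
    "\<And>i q. i < n \<Longrightarrow> q < n \<Longrightarrow> (\<Sum>r<n. T (i, r) * S (r, q)) = unit_vec q i"
    "\<And>j. j < m \<Longrightarrow> (\<Sum>i<n. \<bar>\<Sum>b<n. T (i, b) * G (b, j)\<bar>) \<le> 1"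
    "\<And>i. i < n \<Longrightarrow> (\<Sum>j<m. \<bar>Y (j, i)\<bar>) \<le> 1"
    "\<And>i r. i < n \<Longrightarrow> r < n \<Longrightarrow> \<rho> * (\<Sum>b<n. T (r, b) * (\<Sum>j<m. G (b, j) * Y (j, i))) = unit_vec i r"
    using assms(1) by (auto simp: bm_witness_def)
  have "T \<in> GL n"
    unfolding GL_def using mat_apply_inverse[OF W(1)] mat_apply_inverse[OF W(2)] by blast
  moreover have "mat_apply n n T ` (mat_apply n m G ` cross_polytope m) \<subseteq> cross_polytope n"
  proof
    fix z assume "z \<in> mat_apply n n T ` (mat_apply n m G ` cross_polytope m)"
    then obtain x where x: "x \<in> cross_polytope m" "z = ?TG x" by auto
    have zi: "z i = (\<Sum>j<m. x j * (\<Sum>b<n. T (i, b) * G (b, j)))" if "i < n" for i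
    proof -
      have "z i = (\<Sum>b<n. \<Sum>j<m. x j * (T (i, b) * G (b, j)))"
        using that by (simp add: x(2) mat_apply_def sum_distrib_left mult_ac)
      then show ?thesis unfolding sum_distrib_left by (subst sum.swap) simp
    qed
    have "(\<Sum>i<n. \<bar>z i\<bar>) \<le> (\<Sum>i<n. \<Sum>j<m. \<bar>x j\<bar> * \<bar>\<Sum>b<n. T (i, b) * G (b, j)\<bar>)"
      using zi by (intro sum_mono) (auto simp: abs_mult intro!: order_trans[OF sum_abs] sum_mono)
    also have "\<dots> = (\<Sum>j<m. \<bar>x j\<bar> * (\<Sum>i<n. \<bar>\<Sum>b<n. T (i, b) * G (b, j)\<bar>))"
      unfolding sum_distrib_left by (rule sum.swap)
    also have "\<dots> \<le> (\<Sum>j<m. \<bar>x j\<bar> * 1)"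
      using W(3) by (intro sum_mono mult_left_mono) auto
    also have "\<dots> \<le> 1" using x(1) assms(4) by (simp add: cross_polytope_eq_l1_ball)
    finally show "z \<in> cross_polytope n"
      using assms(3) x(2) mat_apply_in_Rn[of n n T] by (simp add: cross_polytope_eq_l1_ball)
  qed
  moreover have "cross_polytope n \<subseteq> (\<lambda>x i. \<rho> * x i) ` (mat_apply n n T ` (mat_apply n m G ` cross_polytope m))"
  proof
    fix z assume "z \<in> cross_polytope n"
    then have z: "z \<in> Rn n" "(\<Sum>i<n. \<bar>z i\<bar>) \<le> 1" using assms(3) by (auto simp: cross_polytope_eq_l1_ball)
    define x where "x j = (if j < m then \<Sum>i<n. z i * Y (j, i) else 0)" for j
    have "(\<Sum>j<m. \<bar>x j\<bar>) \<le> (\<Sum>j<m. \<Sum>i<n. \<bar>z i\<bar> * \<bar>Y (j, i)\<bar>)"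
      by (intro sum_mono) (auto simp: x_def abs_mult intro!: order_trans[OF sum_abs] sum_mono)
    also have "\<dots> = (\<Sum>i<n. \<bar>z i\<bar> * (\<Sum>j<m. \<bar>Y (j, i)\<bar>))"
      unfolding sum_distrib_left by (rule sum.swap)
    also have "\<dots> \<le> (\<Sum>i<n. \<bar>z i\<bar> * 1)" using W(4) by (intro sum_mono mult_left_mono) auto
    finally have xc: "x \<in> cross_polytope m"
      using z(2) assms(4) by (simp add: cross_polytope_eq_l1_ball topspace_Euclidean_space x_def)
    have "z = (\<lambda>i. \<rho> * ?TG x i)"
    proof
      fix r
      show "z r = \<rho> * ?TG x r"
      proof (cases "r < n")
        case True
        have "?TG x r = (\<Sum>b<n. T (r, b) * (\<Sum>j<m. G (b, j) * (\<Sum>i<n. z i * Y (j, i))))"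
          using True by (simp add: mat_apply_def x_def)
        also have "\<dots> = (\<Sum>b<n. \<Sum>i<n. z i * (T (r, b) * (\<Sum>j<m. G (b, j) * Y (j, i))))"
        proof (rule sum.cong[OF refl])
          fix b
          have "(\<Sum>j<m. G (b, j) * (\<Sum>i<n. z i * Y (j, i))) = (\<Sum>i<n. \<Sum>j<m. z i * (G (b, j) * Y (j, i)))"
            unfolding sum_distrib_left by (subst sum.swap) (simp add: mult_ac)
          then show "T (r, b) * (\<Sum>j<m. G (b, j) * (\<Sum>i<n. z i * Y (j, i))) =
             (\<Sum>i<n. z i * (T (r, b) * (\<Sum>j<m. G (b, j) * Y (j, i))))"
            by (simp add: sum_distrib_left mult_ac)
        qed
        also have "\<dots> = (\<Sum>i<n. z i * (\<Sum>b<n. T (r, b) * (\<Sum>j<m. G (b, j) * Y (j, i))))"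
          unfolding sum_distrib_left[of "z _"] by (rule sum.swap)
        finally have TGx: "?TG x r = (\<Sum>i<n. z i * (\<Sum>b<n. T (r, b) * (\<Sum>j<m. G (b, j) * Y (j, i))))" .
        have pull: "\<rho> * (\<Sum>i<n. z i * A i) = (\<Sum>i<n. z i * (\<rho> * A i))" for A :: "nat \<Rightarrow> real"
          by (simp add: sum_distrib_left mult.left_commute)
        have "\<rho> * ?TG x r = (\<Sum>i<n. z i * (\<rho> * (\<Sum>b<n. T (r, b) * (\<Sum>j<m. G (b, j) * Y (j, i)))))"
          unfolding TGx by (rule pull)
        also have "\<dots> = (\<Sum>i<n. z i * unit_vec r i)"
          using W(5) True by (intro sum.cong) (auto simp: unit_vec_def)
        finally show ?thesis using True by (simp add: sum_unit_vec)
      next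
        case False
        then show ?thesis using z(1) by (simp add: mat_apply_def topspace_Euclidean_space)
      qed
    qed
    then show "z \<in> (\<lambda>x i. \<rho> * x i) ` (mat_apply n n T ` (mat_apply n m G ` cross_polytope m))"
      using xc by blast
  qed
  ultimately show ?thesis unfolding BM_dist_def using assms(2) by (intro Inf_lower) blast
qed

lemma witness_of_BM_dist_less:
  assumes "BM_dist n (mat_apply n m G ` cross_polytope m) (cross_polytope n) < ereal \<rho>" "n > 0" "m > 0"
  shows "\<exists>\<rho>' T S Y. 1 \<le> \<rho>' \<and> \<rho>' < \<rho> \<and> bm_witness n m \<rho>' G T S Y \<and> (\<forall>i j. \<bar>Y (j, i)\<bar> \<le> 1)"
proof -
  obtain \<rho>' T where \<rho>': "1 \<le> \<rho>'" "\<rho>' < \<rho>" and T: "T \<in> GL n"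
    "mat_apply n n T ` (mat_apply n m G ` cross_polytope m) \<subseteq> cross_polytope n"
    "cross_polytope n \<subseteq> (\<lambda>x i. \<rho>' * x i) ` (mat_apply n n T ` (mat_apply n m G ` cross_polytope m))"
    using assms(1) unfolding BM_dist_def Inf_less_iff by auto
  obtain S where S: "\<And>x. x \<in> Rn n \<Longrightarrow> mat_apply n n S (mat_apply n n T x) = x"
    "\<And>x. x \<in> Rn n \<Longrightarrow> mat_apply n n T (mat_apply n n S x) = x"
    using T(1) by (auto simp: GL_def)
  have "\<forall>i\<in>{..<n}. \<exists>y. y \<in> cross_polytope m \<and> unit_vec i = (\<lambda>r. \<rho>' * mat_apply n n T (mat_apply n m G y) r)"
    using T(3) unit_vec_in_cross_polytope by blast
  from bchoice[OF this] obtain y where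
    y: "\<And>i. i < n \<Longrightarrow> y i \<in> cross_polytope m" "\<And>i. i < n \<Longrightarrow> unit_vec i = (\<lambda>r. \<rho>' * mat_apply n n T (mat_apply n m G (y i)) r)"
    by auto
  \<comment> \<open>Zeros outside the range make all entries of \<open>Y\<close> at most 1 in
    modulus, for the compactness argument behind measurability.\<close>
  define Y where "Y = (\<lambda>(j, i). if i < n \<and> j < m then y i j else 0)"
  have y1: "(\<Sum>j<m. \<bar>y i j\<bar>) \<le> 1" if "i < n" for i
    using y(1)[OF that] assms(3) by (simp add: cross_polytope_eq_l1_ball)
  have "bm_witness n m \<rho>' G T S Y"
    unfolding bm_witness_def
  proof (intro conjI allI impI)
    fix i q assume "i < n" "q < n"
    then show "(\<Sum>r<n. S (i, r) * T (r, q)) = unit_vec q i"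
      using fun_cong[OF S(1)[OF unit_vec_in_Rn], of q i] by (simp add: mat_apply_unit_vec) (simp add: mat_apply_def)
    show "(\<Sum>r<n. T (i, r) * S (r, q)) = unit_vec q i"
      using \<open>i < n\<close> \<open>q < n\<close> fun_cong[OF S(2)[OF unit_vec_in_Rn], of q i] by (simp add: mat_apply_unit_vec) (simp add: mat_apply_def)
  next
    fix j assume j: "j < m"
    have "mat_apply n n T (mat_apply n m G (unit_vec j)) \<in> cross_polytope n"
      using T(2) unit_vec_in_cross_polytope[OF j] by blast
    then have "(\<Sum>i<n. \<bar>mat_apply n n T (mat_apply n m G (unit_vec j)) i\<bar>) \<le> 1"
      using assms(2) by (simp add: cross_polytope_eq_l1_ball)
    moreover have "mat_apply n n T (mat_apply n m G (unit_vec j)) i = (\<Sum>b<n. T (i, b) * G (b, j))" if "i < n" for i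
      using that j by (simp add: mat_apply_unit_vec) (simp add: mat_apply_def)
    ultimately show "(\<Sum>i<n. \<bar>\<Sum>b<n. T (i, b) * G (b, j)\<bar>) \<le> 1" by simp
  next
    fix i assume "i < n"
    then show "(\<Sum>j<m. \<bar>Y (j, i)\<bar>) \<le> 1" using y1 by (simp add: Y_def)
  next
    fix i r assume "i < n" "r < n"
    then show "\<rho>' * (\<Sum>b<n. T (r, b) * (\<Sum>j<m. G (b, j) * Y (j, i))) = unit_vec i r"
      using fun_cong[OF y(2), of i r] by (simp add: mat_apply_def Y_def)
  qed
  moreover have "\<bar>Y (j, i)\<bar> \<le> 1" for i j
  proof (cases "i < n \<and> j < m")
    case True
    then have "\<bar>y i j\<bar> \<le> (\<Sum>j<m. \<bar>y i j\<bar>)" by (intro member_le_sum) auto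
    then show ?thesis using y1[of i] True by (simp add: Y_def)
  next
    case False
    then show ?thesis by (auto simp: Y_def)
  qed
  ultimately show ?thesis using \<rho>' by blast
qed

lemma bm_witness_cong:
  assumes "\<And>i q. i < n \<Longrightarrow> q < n \<Longrightarrow> T (i, q) = T' (i, q)" "\<And>i q. i < n \<Longrightarrow> q < n \<Longrightarrow> S (i, q) = S' (i, q)"
    and "bm_witness n m \<rho> G T S Y"
  shows "bm_witness n m \<rho> G T' S' Y"
  using assms unfolding bm_witness_def by simp

text \<open>Shrinking \<open>Y\<close> by \<open>\<rho> / \<rho>'\<close> keeps its product with the
  distance parameter. A witness can thus be raised to one of countably many levels.\<close>

lemma bm_witness_mono:
  assumes "bm_witness n m \<rho> G T S Y" "0 < \<rho>" "\<rho> \<le> \<rho>'"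
  shows "bm_witness n m \<rho>' G T S (\<lambda>p. \<rho> / \<rho>' * Y p)"
proof -
  have "(\<Sum>j<m. \<bar>\<rho> / \<rho>' * Y (j, i)\<bar>) \<le> 1" if "(\<Sum>j<m. \<bar>Y (j, i)\<bar>) \<le> 1" for i
  proof -
    have "(\<Sum>j<m. \<bar>\<rho> / \<rho>' * Y (j, i)\<bar>) = \<rho> / \<rho>' * (\<Sum>j<m. \<bar>Y (j, i)\<bar>)"
      using assms(2,3) by (simp add: abs_mult sum_distrib_left)
    also have "\<dots> \<le> 1 * 1" using assms(2,3) that by (intro mult_mono) (auto intro: sum_nonneg)
    finally show ?thesis by simp
  qed
  moreover have "\<rho>' * (\<Sum>b<n. T (r, b) * (\<Sum>j<m. G (b, j) * (\<rho> / \<rho>' * Y (j, i)))) =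
     \<rho> * (\<Sum>b<n. T (r, b) * (\<Sum>j<m. G (b, j) * Y (j, i)))" for r i
  proof -
    have "(\<Sum>b<n. T (r, b) * (\<Sum>j<m. G (b, j) * (\<rho> / \<rho>' * Y (j, i)))) =
      \<rho> / \<rho>' * (\<Sum>b<n. T (r, b) * (\<Sum>j<m. G (b, j) * Y (j, i)))"
      unfolding sum_distrib_left by (intro sum.cong refl) (simp only: mult_ac)
    then show ?thesis using assms(2,3) by simp
  qed
  ultimately show ?thesis using assms(1) unfolding bm_witness_def by simp
qed

text \<open>The vectors \<open>\<rho>' \<Gamma> y\<^sub>i\<close> are mapped by \<open>T\<close> to
  the unit vectors, so they are the columns of the inverse \<open>S\<close>; the identity required
  by \<open>good_matrix_estimate\<close> is then \<open>S T = Id\<close>.\<close>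

theorem BM_dist_ge_of_good:
  assumes G: "G \<in> space (gaussian_matrix n m)" "G \<notin> l1_bad n m" "G \<notin> greedy_bad n m k \<rho> l \<tau>"
    and dims: "0 < l" "4 * l \<le> n" "n \<le> m" "0 < k" and \<rho>: "\<rho> > 0" and \<tau>: "\<tau> > 0"
    and big: "64 * (4 * real l / real n * (\<rho> * sqrt \<tau>) + 5 * \<rho> * sqrt (\<tau> / real k)) < 2 * real l"
  shows "ereal \<rho> \<le> BM_dist n (mat_apply n m G ` cross_polytope m) (cross_polytope n)"
proof (rule ccontr)
  have nm: "n > 0" "m > 0" using dims by auto
  assume "\<not> ?thesis"
  then obtain \<rho>' T S Y where W: "1 \<le> \<rho>'" "\<rho>' < \<rho>" "bm_witness n m \<rho>' G T S Y"
    using witness_of_BM_dist_less[OF _ nm, of G \<rho>] by (auto simp: not_le)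
  define a where "a i j = \<rho>' * Y (j, i)" for i j
  have Wd: "\<And>i q. i < n \<Longrightarrow> q < n \<Longrightarrow> (\<Sum>r<n. S (i, r) * T (r, q)) = unit_vec q i"
    "\<And>j. j < m \<Longrightarrow> (\<Sum>i<n. \<bar>\<Sum>b<n. T (i, b) * G (b, j)\<bar>) \<le> 1"
    "\<And>i. i < n \<Longrightarrow> (\<Sum>j<m. \<bar>Y (j, i)\<bar>) \<le> 1"
    "\<And>i r. i < n \<Longrightarrow> r < n \<Longrightarrow> \<rho>' * (\<Sum>b<n. T (r, b) * (\<Sum>j<m. G (b, j) * Y (j, i))) = unit_vec i r"
    using W(3) by (auto simp: bm_witness_def)
  have x: "mv m G (a i) r = S (r, i)" if ir: "i < n" "r < n" for i r
  proof -
    have "mat_apply n n S (mat_apply n n T (mat_apply n m G (a i))) = mat_apply n m G (a i)"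
      using mat_apply_inverse[OF Wd(1) mat_apply_in_Rn] .
    moreover have "mat_apply n n T (mat_apply n m G (a i)) = unit_vec i"
    proof
      fix q
      show "mat_apply n n T (mat_apply n m G (a i)) q = unit_vec i q"
      proof (cases "q < n")
        case True
        have "mat_apply n n T (mat_apply n m G (a i)) q = (\<Sum>b<n. T (q, b) * (\<Sum>j<m. G (b, j) * (\<rho>' * Y (j, i))))"
          using True by (simp add: mat_apply_def a_def)
        also have "\<dots> = \<rho>' * (\<Sum>b<n. T (q, b) * (\<Sum>j<m. G (b, j) * Y (j, i)))"
          unfolding sum_distrib_left by (intro sum.cong refl) (simp only: mult_ac)
        finally show ?thesis using Wd(4) ir True by simp
      next
        case False
        then show ?thesis using ir by (auto simp: mat_apply_def unit_vec_def)
      qed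
    qed
    ultimately have "mat_apply n m G (a i) = mat_apply n n S (unit_vec i)" by simp
    then have "mat_apply n m G (a i) r = S (r, i)" using ir by (simp add: mat_apply_unit_vec)
    then show ?thesis using ir by (simp add: mat_apply_eq_mv)
  qed
  have "2 * real l \<le> 64 * (4 * real l / real n * (\<rho> * sqrt \<tau>) + 5 * \<rho> * sqrt (\<tau> / real k))"
  proof (rule good_matrix_estimate[OF G dims \<rho> \<tau>, where a = a and T = "\<lambda>i b. T (i, b)"])
    fix i assume "i < n"
    have "(\<Sum>j<m. \<bar>a i j\<bar>) = \<rho>' * (\<Sum>j<m. \<bar>Y (j, i)\<bar>)"
      using W(1) by (simp add: a_def abs_mult sum_distrib_left)
    also have "\<dots> \<le> \<rho>' * 1" using W(1) Wd(3)[OF \<open>i < n\<close>] by (intro mult_left_mono) auto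
    finally show "(\<Sum>j<m. \<bar>a i j\<bar>) \<le> \<rho>" using W(2) by simp
  next
    fix j assume "j < m"
    then show "(\<Sum>i<n. \<bar>\<Sum>b<n. G (b, j) * T (i, b)\<bar>) \<le> 1" using Wd(2) by (simp add: mult.commute)
  next
    fix r q assume "r < n" "q < n"
    then show "(\<Sum>i<n. mv m G (a i) r * T (i, q)) = (if r = q then 1 else 0)"
      using Wd(1)[of r q] by (simp add: x unit_vec_def)
  qed
  then show False using big by simp
qed

section \<open>Measurability of the distance\<close>

text \<open>Projection along a compact factor is a closed map. This turns the existence of a bounded
  witness into a closed condition on the matrix.\<close>

lemma closed_projection:
  fixes S :: "'a::topological_space set" and T :: "('a \<times> 'b::topological_space) set"
  assumes "compact S" "closed T"
  shows "closed {y. \<exists>x\<in>S. (x, y) \<in> T}"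
proof -
  have "closed_map (prod_topology (top_of_set S) euclidean) (euclidean :: 'b topology) snd"
    using assms(1) by (intro Abstract_Topological_Spaces.closed_map_snd) (simp add: compact_space_subtopology)
  moreover have "closedin (prod_topology (top_of_set S) euclidean) ((S \<times> UNIV) \<inter> T)"
  proof -
    have "prod_topology (top_of_set S) (euclidean :: 'b topology) = top_of_set (S \<times> UNIV)"
      by (metis euclidean_product_topology prod_topology_subtopology(1) subtopology_UNIV prod_topology_subtopology_eu)
    then show ?thesis using assms(2) by (simp add: closedin_closed_Int)
  qed
  ultimately have "closedin (euclidean :: 'b topology) (snd ` ((S \<times> UNIV) \<inter> T))"
    by (simp add: closed_map_def)
  moreover have "snd ` ((S \<times> UNIV) \<inter> T) = {y. \<exists>x\<in>S. (x, y) \<in> T}" by force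
  ultimately show ?thesis unfolding closed_closedin by (simp only:)
qed

lemma compact_box: "compact {W :: 'i \<Rightarrow> real. \<forall>p. \<bar>W p\<bar> \<le> N}"
proof -
  have "{W :: 'i \<Rightarrow> real. \<forall>p. \<bar>W p\<bar> \<le> N} = PiE UNIV (\<lambda>_. {-N..N})"
    by (auto simp: PiE_def Pi_def abs_le_iff minus_le_iff)
  moreover have "compactin (product_topology (\<lambda>_. euclidean) UNIV) (PiE (UNIV :: 'i set) (\<lambda>_. {-N..N :: real}))"
    unfolding compactin_PiE by simp
  ultimately show ?thesis by (simp add: euclidean_product_topology)
qed

text \<open>Equations and weak inequalities between continuous functions of the entries.
  Invertibility of \<open>T\<close> alone is not a closed condition, which is why the witness
  carries the inverse. The first index of \<open>W\<close> packs the three matrices into one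
  function.\<close>

lemma closed_bm_witness:
  "closed {(W :: nat \<times> nat \<times> nat \<Rightarrow> real, G). bm_witness n m \<rho> G (\<lambda>p. W (0, p)) (\<lambda>p. W (1, p)) (\<lambda>p. W (2, p))}"
proof -
  have W: "continuous_on UNIV (\<lambda>x :: (nat \<times> nat \<times> nat \<Rightarrow> real) \<times> (nat \<times> nat \<Rightarrow> real). fst x p)" for p
    by (rule continuous_on_product_then_coordinatewise) (intro continuous_intros)
  have G: "continuous_on UNIV (\<lambda>x :: (nat \<times> nat \<times> nat \<Rightarrow> real) \<times> (nat \<times> nat \<Rightarrow> real). snd x p)" for p
    by (rule continuous_on_product_then_coordinatewise) (intro continuous_intros)
  show ?thesis
    unfolding bm_witness_def case_prod_unfold
    by (intro closed_Collect_conj closed_Collect_all closed_Collect_imp open_Collect_const closed_Collect_le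
        closed_Collect_eq continuous_intros W G)
qed

text \<open>A distance below \<open>\<rho>\<close> means a witness at some level
  \<open>\<rho> - 1 / (N + 1)\<close> with entries bounded by \<open>N\<close>. For each
  \<open>N\<close> such matrices form a closed set, so the event is the complement of a countable
  union of closed sets.\<close>

lemma sets_BM_dist_ge:
  assumes "n > 0" "m > 0"
  shows "{G \<in> space (gaussian_matrix n m). ereal \<rho> \<le> BM_dist n (mat_apply n m G ` cross_polytope m) (cross_polytope n)}
    \<in> sets (gaussian_matrix n m)"
proof -
  let ?M = "gaussian_matrix n m" and ?I = "{..<n} \<times> {..<m}"
  let ?d = "\<lambda>G. BM_dist n (mat_apply n m G ` cross_polytope m) (cross_polytope n)"
  define P where "P N = {G. \<exists>W\<in>{W. \<forall>p. \<bar>W p\<bar> \<le> real N}. (W, G) \<in>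
     {(W :: nat \<times> nat \<times> nat \<Rightarrow> real, G). bm_witness n m (\<rho> - 1 / real (Suc N)) G (\<lambda>p. W (0, p)) (\<lambda>p. W (1, p)) (\<lambda>p. W (2, p))}}" for N :: nat
  have "closed (P N)" for N
    unfolding P_def by (rule closed_projection[OF compact_box closed_bm_witness])
  then have Pb: "P N \<in> sets (Pi\<^sub>M UNIV (\<lambda>_. borel))" for N
    unfolding sets_PiM_equal_borel by (rule borel_closed)
  have id: "(\<lambda>G. G) \<in> measurable ?M (Pi\<^sub>M UNIV (\<lambda>_. borel))"
  proof (rule measurable_PiM_single')
    fix p :: "nat \<times> nat"
    show "(\<lambda>G. G p) \<in> borel_measurable ?M"
    proof (cases "p \<in> ?I")
      case True
      then show ?thesis unfolding gaussian_matrix_def by (rule measurable_gauss_component)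
    next
      case False
      \<comment> \<open>Points of the product space are \<open>undefined\<close> off the index set,
        so the remaining coordinates are constant.\<close>
      then have "G p = undefined" if "G \<in> space ?M" for G
        by (rule PiE_arb[OF that[unfolded gaussian_matrix_def space_PiM]])
      then show ?thesis by (subst measurable_cong[where g = "\<lambda>_. undefined"]) auto
    qed
  qed (auto simp: space_PiM)
  have lt: "?d G < ereal \<rho> \<longleftrightarrow> (\<exists>N. 1 \<le> \<rho> - 1 / real (Suc N) \<and> G \<in> P N)" for G
  proof
    assume "?d G < ereal \<rho>"
    from witness_of_BM_dist_less[OF this assms] obtain \<rho>' T S Y where
      W: "1 \<le> \<rho>'" "\<rho>' < \<rho>" "bm_witness n m \<rho>' G T S Y" "\<And>i j. \<bar>Y (j, i)\<bar> \<le> 1" by blast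
    \<comment> \<open>\<open>N\<close> must dominate the entries of \<open>T\<close> and
      \<open>S\<close>, and \<open>1 / (\<rho> - \<rho>')\<close> so that level \<open>N\<close> is
      not below \<open>\<rho>'\<close>; the last summand covers the entries of
      \<open>Y\<close>.\<close>
    define c where "c = (\<Sum>p\<in>{..<n} \<times> {..<n}. \<bar>T p\<bar> + \<bar>S p\<bar>) + 1 / (\<rho> - \<rho>') + 1"
    have s0: "0 \<le> (\<Sum>p\<in>{..<n} \<times> {..<n}. \<bar>T p\<bar> + \<bar>S p\<bar>)" by (intro sum_nonneg) auto
    obtain N where N: "c \<le> real N" using real_arch_simple by blast
    have "0 < 1 / (\<rho> - \<rho>')" using W(2) by simp
    then have N1: "1 \<le> real N" "1 / (\<rho> - \<rho>') \<le> real (Suc N)" using N s0 unfolding c_def by linarith+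
    then have "1 / real (Suc N) \<le> \<rho> - \<rho>'" using W(2) by (simp add: field_simps)
    then have \<rho>N: "\<rho>' \<le> \<rho> - 1 / real (Suc N)" by simp
    have TS: "\<bar>T p\<bar> \<le> real N" "\<bar>S p\<bar> \<le> real N" if "p \<in> {..<n} \<times> {..<n}" for p
    proof -
      have "\<bar>T p\<bar> + \<bar>S p\<bar> \<le> (\<Sum>p\<in>{..<n} \<times> {..<n}. \<bar>T p\<bar> + \<bar>S p\<bar>)"
        using that by (intro member_le_sum) auto
      also have "\<dots> \<le> c" using W(2) by (simp add: c_def)
      finally show "\<bar>T p\<bar> \<le> real N" "\<bar>S p\<bar> \<le> real N" using N by auto
    qed
    define V :: "nat \<times> nat \<times> nat \<Rightarrow> real" where "V = (\<lambda>(s, p). if s = 2 then \<rho>' / (\<rho> - 1 / real (Suc N)) * Y p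
      else if p \<in> {..<n} \<times> {..<n} then (if s = 0 then T p else S p) else 0)"
    have "bm_witness n m (\<rho> - 1 / real (Suc N)) G (\<lambda>p. V (0, p)) (\<lambda>p. V (1, p)) (\<lambda>p. V (2, p))"
    proof (rule bm_witness_cong[of n T _ S])
      show "bm_witness n m (\<rho> - 1 / real (Suc N)) G T S (\<lambda>p. V (2, p))"
        using bm_witness_mono[OF W(3) _ \<rho>N] W(1) by (simp add: V_def)
    qed (auto simp: V_def)
    moreover have "\<bar>V p\<bar> \<le> real N" for p
    proof -
      obtain s i j where p: "p = (s, j, i)" by (metis surj_pair)
      have "\<bar>\<rho>' / (\<rho> - 1 / real (Suc N)) * Y (j, i)\<bar> \<le> 1 * 1"
        unfolding abs_mult using W(1,4) \<rho>N by (intro mult_mono) auto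
      then show ?thesis using TS N1(1) by (auto simp: V_def p)
    qed
    ultimately have "G \<in> P N" by (auto simp: P_def)
    then show "\<exists>N. 1 \<le> \<rho> - 1 / real (Suc N) \<and> G \<in> P N" using \<rho>N W(1) by (intro exI[of _ N]) auto
  next
    assume "\<exists>N. 1 \<le> \<rho> - 1 / real (Suc N) \<and> G \<in> P N"
    then obtain N and W :: "nat \<times> nat \<times> nat \<Rightarrow> real" where N: "1 \<le> \<rho> - 1 / real (Suc N)"
      "bm_witness n m (\<rho> - 1 / real (Suc N)) G (\<lambda>p. W (0, p)) (\<lambda>p. W (1, p)) (\<lambda>p. W (2, p))" unfolding P_def by blast
    from BM_dist_le_of_witness[OF N(2,1) assms] have "?d G \<le> ereal (\<rho> - 1 / real (Suc N))" .
    also have "\<dots> < ereal \<rho>" by simp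
    finally show "?d G < ereal \<rho>" .
  qed
  have Pm: "(\<lambda>G. G) -` P N \<inter> space ?M \<in> sets ?M" for N
    by (rule measurable_sets[OF id Pb])
  have "{G \<in> space ?M. ereal \<rho> \<le> ?d G} = space ?M - (\<Union>N\<in>{N. 1 \<le> \<rho> - 1 / real (Suc N)}. (\<lambda>G. G) -` P N \<inter> space ?M)"
    using lt by (auto simp: not_le[symmetric])
  also have "\<dots> \<in> sets ?M"
    by (intro sets.compl_sets sets.countable_UN') (use Pm in auto)
  finally show ?thesis .
qed

section \<open>The random polytope is a symmetric convex body\<close>

lemma gram_schmidt_in_span: "\<exists>c. \<forall>b. gram_schmidt I g s b = (\<Sum>t\<le>s. c t * g t b)"
proof (induction s rule: less_induct)
  case (less s)
  then have "\<forall>t\<in>{..<s}. \<exists>c. \<forall>b. gram_schmidt I g t b = (\<Sum>u\<le>t. c u * g u b)" by blast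
  from bchoice[OF this] obtain c where c: "\<And>t b. t < s \<Longrightarrow> gram_schmidt I g t b = (\<Sum>u\<le>t. c t u * g u b)" by auto
  define r where "r t = ip I (g s) (gram_schmidt I g t) / sq_norm I (gram_schmidt I g t)" for t
  define c' where "c' u = (if u = s then 1 else - (\<Sum>t<s. if u \<le> t then r t * c t u else 0))" for u
  have "gram_schmidt I g s b = (\<Sum>u\<le>s. c' u * g u b)" for b
  proof -
    have "gram_schmidt I g s b = g s b - (\<Sum>t<s. r t * (\<Sum>u\<le>t. c t u * g u b))"
      using c by (subst gram_schmidt.simps) (simp add: r_def)
    also have "(\<Sum>t<s. r t * (\<Sum>u\<le>t. c t u * g u b)) = (\<Sum>t<s. \<Sum>u<s. if u \<le> t then r t * c t u * g u b else 0)"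
    proof (rule sum.cong[OF refl])
      fix t assume "t \<in> {..<s}"
      then have "(\<Sum>u<s. if u \<le> t then r t * c t u * g u b else 0) = (\<Sum>u\<in>{u\<in>{..<s}. u \<le> t}. r t * c t u * g u b)"
        by (subst sum.inter_filter) auto
      also have "{u\<in>{..<s}. u \<le> t} = {..t}" using \<open>t \<in> {..<s}\<close> by auto
      finally show "r t * (\<Sum>u\<le>t. c t u * g u b) = (\<Sum>u<s. if u \<le> t then r t * c t u * g u b else 0)"
        by (simp add: sum_distrib_left mult.assoc)
    qed
    also have "\<dots> = (\<Sum>u<s. \<Sum>t<s. if u \<le> t then r t * c t u * g u b else 0)" by (rule sum.swap)
    also have "\<dots> = (\<Sum>u<s. - c' u * g u b)"
      by (intro sum.cong refl) (simp add: c'_def sum_distrib_right if_distrib[of "\<lambda>x. x * _"] cong: if_cong)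
    finally show ?thesis
      by (simp add: sum_negf c'_def lessThan_Suc_atMost[symmetric])
  qed
  then show ?case by blast
qed

lemma gs_residual_in_span: "\<exists>a. \<forall>b. y b - gs_residual I g q y b = (\<Sum>t<q. a t * g t b)"
proof -
  have "\<forall>s. \<exists>c. \<forall>b. gram_schmidt I g s b = (\<Sum>t\<le>s. c t * g t b)" using gram_schmidt_in_span by blast
  from choice[OF this] obtain c where c: "\<And>s b. gram_schmidt I g s b = (\<Sum>t\<le>s. c s t * g t b)" by auto
  define r where "r s = ip I y (gram_schmidt I g s) / sq_norm I (gram_schmidt I g s)" for s
  have "y b - gs_residual I g q y b = (\<Sum>t<q. (\<Sum>s<q. if t \<le> s then r s * c s t else 0) * g t b)" for b
  proof -
    have "y b - gs_residual I g q y b = (\<Sum>s<q. r s * (\<Sum>t\<le>s. c s t * g t b))"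
      using c by (simp add: gs_residual_def r_def)
    also have "\<dots> = (\<Sum>s<q. \<Sum>t<q. if t \<le> s then r s * c s t * g t b else 0)"
    proof (rule sum.cong[OF refl])
      fix s assume "s \<in> {..<q}"
      then have "(\<Sum>t<q. if t \<le> s then r s * c s t * g t b else 0) = (\<Sum>t\<in>{t\<in>{..<q}. t \<le> s}. r s * c s t * g t b)"
        by (subst sum.inter_filter) auto
      also have "{t\<in>{..<q}. t \<le> s} = {..s}" using \<open>s \<in> {..<q}\<close> by auto
      finally show "r s * (\<Sum>t\<le>s. c s t * g t b) = (\<Sum>t<q. if t \<le> s then r s * c s t * g t b else 0)"
        by (simp add: sum_distrib_left mult.assoc)
    qed
    also have "\<dots> = (\<Sum>t<q. \<Sum>s<q. if t \<le> s then r s * c s t * g t b else 0)" by (rule sum.swap)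
    also have "\<dots> = (\<Sum>t<q. (\<Sum>s<q. if t \<le> s then r s * c s t else 0) * g t b)"
      by (intro sum.cong refl) (simp add: sum_distrib_right if_distrib[of "\<lambda>x. x * _"] cong: if_cong)
    finally show ?thesis .
  qed
  then show ?thesis by (intro exI[of _ "\<lambda>t. \<Sum>s<q. if t \<le> s then r s * c s t else 0"] allI)
qed

text \<open>The residual of \<open>y\<close> against all columns is orthogonal to each of them, so
  its l1 image is 0 and the lower bound forces it to vanish. For \<open>m > n\<close> some
  Gram-Schmidt vectors are 0 here, which the convention \<open>x / 0 = 0\<close> absorbs.\<close>

lemma good_matrix_surj:
  assumes G: "G \<in> space (gaussian_matrix n m)" "G \<notin> l1_bad n m" and "n > 0" "m > 0"
  shows "\<exists>a. \<forall>b<n. mv m G a b = y b"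
proof -
  let ?g = "\<lambda>j b. G (b, j)"
  let ?r = "gs_residual {..<n} ?g m y"
  have orth: "ip {..<n} ?r (?g j) = 0" if "j < m" for j
  proof -
    have "?g j = (\<lambda>b. gram_schmidt {..<n} ?g j b + (\<Sum>s<j. ip {..<n} (?g j) (gram_schmidt {..<n} ?g s) /
        sq_norm {..<n} (gram_schmidt {..<n} ?g s) * gram_schmidt {..<n} ?g s b))"
      by (subst gram_schmidt.simps) simp
    then have "ip {..<n} ?r (?g j) = ip {..<n} ?r (\<lambda>b. gram_schmidt {..<n} ?g j b + (\<Sum>s<j. ip {..<n} (?g j) (gram_schmidt {..<n} ?g s) /
        sq_norm {..<n} (gram_schmidt {..<n} ?g s) * gram_schmidt {..<n} ?g s b))"
      by (rule arg_cong)
    also have "\<dots> = 0"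
      using gs_residual_orth[of "{..<n}" _ m ?g y] that
      by (simp add: ip_add_right ip_sum_right ip_scale_right del: times_divide_eq_left)
    finally show ?thesis .
  qed
  have "l1_image n m G ?r = 0"
    unfolding l1_image_def using orth by (intro sum.neutral) (auto simp: ip_def mult.commute)
  then have "real m / 64 * sqrt (sq_norm {..<n} ?r) \<le> 0" using l1_image_lower[OF G assms(3), of ?r] by simp
  then have "sq_norm {..<n} ?r = 0"
    using assms(4) ip_self_nonneg[of "{..<n}" ?r] by (auto simp: mult_le_0_iff intro: antisym)
  then have r0: "?r b = 0" if "b < n" for b using that by (simp add: ip_self_eq_0)
  obtain a where a: "\<And>b. y b - ?r b = (\<Sum>t<m. a t * G (b, t))" using gs_residual_in_span[of y "{..<n}" ?g m] by auto
  then have "mv m G a b = y b" if "b < n" for b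
    using a[of b] r0[OF that] by (simp add: mv_def mult.commute)
  then show ?thesis by blast
qed

lemma continuous_on_mat_apply: "continuous_on UNIV (mat_apply n m G)"
proof (rule continuous_on_coordinatewise_then_product)
  fix i
  have "continuous_on UNIV (\<lambda>x :: nat \<Rightarrow> real. \<Sum>j<m. G (i, j) * x j)"
    by (intro continuous_intros continuous_on_product_coordinates)
  then show "continuous_on UNIV (\<lambda>x. mat_apply n m G x i)"
    by (cases "i < n") (simp_all add: mat_apply_def)
qed

lemma compact_cross_polytope:
  assumes "m > 0" shows "compact (cross_polytope m)"
proof -
  let ?C = "{x :: nat \<Rightarrow> real. (\<forall>i\<ge>m. x i = 0) \<and> (\<Sum>i<m. \<bar>x i\<bar>) \<le> 1}"
  have eq: "cross_polytope m = {x. \<forall>p. \<bar>x p\<bar> \<le> 1} \<inter> ?C"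
  proof -
    have "\<bar>x p\<bar> \<le> 1" if "\<forall>i\<ge>m. x i = 0" "(\<Sum>i<m. \<bar>x i\<bar>) \<le> 1" for x :: "nat \<Rightarrow> real" and p
    proof (cases "p < m")
      case True
      then have "\<bar>x p\<bar> \<le> (\<Sum>i<m. \<bar>x i\<bar>)" by (intro member_le_sum) auto
      then show ?thesis using that by simp
    qed (use that in auto)
    then show ?thesis by (auto simp: cross_polytope_eq_l1_ball[OF assms] topspace_Euclidean_space)
  qed
  have "closed ?C"
    by (intro closed_Collect_conj closed_Collect_all closed_Collect_imp open_Collect_const closed_Collect_le
        closed_Collect_eq continuous_intros continuous_on_product_coordinates)
  then show ?thesis unfolding eq by (intro compact_Int_closed compact_box)
qed

lemma convex_fun_mat_image:
  assumes "m > 0"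
  shows "convex_fun (mat_apply n m G ` cross_polytope m)"
  unfolding convex_fun_def
proof (intro ballI allI impI)
  fix x y and u v :: real
  assume xy: "x \<in> mat_apply n m G ` cross_polytope m" "y \<in> mat_apply n m G ` cross_polytope m"
    and uv: "0 \<le> u" "0 \<le> v" "u + v = 1"
  obtain x' y' where x': "x = mat_apply n m G x'" "y = mat_apply n m G y'" "x' \<in> cross_polytope m" "y' \<in> cross_polytope m"
    using xy by blast
  have "(\<Sum>i<m. \<bar>u * x' i + v * y' i\<bar>) \<le> (\<Sum>i<m. u * \<bar>x' i\<bar> + v * \<bar>y' i\<bar>)"
    using uv by (intro sum_mono) (metis abs_mult abs_of_nonneg abs_triangle_ineq)
  also have "\<dots> = u * (\<Sum>i<m. \<bar>x' i\<bar>) + v * (\<Sum>i<m. \<bar>y' i\<bar>)" by (simp add: sum.distrib sum_distrib_left)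
  also have "\<dots> \<le> 1"
    using x'(3,4) uv assms by (intro convex_bound_le) (auto simp: cross_polytope_eq_l1_ball)
  finally have "(\<lambda>i. u * x' i + v * y' i) \<in> cross_polytope m"
    using x'(3,4) assms by (auto simp: cross_polytope_eq_l1_ball topspace_Euclidean_space)
  moreover have "(\<lambda>i. u * x i + v * y i) = mat_apply n m G (\<lambda>i. u * x' i + v * y' i)"
    by (auto simp: x' mat_apply_def algebra_simps sum.distrib sum_distrib_left fun_eq_iff)
  ultimately show "(\<lambda>i. u * x i + v * y i) \<in> mat_apply n m G ` cross_polytope m" by blast
qed

text \<open>The interior comes from surjectivity: with preimages \<open>a i\<close> of the unit
  vectors, every point of a box of radius \<open>1 / A\<close> around 0 is the image of a
  combination of the \<open>a i\<close> of l1 norm at most 1.\<close>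

theorem sym_convex_body_of_good:
  assumes G: "G \<in> space (gaussian_matrix n m)" "G \<notin> l1_bad n m" and "n > 0" "m > 0"
  shows "sym_convex_body n (mat_apply n m G ` cross_polytope m)"
proof -
  let ?K = "mat_apply n m G ` cross_polytope m"
  have "compact ?K"
    by (rule compact_continuous_image[OF continuous_on_subset[OF continuous_on_mat_apply] compact_cross_polytope]) (use assms in auto)
  then have "compactin (Euclidean_space n) ?K"
    using mat_apply_in_Rn[of n m G] unfolding Euclidean_space_def compactin_subtopology
    by (auto simp: euclidean_product_topology topspace_Euclidean_space)
  moreover have "(\<lambda>i. - x i) \<in> ?K" if "x \<in> ?K" for x
  proof -
    obtain x' where x': "x = mat_apply n m G x'" "x' \<in> cross_polytope m" using \<open>x \<in> ?K\<close> by blast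
    have "(\<lambda>i. - x' i) \<in> cross_polytope m"
      using x'(2) assms(4) by (simp add: cross_polytope_eq_l1_ball topspace_Euclidean_space)
    moreover have "(\<lambda>i. - x i) = mat_apply n m G (\<lambda>i. - x' i)"
      using mat_apply_scale[of n m G "-1" x'] by (simp add: x')
    ultimately show ?thesis by blast
  qed
  moreover have "Euclidean_space n interior_of ?K \<noteq> {}"
  proof -
    have "\<forall>i. \<exists>a. \<forall>b<n. mv m G a b = unit_vec i b" using good_matrix_surj[OF assms] by blast
    from choice[OF this] obtain a where a: "\<And>i b. b < n \<Longrightarrow> mv m G (a i) b = unit_vec i b" by auto
    define A where "A = 1 + (\<Sum>i<n. \<Sum>j<m. \<bar>a i j\<bar>)"
    have A0: "0 < A" by (simp add: A_def add_pos_nonneg sum_nonneg)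
    define U where "U = {x :: nat \<Rightarrow> real. \<forall>i<n. \<bar>x i\<bar> < 1 / A}"
    have "open U"
    proof -
      have "U = (\<Inter>i\<in>{..<n}. {x. \<bar>x i\<bar> < 1 / A})" by (auto simp: U_def)
      then show ?thesis
        by (auto intro!: open_INT open_Collect_less continuous_intros continuous_on_product_coordinates)
    qed
    then have "openin (Euclidean_space n) (U \<inter> Rn n)"
      unfolding Euclidean_space_def by (auto simp: euclidean_product_topology openin_subtopology)
    moreover have "U \<inter> Rn n \<subseteq> ?K"
    proof
      fix x assume x: "x \<in> U \<inter> Rn n"
      define w where "w j = (if j < m then \<Sum>i<n. x i * a i j else 0)" for j
      have "(\<Sum>j<m. \<bar>w j\<bar>) \<le> (\<Sum>j<m. \<Sum>i<n. \<bar>x i\<bar> * \<bar>a i j\<bar>)"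
        by (intro sum_mono) (auto simp: w_def abs_mult intro!: order_trans[OF sum_abs] sum_mono)
      also have "\<dots> \<le> (\<Sum>j<m. \<Sum>i<n. 1 / A * \<bar>a i j\<bar>)"
        using x by (intro sum_mono mult_right_mono) (auto simp: U_def intro: less_imp_le)
      also have "\<dots> = 1 / A * (\<Sum>i<n. \<Sum>j<m. \<bar>a i j\<bar>)"
        by (subst sum.swap) (simp add: sum_distrib_left sum_divide_distrib)
      also have "\<dots> \<le> 1 / A * A" using A0 by (intro mult_left_mono) (auto simp: A_def)
      finally have "w \<in> cross_polytope m"
        using A0 assms(4) by (simp add: cross_polytope_eq_l1_ball topspace_Euclidean_space w_def)
      moreover have "x = mat_apply n m G w"
      proof
        fix b
        show "x b = mat_apply n m G w b"
        proof (cases "b < n")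
          case True
          have "mat_apply n m G w b = mv m G (\<lambda>j. \<Sum>i<n. x i * a i j) b"
            using True mv_cong[of m w "\<lambda>j. \<Sum>i<n. x i * a i j" G] by (simp add: mat_apply_eq_mv w_def)
          also have "\<dots> = (\<Sum>i<n. x i * unit_vec i b)"
            using a[OF True] by (simp add: mv_sum mv_scale)
          also have "\<dots> = (\<Sum>i<n. x i * unit_vec b i)" by (intro sum.cong) (auto simp: unit_vec_def)
          finally show ?thesis using True by (simp add: sum_unit_vec)
        next
          case False
          then show ?thesis using x by (simp add: mat_apply_def topspace_Euclidean_space)
        qed
      qed
      ultimately show "x \<in> ?K" by blast
    qed
    ultimately have "U \<inter> Rn n \<subseteq> Euclidean_space n interior_of ?K" by (rule interior_of_maximal[rotated])
    moreover have "(\<lambda>_. 0) \<in> U \<inter> Rn n" using A0 by (simp add: U_def topspace_Euclidean_space)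
    ultimately show ?thesis by blast
  qed
  ultimately show ?thesis using convex_fun_mat_image[OF assms(4)] unfolding sym_convex_body_def by blast
qed

section \<open>Choice of parameters\<close>

definition dim_gap :: "nat \<Rightarrow> nat" where
  "dim_gap n = nat \<lceil>real n powr (3 / 4) * sqrt (ln (real n))\<rceil>"

definition sparsity :: "nat \<Rightarrow> nat" where
  "sparsity n = nat \<lceil>sqrt (real n)\<rceil>"

lemma nat_ceiling_bounds:
  fixes x :: real
  assumes "1 \<le> x"
  shows "x \<le> real (nat \<lceil>x\<rceil>)" "real (nat \<lceil>x\<rceil>) \<le> 2 * x"
proof -
  have "real (nat \<lceil>x\<rceil>) = of_int \<lceil>x\<rceil>" using assms by simp
  then show "x \<le> real (nat \<lceil>x\<rceil>)" "real (nat \<lceil>x\<rceil>) \<le> 2 * x" using assms by linarith+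
qed

text \<open>The factor 8 leads to \<open>4 * l \<le> n\<close>, because rounding up at most doubles
  a number that is at least 1.\<close>

lemma eventually_dims:
  "\<forall>\<^sub>F n in sequentially. 3 \<le> n \<and> 1 \<le> ln (real n) \<and>
     1 \<le> real n powr (3 / 4) * sqrt (ln (real n)) \<and> 8 * (real n powr (3 / 4) * sqrt (ln (real n))) \<le> real n \<and>
     ln (2 * real n ^ 3 + 1) \<le> 4 * ln (real n) \<and> sqrt (ln (real n)) \<le> real n powr (3 / 4)"
proof (intro eventually_conj)
  show "\<forall>\<^sub>F n :: nat in sequentially. 3 \<le> n" by (rule eventually_ge_at_top)
qed real_asymp+

text \<open>The net contributes \<open>exp (O (n ln n))\<close>, negligible against
  \<open>(6 / 5) ^ (n ^ 3)\<close>.\<close>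

lemma eventually_l1_bad_small:
  "\<forall>\<^sub>F n in sequentially. (3 / 4) ^ (n * n ^ 3) + (256 * real n + 1) ^ n * (5 / 6) ^ (n ^ 3) \<le> 1 / real n"
proof -
  have "\<forall>\<^sub>F n in sequentially. (3 / 4) powr (real n ^ 4) + (256 * real n + 1) powr (real n) * (5 / 6) powr (real n ^ 3) \<le> 1 / real n"
    by real_asymp
  then show ?thesis
  proof eventually_elim
    case (elim n)
    have "(3 / 4 :: real) powr (real n ^ 4) = (3 / 4) ^ (n * n ^ 3)"
      using powr_realpow[of "3 / 4" "n * n ^ 3"] by (simp add: power4_eq_xxxx power3_eq_cube mult.assoc)
    moreover have "(5 / 6 :: real) powr (real n ^ 3) = (5 / 6) ^ (n ^ 3)"
      using powr_realpow[of "5 / 6" "n ^ 3"] by simp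
    moreover have "(256 * real n + 1) powr (real n) = (256 * real n + 1) ^ n"
      by (rule powr_realpow) (simp add: add_nonneg_pos)
    ultimately show ?case using elim by simp
  qed
qed

text \<open>All exponents are compared with \<open>X = n^(3/2) ln n\<close>, which is at most
  \<open>l^2\<close>. The counting factors contribute at most \<open>26 * X\<close>, the failure
  probability \<open>- 37 * l^2\<close>: 40 from \<open>\<tau> / 4\<close>, less 3 because
  \<open>4 \<le> exp 3\<close>. The remaining \<open>11 * X\<close> covers the factor
  \<open>1 / n\<close>.\<close>

lemma greedy_bad_small:
  assumes "3 \<le> n" and L: "1 \<le> ln (real n)"
    and l: "real n powr (3 / 4) * sqrt (ln (real n)) \<le> real l" "real l \<le> 2 * (real n powr (3 / 4) * sqrt (ln (real n)))"
    and k: "real k \<le> 2 * sqrt (real n)" and ln: "4 * l \<le> n" "0 < l"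
    and lm: "ln (2 * real n ^ 3 + 1) \<le> 4 * ln (real n)" "sqrt (ln (real n)) \<le> real n powr (3 / 4)"
  shows "2 * real l * (2 ^ n * (2 * real (n ^ 3) + 1) ^ (2 * k * n) * (real (n ^ 3) * real n) ^ l) *
     (4 ^ l * exp (- (160 * real l) / 4)) ^ l \<le> 1 / real n"
proof -
  define x where "x = real n"
  define L where "L = ln x"
  define X where "X = x powr (3 / 2) * L"
  have x3: "3 \<le> x" and L1: "1 \<le> L" using assms(1) L by (auto simp: x_def L_def)
  have xx: "x powr (3 / 2) = sqrt x * x"
  proof -
    have "x powr (3 / 2) = x powr (1 / 2) * x powr 1" by (subst powr_add[symmetric]) simp
    then show ?thesis using x3 by (simp add: powr_half_sqrt)
  qed
  have s1: "1 \<le> sqrt x" using x3 by simp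
  have xX: "x \<le> X"
  proof -
    have "1 * x * 1 \<le> sqrt x * x * L" using s1 x3 L1 by (intro mult_mono) auto
    then show ?thesis by (simp add: X_def xx)
  qed
  have LX: "L \<le> X"
  proof -
    have "1 * 1 * L \<le> sqrt x * x * L" using s1 x3 L1 by (intro mult_mono) auto
    then show ?thesis by (simp add: X_def xx)
  qed
  have l2: "X \<le> (real l)\<^sup>2"
  proof -
    have "(x powr (3 / 4) * sqrt L)\<^sup>2 \<le> (real l)\<^sup>2"
      using l(1) L1 by (intro power_mono) (auto simp: x_def L_def)
    moreover have "(x powr (3 / 4) * sqrt L)\<^sup>2 = X"
    proof -
      have "(x powr (3 / 4))\<^sup>2 = x powr (3 / 2)" by (simp add: power2_eq_square flip: powr_add)
      then show ?thesis using L1 by (simp add: power_mult_distrib X_def)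
    qed
    ultimately show ?thesis by simp
  qed
  have lL: "real l * L \<le> 2 * X"
  proof -
    have "real l \<le> 2 * (x powr (3 / 4) * x powr (3 / 4))"
      using l(2) lm(2) by (simp add: x_def) (meson mult_left_mono order_trans powr_ge_zero zero_le_numeral mult_left_mono)
    also have "x powr (3 / 4) * x powr (3 / 4) = x powr (3 / 2)" by (simp flip: powr_add)
    finally have "real l * L \<le> (2 * x powr (3 / 2)) * L" using L1 by (intro mult_right_mono) auto
    then show ?thesis by (simp add: X_def)
  qed
  have kn: "2 * real k * x * (4 * L) \<le> 16 * X"
  proof -
    have "2 * real k * x * (4 * L) \<le> 2 * (2 * sqrt x) * x * (4 * L)"
      using k x3 L1 by (intro mult_right_mono mult_left_mono) (auto simp: x_def)
    then show ?thesis by (simp add: X_def xx)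
  qed
  have e1: "2 * real l \<le> exp L"
  proof -
    have "real (4 * l) \<le> real n" using ln(1) by (rule of_nat_mono)
    then have "2 * real l \<le> x" by (simp add: x_def)
    then show ?thesis using x3 by (simp add: L_def)
  qed
  have e2: "(2 :: real) ^ n \<le> exp x"
  proof -
    have "(2 :: real) ^ n \<le> exp 1 ^ n" using exp_ge_add_one_self[of 1] by (intro power_mono) auto
    then show ?thesis by (simp add: x_def flip: exp_of_nat_mult)
  qed
  have e3: "(2 * real (n ^ 3) + 1) ^ (2 * k * n) \<le> exp (2 * real k * x * (4 * L))"
  proof -
    have pos: "0 < 2 * real n ^ 3 + 1" by (simp add: add_nonneg_pos)
    have "2 * real (n ^ 3) + 1 = exp (ln (2 * real n ^ 3 + 1))" using pos by simp
    also have "\<dots> \<le> exp (4 * L)" using lm(1) by (simp add: L_def x_def)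
    finally have "(2 * real (n ^ 3) + 1) ^ (2 * k * n) \<le> exp (4 * L) ^ (2 * k * n)" by (intro power_mono) auto
    then show ?thesis by (simp add: x_def flip: exp_of_nat_mult)
  qed
  have e4: "(real (n ^ 3) * real n) ^ l = exp (4 * (real l * L))"
  proof -
    have "real (n ^ 3) * real n = exp L ^ 4" using x3 by (simp add: L_def x_def power4_eq_xxxx power3_eq_cube)
    then show ?thesis by (simp add: mult.left_commute flip: exp_of_nat_mult power_mult)
  qed
  have e5: "(4 ^ l * exp (- (160 * real l) / 4)) ^ l \<le> exp (- 37 * (real l)\<^sup>2)"
  proof -
    have "(4 :: real) \<le> exp 3" using exp_ge_add_one_self[of 3] by simp
    then have "(4 :: real) ^ l \<le> exp 3 ^ l" by (intro power_mono) auto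
    then have "4 ^ l * exp (- (160 * real l) / 4) \<le> exp (real l * 3) * exp (- (160 * real l) / 4)"
      by (intro mult_right_mono) (auto simp: exp_of_nat_mult)
    also have "\<dots> = exp (- 37 * real l)" by (simp flip: exp_add)
    finally have "(4 ^ l * exp (- (160 * real l) / 4)) ^ l \<le> exp (- 37 * real l) ^ l" by (intro power_mono) auto
    also have "\<dots> = exp (- 37 * (real l)\<^sup>2)" by (simp add: power2_eq_square mult.left_commute flip: exp_of_nat_mult)
    finally show ?thesis .
  qed
  have "2 * real l * (2 ^ n * (2 * real (n ^ 3) + 1) ^ (2 * k * n) * (real (n ^ 3) * real n) ^ l) *
     (4 ^ l * exp (- (160 * real l) / 4)) ^ l
     \<le> exp L * (exp x * exp (2 * real k * x * (4 * L)) * exp (4 * (real l * L))) * exp (- 37 * (real l)\<^sup>2)"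
    using e1 e2 e3 e4 e5 by (intro mult_mono) auto
  also have "\<dots> = exp (L + x + 2 * real k * x * (4 * L) + 4 * (real l * L) - 37 * (real l)\<^sup>2)"
    by (simp add: algebra_simps flip: exp_add)
  also have "\<dots> \<le> exp (- L)"
  proof (subst exp_le_cancel_iff)
    have "L + x + 2 * real k * x * (4 * L) + 4 * (real l * L) \<le> X + X + 16 * X + 8 * X"
      using LX xX kn lL by linarith
    moreover have "37 * X \<le> 37 * (real l)\<^sup>2" using l2 by simp
    moreover have "0 \<le> X" using xX x3 by simp
    ultimately show "L + x + 2 * real k * x * (4 * L) + 4 * (real l * L) - 37 * (real l)\<^sup>2 \<le> - L" using LX by linarith
  qed
  also have "\<dots> = 1 / real n" using x3 by (simp add: L_def x_def exp_minus inverse_eq_divide)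
  finally show ?thesis .
qed

text \<open>\<open>sqrt 160\<close> cancels the constant of \<open>\<tau> = 160 * l\<close>; the
  1000 brings the final estimate to \<open>64 * 13 / 1000 * l\<close>, below
  \<open>2 * l\<close>.\<close>

definition bm_const :: real where "bm_const = 1 / (1000 * sqrt 160)"

abbreviation bm_bound :: "nat \<Rightarrow> real" where
  "bm_bound n \<equiv> bm_const * real n powr (5 / 8) * ln (real n) powr (- (1 / 4))"

lemma bm_const_pos: "bm_const > 0"
  by (simp add: bm_const_def)

text \<open>In \<open>\<rho> * sqrt \<tau>\<close> the powers of \<open>ln n\<close> cancel and
  those of \<open>n\<close> multiply to \<open>n\<close>, up to a constant: the first summand
  dictates the shape of \<open>bm_bound\<close>. The second has a factor \<open>sqrt (ln n)\<close>
  to spare.\<close>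

lemma estimate_small:
  assumes "3 \<le> n" and L: "1 \<le> ln (real n)"
    and l: "real n powr (3 / 4) * sqrt (ln (real n)) \<le> real l" "real l \<le> 2 * (real n powr (3 / 4) * sqrt (ln (real n)))"
    and k: "sqrt (real n) \<le> real k"
  defines "\<rho> \<equiv> bm_bound n" and "\<tau> \<equiv> 160 * real l"
  shows "64 * (4 * real l / real n * (\<rho> * sqrt \<tau>) + 5 * \<rho> * sqrt (\<tau> / real k)) < 2 * real l"
proof -
  define x where "x = real n"
  define L where "L = ln x"
  have x3: "3 \<le> x" and L1: "1 \<le> L" using assms(1) L by (auto simp: x_def L_def)
  have l0: "0 < real l"
  proof -
    have "0 < x powr (3 / 4) * sqrt L" using x3 L1 by simp
    then show ?thesis using l(1) by (simp add: x_def L_def)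
  qed
  have "0 < sqrt (real n)" using assms(1) by simp
  then have k0: "0 < real k" using k by linarith
  have \<rho>: "\<rho> = bm_const * (x powr (5 / 8) * L powr (- (1 / 4)))" by (simp add: \<rho>_def x_def L_def)
  have \<rho>0: "0 < \<rho>" using x3 L1 bm_const_pos by (simp add: \<rho>)
  have c: "bm_const * sqrt 160 = 1 / 1000" by (simp add: bm_const_def)
  have A: "\<rho> * sqrt \<tau> \<le> 2 / 1000 * x"
  proof -
    have "sqrt (real l) \<le> sqrt (2 * (x powr (3 / 4) * sqrt L))" using l(2) by (simp add: x_def L_def)
    also have "\<dots> = sqrt 2 * (x powr (3 / 8) * L powr (1 / 4))"
      using x3 L1 by (simp add: real_sqrt_mult powr_half_sqrt[symmetric] powr_powr)
    finally have "\<rho> * sqrt \<tau> \<le> \<rho> * (sqrt 160 * (sqrt 2 * (x powr (3 / 8) * L powr (1 / 4))))"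
      using \<rho>0 by (simp add: \<tau>_def real_sqrt_mult)
    also have "\<dots> = (bm_const * sqrt 160) * sqrt 2 * ((x powr (5 / 8) * x powr (3 / 8)) * (L powr (- (1 / 4)) * L powr (1 / 4)))"
      by (simp add: \<rho>)
    also have "\<dots> = 1 / 1000 * sqrt 2 * x" using x3 L1 by (simp add: c flip: powr_add)
    also have "\<dots> \<le> 2 / 1000 * x"
    proof -
      have "sqrt 2 \<le> (2 :: real)" by (rule real_le_lsqrt) auto
      then show ?thesis using x3 by (simp add: mult_right_mono)
    qed
    finally show ?thesis .
  qed
  have B: "\<rho> * sqrt (\<tau> / real k) \<le> 1 / 1000 * real l"
  proof -
    have "\<rho> * sqrt (\<tau> / real k) = \<rho> * (sqrt 160 * (sqrt (real l) / sqrt (real k)))"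
      by (simp add: \<tau>_def real_sqrt_mult real_sqrt_divide)
    also have "\<dots> = 1 / 1000 * ((x powr (5 / 8) * L powr (- (1 / 4))) * (sqrt (real l) / sqrt (real k)))"
      unfolding c[symmetric] by (simp add: \<rho>)
    also have "\<dots> \<le> 1 / 1000 * ((sqrt (real l) * sqrt (real k)) * (sqrt (real l) / sqrt (real k)))"
    proof (intro mult_left_mono mult_right_mono)
      \<comment> \<open>The spare \<open>sqrt L\<close> is given away to reach exactly the root of
        the product of the lower bounds for \<open>l\<close> and \<open>k\<close>.\<close>
      have "x powr (5 / 8) * L powr (- (1 / 4)) \<le> x powr (5 / 8) * L powr (1 / 4)"
        using x3 L1 by (intro mult_left_mono powr_mono) auto
      also have "\<dots> = sqrt (x powr (3 / 4) * sqrt L) * sqrt (sqrt x)"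
        using x3 L1 by (simp add: real_sqrt_mult powr_half_sqrt[symmetric] powr_powr mult_ac flip: powr_add)
      also have "\<dots> \<le> sqrt (real l) * sqrt (real k)"
        using l(1) k x3 L1 by (intro mult_mono real_sqrt_le_mono) (auto simp: x_def L_def)
      finally show "x powr (5 / 8) * L powr (- (1 / 4)) \<le> sqrt (real l) * sqrt (real k)" .
    qed (use l0 k0 in auto)
    also have "\<dots> = 1 / 1000 * real l" using k0 l0 by simp
    finally show ?thesis .
  qed
  have "4 * real l / real n * (\<rho> * sqrt \<tau>) \<le> 4 * real l / x * (2 / 1000 * x)"
    using A l0 x3 unfolding x_def by (intro mult_left_mono) auto
  also have "\<dots> = 8 / 1000 * real l" using x3 by simp
  finally have "64 * (4 * real l / real n * (\<rho> * sqrt \<tau>) + 5 * \<rho> * sqrt (\<tau> / real k)) \<le> 64 * (8 / 1000 * real l + 5 * (1 / 1000 * real l))"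
    using B by simp
  also have "\<dots> < 2 * real l" using l0 by simp
  finally show ?thesis .
qed

text \<open>One exceptional set serves both conclusions; \<open>2 / real n < 1\<close> guarantees a
  matrix outside it, from which the bound for \<open>R1\<close> is read off.\<close>

lemma eventually_good:
  "\<forall>\<^sub>F n in sequentially. \<exists>B\<in>sets (gaussian_matrix n (n ^ 3)).
     0 < n \<and> measure (gaussian_matrix n (n ^ 3)) B \<le> 2 / real n \<and> 2 / real n < 1 \<and>
     (\<forall>G\<in>space (gaussian_matrix n (n ^ 3)) - B.
        ereal (bm_bound n)
          \<le> BM_dist n (mat_apply n (n ^ 3) G ` cross_polytope (n ^ 3)) (cross_polytope n) \<and>
        sym_convex_body n (mat_apply n (n ^ 3) G ` cross_polytope (n ^ 3)))"
  using eventually_dims eventually_l1_bad_small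
proof eventually_elim
  case (elim n)
  let ?x = "real n powr (3 / 4) * sqrt (ln (real n))"
  let ?m = "n ^ 3"
  let ?M = "gaussian_matrix n ?m"
  interpret prob_space ?M by (rule prob_space_gaussian_matrix)
  define l where "l = dim_gap n"
  define k where "k = sparsity n"
  define \<rho> where "\<rho> = bm_bound n"
  define \<tau> where "\<tau> = 160 * real l"
  have n3: "3 \<le> n" and L1: "1 \<le> ln (real n)" using elim by auto
  have l: "?x \<le> real l" "real l \<le> 2 * ?x"
    unfolding l_def dim_gap_def using nat_ceiling_bounds[of ?x] elim by auto
  have k: "sqrt (real n) \<le> real k" "real k \<le> 2 * sqrt (real n)"
    unfolding k_def sparsity_def using nat_ceiling_bounds[of "sqrt (real n)"] n3 by auto
  have "4 * real l \<le> real n" using l(2) elim by linarith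
  then have ln: "4 * l \<le> n" by linarith
  have l0: "0 < l" using l(1) elim by linarith
  have k0: "0 < k" using k(1) n3 by (cases k) auto
  have nm: "n \<le> ?m" by (cases n) (auto simp: power3_eq_cube)
  have \<rho>0: "\<rho> > 0" using n3 L1 bm_const_pos by (simp add: \<rho>_def)
  have \<tau>0: "\<tau> > 0" using l0 by (simp add: \<tau>_def)
  let ?B1 = "l1_bad n ?m" and ?B2 = "greedy_bad n ?m k \<rho> l \<tau>"
  have B: "?B1 \<in> sets ?M" "?B2 \<in> sets ?M"
    using l1_bad_measure(1) greedy_bad_measure(1)[OF ln nm l0] by auto
  have "emeasure ?M (?B1 \<union> ?B2) \<le> emeasure ?M ?B1 + emeasure ?M ?B2"
    by (rule emeasure_subadditive[OF B])
  also have "\<dots> \<le> ennreal (1 / real n) + ennreal (1 / real n)"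
  proof (rule add_mono)
    show "emeasure ?M ?B1 \<le> ennreal (1 / real n)"
      using elim by (intro order_trans[OF l1_bad_measure(2)] ennreal_leI) simp
    show "emeasure ?M ?B2 \<le> ennreal (1 / real n)"
      by (rule order_trans[OF greedy_bad_measure(2)[OF ln nm l0]], rule ennreal_leI, unfold \<tau>_def,
          rule greedy_bad_small) (use n3 L1 l k ln l0 elim in auto)
  qed
  also have "\<dots> = ennreal (2 / real n)" by (subst ennreal_plus[symmetric]) auto
  finally have meas: "measure ?M (?B1 \<union> ?B2) \<le> 2 / real n"
    by (simp add: emeasure_eq_measure)
  have est: "64 * (4 * real l / real n * (\<rho> * sqrt \<tau>) + 5 * \<rho> * sqrt (\<tau> / real k)) < 2 * real l"
    unfolding \<rho>_def \<tau>_def by (rule estimate_small[OF n3 L1 l k(1)])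
  show ?case
  proof (intro bexI[of _ "?B1 \<union> ?B2"] conjI ballI)
    fix G assume G: "G \<in> space ?M - (?B1 \<union> ?B2)"
    show "ereal (bm_bound n)
          \<le> BM_dist n (mat_apply n ?m G ` cross_polytope ?m) (cross_polytope n)"
      unfolding \<rho>_def[symmetric]
      by (rule BM_dist_ge_of_good[OF _ _ _ l0 ln nm k0 \<rho>0 \<tau>0 est]) (use G in auto)
    show "sym_convex_body n (mat_apply n ?m G ` cross_polytope ?m)"
      by (rule sym_convex_body_of_good) (use G n3 in auto)
  qed (use B meas n3 in auto)
qed

theorem theorem1p1:
  shows "\<exists>c C :: real. c > 0 \<and> C > 0 \<and>
    (\<forall>\<^sub>F n :: nat in sequentially.
       measure (gaussian_matrix n (n ^ 3))
         {\<Gamma> \<in> space (gaussian_matrix n (n ^ 3)).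
            BM_dist n (mat_apply n (n ^ 3) \<Gamma> ` cross_polytope (n ^ 3)) (cross_polytope n)
              \<ge> ereal (c * real n powr (5 / 8) * ln (real n) powr (- (1 / 4)))}
       \<ge> 1 - C / real n) \<and>
    (\<forall>\<^sub>F n :: nat in sequentially.
       R1 n \<ge> ereal (c * real n powr (5 / 8) * ln (real n) powr (- (1 / 4))))"
proof (rule exI[of _ bm_const], rule exI[of _ 2], intro conjI)
  show "\<forall>\<^sub>F n :: nat in sequentially.
       measure (gaussian_matrix n (n ^ 3))
         {\<Gamma> \<in> space (gaussian_matrix n (n ^ 3)).
            BM_dist n (mat_apply n (n ^ 3) \<Gamma> ` cross_polytope (n ^ 3)) (cross_polytope n)
              \<ge> ereal (bm_bound n)}
       \<ge> 1 - 2 / real n"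
    using eventually_good
  proof eventually_elim
    case (elim n)
    let ?M = "gaussian_matrix n (n ^ 3)"
    let ?E = "{\<Gamma> \<in> space ?M. BM_dist n (mat_apply n (n ^ 3) \<Gamma> ` cross_polytope (n ^ 3)) (cross_polytope n)
              \<ge> ereal (bm_bound n)}"
    interpret prob_space ?M by (rule prob_space_gaussian_matrix)
    obtain B where B: "B \<in> sets ?M" "0 < n" "measure ?M B \<le> 2 / real n" "space ?M - B \<subseteq> ?E"
      using elim by blast
    \<comment> \<open>Monotonicity needs this: \<open>measure\<close> assigns 0 to a set that is not
      measurable.\<close>
    have "?E \<in> sets ?M" using B(2) by (intro sets_BM_dist_ge) auto
    then have "measure ?M (space ?M - B) \<le> measure ?M ?E" by (intro finite_measure_mono B(4))
    then show ?case using prob_compl[OF B(1)] B(3) by simp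
  qed
  show "\<forall>\<^sub>F n :: nat in sequentially.
       R1 n \<ge> ereal (bm_bound n)"
    using eventually_good
  proof eventually_elim
    case (elim n)
    let ?M = "gaussian_matrix n (n ^ 3)"
    interpret prob_space ?M by (rule prob_space_gaussian_matrix)
    obtain B where B: "B \<in> sets ?M" "measure ?M B \<le> 2 / real n" "2 / real n < 1"
      "\<forall>G\<in>space ?M - B. ereal (bm_bound n)
          \<le> BM_dist n (mat_apply n (n ^ 3) G ` cross_polytope (n ^ 3)) (cross_polytope n) \<and>
        sym_convex_body n (mat_apply n (n ^ 3) G ` cross_polytope (n ^ 3))"
      using elim by blast
    have "measure ?M (space ?M - B) > 0"
      using prob_compl[OF B(1)] B(2,3) by linarith
    then have "space ?M - B \<noteq> {}" by (metis less_irrefl measure_empty)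
    then obtain G where "G \<in> space ?M - B" by blast
    with B(4) show ?case
      unfolding R1_def by (auto intro: SUP_upper2)
  qed
qed (simp_all add: bm_const_pos)

end
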